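(* Let $p,q>0$ and let $P_{k,n}$ be the monic polynomials defined in the context (with parameters $\alpha=pn$, $\nu=qn$). Let $\nu(P_{k,n})=\frac1k\sum_{P_{k,n}(x)=0}\delta_x$ be the normalized zero counting measure of $P_{k,n}$. Then for every $\xi>0$, as $k,n\to\infty$ with $k/n\to\xi$, the measures $\nu(P_{k,n})$ converge weakly to the probability measure $$\nu_1^\xi=\frac1\xi\int_0^\xi\mu_1^s\,ds,$$ where $\mu_1^s$ is the measure defined in the context.
   Context: Polynomials: for $p,q>0$ and $n\in\mathbb N$ put $\alpha=pn$, $\nu=qn$, and let $P_{k,n}$ be generated by $P_{0,n}\equiv1$, $P_{-1,n}\equiv P_{-2,n}\equiv0$ and, for $k\ge0$, $$xP_{k,n}(x)=P_{k+1,n}(x)+b_{k,n}P_{k,n}(x)+c_{k,n}P_{k-1,n}(x)+d_{k,n}P_{k-2,n}(x),$$ $$b_{k,n}=\frac{(k+\alpha+1)(3k+\alpha+2\nu)-(\alpha+1)(\nu-1)}{n^2},\quad c_{k,n}=\frac{k(k+\alpha)(k+\alpha+\nu)(3k+2\alpha+\nu)}{n^4},$$ $$d_{k,n}=\frac{k(k-1)(k+\alpha-1)(k+\alpha)(k+\alpha+\nu-1)(k+\alpha+\nu)}{n^6}.$$ (Equivalently $P_{k,n}(x)=n^{-2k}P_k(n^2x)$, where $P_{2k}$, $P_{2k+1}$ are the monic type II multiple orthogonal polynomials of multi-indices $(k,k)$, $(k+1,k)$ for the weights $x^\alpha\rho_\nu(x)$, $x^\alpha\rho_{\nu+1}(x)$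 on $(0,\infty)$, with $\rho_\nu(x)=2x^{\nu/2}K_\nu(2\sqrt x)$ and $K_\nu$ the modified Bessel function of the second kind.) Weak convergence means convergence of integrals of every bounded continuous function on $\mathbb R$. Measure $\mu_1^s$: for $s>0$ let $$A_s(z)=\frac{(z+s(s+p))(z+s(s+p+q))(z+(s+p)(s+p+q))}{z^2},$$ and for $x\in\mathbb C$ let $z_1(x,s),z_2(x,s),z_3(x,s)$ be the three solutions (with multiplicity) of $A_s(z)=x$, ordered so that $|z_1(x,s)|\ge|z_2(x,s)|\ge|z_3(x,s)|>0$. The set $\Gamma_1(s)=\{x\in\mathbb C:|z_1(x,s)|=|z_2(x,s)|\}$ is a compact interval in $(0,\infty)$, and $\mu_1^s$ is the probability measure on $\Gamma_1(s)$ given by $$d\mu_1^s(x)=\frac{1}{2\pi i}\left(\frac{z_{1-}'(x,s)}{z_{1-}(x,s)}-\frac{z_{1+}'(x,s)}{z_{1+}(x,s)}\right)dx,$$ where $'$ is the derivative with respect to $x$ and $z_{1\pm}(x,s)$ is the limit of $z_1(\tilde x,s)$ as $\tilde x\to x$ from the upper ($+$) or lower ($-$) half-plane. *)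

theory Defs
  imports "HOL-Probability.Probability" "HOL-Computational_Algebra.Polynomial"
begin

definition b_coeff :: "real \<Rightarrow> real \<Rightarrow> nat \<Rightarrow> nat \<Rightarrow> real" where
  "b_coeff p q n k = (let \<alpha> = p * real n; \<nu> = q * real n; \<kappa> = real k in
     ((\<kappa> + \<alpha> + 1) * (3 * \<kappa> + \<alpha> + 2 * \<nu>) - (\<alpha> + 1) * (\<nu> - 1)) / real n ^ 2)"

definition c_coeff :: "real \<Rightarrow> real \<Rightarrow> nat \<Rightarrow> nat \<Rightarrow> real" where
  "c_coeff p q n k = (let \<alpha> = p * real n; \<nu> = q * real n; \<kappa> = real k in
     \<kappa> * (\<kappa> + \<alpha>) * (\<kappa> + \<alpha> + \<nu>) * (3 * \<kappa> + 2 * \<alpha> + \<nu>) / real n ^ 4)"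

definition d_coeff :: "real \<Rightarrow> real \<Rightarrow> nat \<Rightarrow> nat \<Rightarrow> real" where
  "d_coeff p q n k = (let \<alpha> = p * real n; \<nu> = q * real n; \<kappa> = real k in
     \<kappa> * (\<kappa> - 1) * (\<kappa> + \<alpha> - 1) * (\<kappa> + \<alpha>) * (\<kappa> + \<alpha> + \<nu> - 1) * (\<kappa> + \<alpha> + \<nu>) / real n ^ 6)"

text \<open>The argument order is n before k, since the recursion is in k for fixed n.
  The two conditionals encode that the polynomials of index -1 and -2 vanish.\<close>

fun P_poly :: "real \<Rightarrow> real \<Rightarrow> nat \<Rightarrow> nat \<Rightarrow> real poly" where
  "P_poly p q n 0 = 1"
| "P_poly p q n (Suc k) =
     [:- b_coeff p q n k, 1:] * P_poly p q n k
     - smult (c_coeff p q n k) (if k \<ge> 1 then P_poly p q n (k - 1) else 0)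
     - smult (d_coeff p q n k) (if k \<ge> 2 then P_poly p q n (k - 2) else 0)"

text \<open>Zeros are counted with multiplicity. The measure lives on the real line; no mass is
  redistributed to compensate for non-real zeros, the normalisation being always 1/k.\<close>

definition zero_measure :: "real \<Rightarrow> real \<Rightarrow> nat \<Rightarrow> nat \<Rightarrow> real measure" where
  "zero_measure p q n k =
     distr (point_measure {x. poly (P_poly p q n k) x = 0}
              (\<lambda>x. ennreal (real (order x (P_poly p q n k)) / real k)))
       borel (\<lambda>x. x)"

text \<open>The library's \<^const>\<open>weak_conv_m\<close> is phrased through distribution functions; here weak
  convergence is convergence of integrals of bounded continuous functions.\<close>

definition weakly_converges :: "(nat \<Rightarrow> real measure) \<Rightarrow> real measure \<Rightarrow> bool" where
  "weakly_converges M N \<longleftrightarrow>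
     (\<forall>f :: real \<Rightarrow> real. continuous_on UNIV f \<and> bounded (range f) \<longrightarrow>
        (\<lambda>j. \<integral>x. f x \<partial>(M j)) \<longlonglongrightarrow> (\<integral>x. f x \<partial>N))"

definition A_symb :: "real \<Rightarrow> real \<Rightarrow> real \<Rightarrow> complex \<Rightarrow> complex" where
  "A_symb p q s z =
     (z + of_real (s * (s + p))) * (z + of_real (s * (s + p + q)))
       * (z + of_real ((s + p) * (s + p + q))) / z ^ 2"

text \<open>The factorisation off the pole expresses that z 1, z 2, z 3 are the three solutions of
  A(z) = x, repeated according to multiplicity. Ties in modulus are broken arbitrarily: the
  set where the two largest moduli agree does not depend on the choice, and off that set
  the first solution is unique.\<close>

definition ordered_solutions ::
  "real \<Rightarrow> real \<Rightarrow> real \<Rightarrow> complex \<Rightarrow> (nat \<Rightarrow> complex) \<Rightarrow> bool" where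
  "ordered_solutions p q s x z \<longleftrightarrow>
     (\<forall>w. w \<noteq> 0 \<longrightarrow> A_symb p q s w - x = (w - z 1) * (w - z 2) * (w - z 3) / w ^ 2) \<and>
     norm (z 1) \<ge> norm (z 2) \<and> norm (z 2) \<ge> norm (z 3) \<and> norm (z 3) > 0"

definition zsol :: "real \<Rightarrow> real \<Rightarrow> nat \<Rightarrow> complex \<Rightarrow> real \<Rightarrow> complex" where
  "zsol p q j x s = (SOME z. ordered_solutions p q s x z) j"

definition Gamma1 :: "real \<Rightarrow> real \<Rightarrow> real \<Rightarrow> complex set" where
  "Gamma1 p q s = {x. norm (zsol p q 1 x s) = norm (zsol p q 2 x s)}"

definition z1_plus :: "real \<Rightarrow> real \<Rightarrow> real \<Rightarrow> real \<Rightarrow> complex" where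
  "z1_plus p q s x = Lim (at (of_real x) within {w. Im w > 0}) (\<lambda>w. zsol p q 1 w s)"

definition z1_minus :: "real \<Rightarrow> real \<Rightarrow> real \<Rightarrow> real \<Rightarrow> complex" where
  "z1_minus p q s x = Lim (at (of_real x) within {w. Im w < 0}) (\<lambda>w. zsol p q 1 w s)"

definition mu1_density :: "real \<Rightarrow> real \<Rightarrow> real \<Rightarrow> real \<Rightarrow> complex" where
  "mu1_density p q s x =
     1 / (2 * of_real pi * \<i>) *
       (vector_derivative (z1_minus p q s) (at x) / z1_minus p q s x
        - vector_derivative (z1_plus p q s) (at x) / z1_plus p q s x)"

text \<open>The two boundary values of the first solution are complex conjugates of each other, so the
  density is already real in the interior of the interval and Re is only a coercion.\<close>

definition mu1 :: "real \<Rightarrow> real \<Rightarrow> real \<Rightarrow> real measure" where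
  "mu1 p q s = density lborel
     (\<lambda>x. ennreal (Re (mu1_density p q s x)) * indicator {x. of_real x \<in> Gamma1 p q s} x)"

definition nu1 :: "real \<Rightarrow> real \<Rightarrow> real \<Rightarrow> real measure" where
  "nu1 p q \<xi> = measure_of UNIV (sets borel)
     (\<lambda>B. ennreal (1 / \<xi>) * (\<integral>\<^sup>+s\<in>{0<..<\<xi>}. emeasure (mu1 p q s) B \<partial>lborel))"

end

theory Submission
  imports Defs "HOL-Complex_Analysis.Complex_Analysis" "HOL-Computational_Algebra.Fundamental_Theorem_Algebra"
begin

text \<open>
  Zeros. The polynomials are multiples of \<open>1F2(-k; \<alpha> + 1, \<alpha> + \<nu> + 1; n\<^sup>2 x)\<close>. Laguerre's multiplier
  theorem shows that all their zeros are positive. The hypergeometric differential equation, written for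
  \<open>u = x P' / (n P)\<close> at \<open>x = -y < 0\<close>, degenerates to \<open>U (U + p) (U + p + q) = y (\<xi> - U)\<close>, so that
  the Stieltjes transforms of the zero measures at \<open>-y\<close> converge to \<open>U / (\<xi> y)\<close>.

  Limit measure. With \<open>a = s\<close>, \<open>b = s + p\<close>, \<open>c = s + p + q\<close> and \<open>z = - a b c / w\<close>, the equation \<open>A z = x\<close>
  becomes \<open>(w - a) (w - b) (w - c) = x w\<close>. On the interior of the support it has one zero \<open>u > c\<close> and a
  conjugate pair \<open>r e\<^sup>\<plusminus>\<^sup>i\<^sup>\<theta>\<close> of smaller modulus, where \<open>r\<^sup>2 = a b c / u\<close> and
  \<open>2 r cos \<theta> = a + b + c - u\<close>. The density of \<open>\<mu>\<^sub>1\<^sup>s\<close> is \<open>\<theta>'(x) / \<pi>\<close>: the angle \<open>\<theta>\<close> is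
  uniformly distributed on \<open>(0, \<pi>)\<close>. Cauchy's formula along \<open>\<theta> \<mapsto> r e\<^sup>i\<^sup>\<theta>\<close> gives the Stieltjes transform
  of \<open>\<mu>\<^sub>1\<^sup>s\<close>, and the substitution \<open>s = U + U (U + p) (U + p + q) / y\<close> integrates it over \<open>s\<close> to the
  same value \<open>U / (\<xi> y)\<close>.
\<close>

section \<open>An explicit formula for the polynomials\<close>

text \<open>Stieltjes transforms are used only at negative points -y. There every y / (y + r) lies
  in (0, 1], the limiting cubic has exactly one nonnegative solution, and no branch has to be
  selected. Positivity of the zeros enters twice: \<open>zero_measure\<close> sees only real zeros,
  and the corrections in the Riccati equation are bounded by means of it. These transforms suffice
  because 1 / (1 + x) maps the half line injectively into [0, 1], where polynomials are dense, and
  no mass escapes since the limit is a probability measure. The two computations meet because v = s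
  - U is the zero below a of the cubic at x = -y; the transform of \<open>mu1\<close> is then y^(-1)
  divided by ds/dU, so the substitution leaves a constant integrand. The delicate points about
  \<open>mu1\<close> are that \<open>zsol\<close> is an unspecified choice at ties, and that its
  one-sided limits must be matched with the right member of the conjugate pair. Ties off the open
  arc are confined to a finite set by a case analysis of real and conjugate zeros; the side is
  decided by a sign argument on imaginary parts (\<open>roots3_sign\<close>).\<close>

definition w_coeff :: "real \<Rightarrow> real \<Rightarrow> nat \<Rightarrow> nat \<Rightarrow> real" where
  "w_coeff p q n i = (p * real n + real i) * (p * real n + q * real n + real i) / real n ^ 2"

text \<open>Up to the sign \<open>(-1)^k\<close> this is the constant term of
  \<open>P_poly p q n k\<close>, so dividing by it normalizes the polynomial to the value 1 at
  0.\<close>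

definition e_coeff :: "real \<Rightarrow> real \<Rightarrow> nat \<Rightarrow> nat \<Rightarrow> real" where
  "e_coeff p q n k = (\<Prod>i=1..k. w_coeff p q n i)"

lemma e_coeff_0 [simp]: "e_coeff p q n 0 = 1"
  by (simp add: e_coeff_def)

lemma e_coeff_Suc: "e_coeff p q n (Suc k) = e_coeff p q n k * w_coeff p q n (Suc k)"
  by (simp add: e_coeff_def)

lemma w_coeff_pos:
  assumes "p > 0" "q > 0" "n > 0"
  shows "w_coeff p q n i > 0"
  using assms unfolding w_coeff_def by (intro divide_pos_pos mult_pos_pos add_pos_nonneg) auto

lemma e_coeff_pos:
  assumes "p > 0" "q > 0" "n > 0"
  shows "e_coeff p q n k > 0"
  unfolding e_coeff_def using w_coeff_pos[OF assms] by (intro prod_pos) auto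

text \<open>Multiplying these coefficients by \<open>(-1)\<^sup>k E k\<close> gives the monic polynomials.\<close>

definition h_coeff :: "real \<Rightarrow> real \<Rightarrow> nat \<Rightarrow> nat \<Rightarrow> nat \<Rightarrow> real" where
  "h_coeff p q n k j = (-1) ^ j * real (k choose j) / e_coeff p q n j"

text \<open>Stated over the reals with truncated \<open>k - 1\<close>, so that \<open>k = 0\<close>
  and \<open>j > k\<close> need no side condition later.\<close>

lemma binom_shift_down: "real k * real ((k - 1) choose j) = (real k - real j) * real (k choose j)"
proof (cases "k = 0")
  case True then show ?thesis by (cases j) auto
next
  case False
  then obtain m where m: "k = Suc m" by (cases k) auto
  show ?thesis
  proof (cases "j \<le> m")
    case True
    have "Suc m * (m choose j) = (Suc m - j) * (Suc m choose j)"
      using binomial_absorb_comp[of "Suc m" j] by simp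
    then have "real (Suc m * (m choose j)) = real ((Suc m - j) * (Suc m choose j))" by simp
    then have "real (Suc m) * real (m choose j) = real (Suc m - j) * real (Suc m choose j)" by (simp only: of_nat_mult)
    then show ?thesis using True m by (simp add: of_nat_diff)
  next
    case F: False
    then have "m choose j = 0" by (simp add: binomial_eq_0)
    moreover have "j = Suc m \<or> Suc m choose j = 0" using F by (auto simp: not_le binomial_eq_0)
    ultimately show ?thesis using m by (auto simp: binomial_eq_0)
  qed
qed

lemma binom_shift_lower: "(real k - real j) * real (k choose j) = (real j + 1) * real (k choose Suc j)"
proof (cases "j \<le> k")
  case True
  have "Suc j * (k choose Suc j) = (k - j) * (k choose j)"
    using binomial_absorption[of j k] binomial_absorb_comp[of k j] by simp
  then have "real (Suc j * (k choose Suc j)) = real ((k - j) * (k choose j))" by simp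
  then have "real (Suc j) * real (k choose Suc j) = real (k - j) * real (k choose j)" by (simp only: of_nat_mult)
  then show ?thesis using True by (simp add: of_nat_diff algebra_simps)
qed (simp add: binomial_eq_0)

text \<open>After the common factor \<open>(-1)^j / e_coeff p q n j\<close> is removed, only
  binomial coefficients remain. The shifts in k are absorbed by the factors k and k (k - 1), which
  also vanish where the index subtraction truncates, and everything reduces to the two neighbours
  \<open>B\<close> and \<open>C\<close>.\<close>

lemma h_coeff_recurrence:
  assumes p: "p > 0" "q > 0" "n > 0"
  defines "w \<equiv> w_coeff p q n"
  shows "(if j = 0 then 0 else h_coeff p q n k (j - 1)) =
     - w (Suc k) * h_coeff p q n (Suc k) j + b_coeff p q n k * h_coeff p q n k j
     - real k * (3 * real k + 2 * p * real n + q * real n) / real n ^ 2 * h_coeff p q n (k - 1) j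
     + real k * (real k - 1) / real n ^ 2 * h_coeff p q n (k - 2) j"
proof -
  define \<alpha> \<nu> N where "\<alpha> = p * real n" and "\<nu> = q * real n" and "N = real n"
  have N: "N > 0" using p by (simp add: N_def)
  define B where "B = (if j = 0 then 0 else real (k choose (j - 1)))"
  define C where "C = real (k choose j)"
  have BC: "real (Suc k choose j) = B + C" unfolding B_def C_def by (cases j) auto
  have B: "(real k - real j + 1) * B = real j * C"
    unfolding B_def C_def using binom_shift_lower[of k "j - 1"] by (cases j) auto
  have k1: "real k * real ((k - 1) choose j) = (real k - real j) * C"
    unfolding C_def by (rule binom_shift_down)
  have k2: "real k * (real k - 1) * real ((k - 2) choose j) = (real k - real j) * (real k - 1 - real j) * C"
  proof (cases "k = 0")
    case False
    have "(real k - 1) * real ((k - 2) choose j) = (real k - 1 - real j) * real ((k - 1) choose j)"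
      using binom_shift_down[of "k - 1" j] False by (simp add: numeral_2_eq_2)
    then have "real k * ((real k - 1) * real ((k - 2) choose j))
       = (real k - 1 - real j) * (real k * real ((k - 1) choose j))" by simp
    also have "\<dots> = (real k - 1 - real j) * ((real k - real j) * C)" unfolding k1 ..
    finally show ?thesis by (simp only: mult_ac)
  qed (use C_def in \<open>cases j; simp\<close>)
  have E: "e_coeff p q n j > 0" by (rule e_coeff_pos[OF p])
  have w: "w i = (\<alpha> + real i) * (\<alpha> + \<nu> + real i) / N^2" for i
    unfolding w_def w_coeff_def \<alpha>_def \<nu>_def N_def by simp
  have b: "b_coeff p q n k = ((real k + \<alpha> + 1) * (3 * real k + \<alpha> + 2 * \<nu>) - (\<alpha> + 1) * (\<nu> - 1)) / N^2"
    unfolding b_coeff_def \<alpha>_def \<nu>_def N_def by (simp add: Let_def)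
  have L: "(if j = 0 then 0 else h_coeff p q n k (j - 1)) = (-1)^j / e_coeff p q n j * (- (B * w j))"
  proof (cases j)
    case (Suc i)
    have "w j \<noteq> 0" "e_coeff p q n i \<noteq> 0" using w_coeff_pos[OF p, of j] e_coeff_pos[OF p, of i]
      by (auto simp: w_def)
    then show ?thesis unfolding h_coeff_def B_def using Suc by (simp add: e_coeff_Suc w_def field_simps)
  qed (simp add: B_def)
  have main: "- (B * w j) = - w (Suc k) * (B + C) + b_coeff p q n k * C
       - (3 * real k + 2 * \<alpha> + \<nu>) / N^2 * ((real k - real j) * C)
       + 1 / N^2 * ((real k - real j) * (real k - 1 - real j) * C)"
  proof -
    \<comment> \<open>Both values of \<open>w\<close> come from the same quadratic, so their
      difference contains the factor k + 1 - j, which is exactly what turns \<open>B\<close> into a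
      multiple of \<open>C\<close>.\<close>
    have "B * (w (Suc k) - w j) * N^2 = (real k - real j + 1) * B * (2 * \<alpha> + \<nu> + real k + 1 + real j)"
      unfolding w using N by (simp add: field_simps)
    also have "\<dots> = real j * C * (2 * \<alpha> + \<nu> + real k + 1 + real j)" unfolding B ..
    finally have 1: "B * (w (Suc k) - w j) * N^2 = real j * C * (2 * \<alpha> + \<nu> + real k + 1 + real j)" .
    have "(- w (Suc k) * C + b_coeff p q n k * C
       - (3 * real k + 2 * \<alpha> + \<nu>) / N^2 * ((real k - real j) * C)
       + 1 / N^2 * ((real k - real j) * (real k - 1 - real j) * C)) * N^2 =
         real j * C * (2 * \<alpha> + \<nu> + real k + 1 + real j)"
      unfolding w b using N by (simp add: field_simps)
    with 1 have "(B * (w (Suc k) - w j)) * N^2 = (- w (Suc k) * C + b_coeff p q n k * C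
       - (3 * real k + 2 * \<alpha> + \<nu>) / N^2 * ((real k - real j) * C)
       + 1 / N^2 * ((real k - real j) * (real k - 1 - real j) * C)) * N^2" by simp
    then have "(B * (w (Suc k) - w j)) = (- w (Suc k) * C + b_coeff p q n k * C
       - (3 * real k + 2 * \<alpha> + \<nu>) / N^2 * ((real k - real j) * C)
       + 1 / N^2 * ((real k - real j) * (real k - 1 - real j) * C))" using N by simp
    then show ?thesis by (simp add: algebra_simps)
  qed
  define s where "s = (-1)^j / e_coeff p q n j"
  have h: "h_coeff p q n m j = s * real (m choose j)" for m
    unfolding h_coeff_def s_def by simp
  have "s * (- (B * w j)) = - w (Suc k) * (s * (B + C)) + b_coeff p q n k * (s * C)
       - (3 * real k + 2 * \<alpha> + \<nu>) / N^2 * (s * (real k * real ((k - 1) choose j)))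
       + 1 / N^2 * (s * (real k * (real k - 1) * real ((k - 2) choose j)))"
    unfolding main k1 k2 by (simp add: algebra_simps)
  then show ?thesis unfolding L h BC s_def[symmetric] C_def[symmetric]
    by (simp add: \<alpha>_def \<nu>_def N_def algebra_simps add_divide_distrib diff_divide_distrib)
qed

text \<open>Strong induction, as the recursion reaches three indices back. \<open>c_coeff\<close>
  and \<open>d_coeff\<close> contain one and two factors \<open>w_coeff\<close>, precisely those by
  which \<open>e_coeff\<close> at the lower index falls short of \<open>e_coeff\<close> at the
  current one.\<close>

lemma coeff_P_poly:
  assumes p: "p > 0" "q > 0" "n > 0"
  shows "coeff (P_poly p q n k) j = (-1) ^ k * e_coeff p q n k * h_coeff p q n k j"
proof (induction k arbitrary: j rule: less_induct)
  case (less k)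
  show ?case
  proof (cases k)
    case 0
    then show ?thesis by (cases j) (auto simp: h_coeff_def)
  next
    case (Suc m)
    define w where "w = w_coeff p q n"
    define E where "E = e_coeff p q n"
    define s where "s = ((-1)::real)^m"
    have N: "real n > 0" using p by simp
    have IH: "coeff (P_poly p q n i) j = (-1) ^ i * E i * h_coeff p q n i j" if "i \<le> m" for i j
      using less[of i j] that Suc by (simp add: E_def)
    have wp: "w i > 0" for i unfolding w_def by (rule w_coeff_pos[OF p])
    have A: "coeff ([:- b_coeff p q n m, 1:] * P_poly p q n m) j =
       s * E m * ((if j = 0 then 0 else h_coeff p q n m (j - 1)) - b_coeff p q n m * h_coeff p q n m j)"
      using IH[of m] by (cases j) (auto simp: s_def algebra_simps)
    have B: "coeff (smult (c_coeff p q n m) (if m \<ge> 1 then P_poly p q n (m - 1) else 0)) j =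
       - s * E m * (real m * (3 * real m + 2 * p * real n + q * real n) / real n ^ 2 * h_coeff p q n (m - 1) j)"
    proof (cases m)
      case (Suc i)
      have c: "c_coeff p q n m = w m * (real m * (3 * real m + 2 * p * real n + q * real n) / real n ^ 2)"
        unfolding c_coeff_def w_def w_coeff_def Let_def using N
        by (simp add: field_simps power4_eq_xxxx power2_eq_square)
      have "E m = E i * w m" unfolding E_def w_def Suc by (rule e_coeff_Suc)
      then show ?thesis using IH[of i] Suc unfolding c s_def by simp
    qed simp
    have C: "coeff (smult (d_coeff p q n m) (if m \<ge> 2 then P_poly p q n (m - 2) else 0)) j =
       s * E m * (real m * (real m - 1) / real n ^ 2 * h_coeff p q n (m - 2) j)"
    proof (cases "m \<ge> 2")
      case True
      then obtain i where i: "m = Suc (Suc i)" by (metis Suc_diff_Suc Suc_le_lessD diff_zero less_2_cases_iff not_less not_less_eq numeral_2_eq_2 Suc_le_D)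
      have d: "d_coeff p q n m = w m * w (m - 1) * (real m * (real m - 1) / real n ^ 2)"
        unfolding d_coeff_def w_def w_coeff_def Let_def using N i
        by (simp add: field_simps eval_nat_numeral)
      have "E m = E i * w (m - 1) * w m" unfolding E_def w_def i by (simp add: e_coeff_Suc)
      then show ?thesis using IH[of i] True i unfolding d s_def by simp
    next
      case False
      then have "m = 0 \<or> m = 1" by auto
      then show ?thesis by auto
    qed
    have "coeff (P_poly p q n k) j = s * E m * (((if j = 0 then 0 else h_coeff p q n m (j - 1)) - b_coeff p q n m * h_coeff p q n m j)
      + (real m * (3 * real m + 2 * p * real n + q * real n) / real n ^ 2 * h_coeff p q n (m - 1) j)
      - (real m * (real m - 1) / real n ^ 2 * h_coeff p q n (m - 2) j))"
    proof -
      have "s * E m * x - (- s * E m * y) - s * E m * z = s * E m * (x + y - z)" for x y z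
        by (simp add: algebra_simps)
      then show ?thesis unfolding Suc P_poly.simps(2) coeff_diff A B C by blast
    qed
    also have "\<dots> = s * E m * (- w (Suc m) * h_coeff p q n (Suc m) j)"
      unfolding h_coeff_recurrence[OF p, of j m] w_def[symmetric] by (rule arg_cong[where f = "\<lambda>x. s * E m * x"]) linarith
    also have "\<dots> = (-1) ^ k * E k * h_coeff p q n k j"
      unfolding Suc s_def E_def w_def by (simp add: e_coeff_Suc)
    finally show ?thesis unfolding E_def .
  qed
qed

text \<open>The ratio of consecutive hypergeometric coefficients; it is the differential equation
  \<open>P_poly_ode\<close> read off coefficient by coefficient.\<close>

lemma coeff_P_poly_lower:
  assumes p: "p > 0" "q > 0" "n > 0"
  shows "real (Suc j) * w_coeff p q n (Suc j) * coeff (P_poly p q n k) (Suc j)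
     = (real j - real k) * coeff (P_poly p q n k) j"
proof -
  have "w_coeff p q n (Suc j) > 0" "e_coeff p q n j > 0"
    by (rule w_coeff_pos[OF p], rule e_coeff_pos[OF p])
  moreover define S where "S = (-1)^k * e_coeff p q n k * (-1)^j / e_coeff p q n j"
  moreover define C0 where "C0 = real (k choose j)"
  moreover define C1 where "C1 = real (k choose Suc j)"
  ultimately have "real (Suc j) * w_coeff p q n (Suc j) * coeff (P_poly p q n k) (Suc j) = - (S * ((real j + 1) * C1))"
    "(real j - real k) * coeff (P_poly p q n k) j = - (S * ((real k - real j) * C0))"
    unfolding coeff_P_poly[OF p] h_coeff_def e_coeff_Suc C0_def[symmetric] C1_def[symmetric]
    by (simp_all add: S_def) (simp_all add: field_simps)
  then show ?thesis using binom_shift_lower[of k j] by (simp add: C0_def C1_def)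
qed

section \<open>Positivity of the zeros\<close>

text \<open>Quantifying over complex zeros expresses real-rootedness and positivity at once. Nonzero
  constants qualify, the zero polynomial does not.\<close>

definition pos_rooted :: "complex poly \<Rightarrow> bool" where
  "pos_rooted f \<longleftrightarrow> (\<forall>z. poly f z = 0 \<longrightarrow> z \<in> complex_of_real ` {0<..})"

lemma pos_rooted_nonzero: "pos_rooted f \<Longrightarrow> f \<noteq> 0"
proof
  assume "pos_rooted f" "f = 0"
  then have "(0::complex) \<in> complex_of_real ` {0<..}" unfolding pos_rooted_def by (metis poly_0)
  then show False by auto
qed

text \<open>The action of a multiplier sequence on a polynomial, the setting of Laguerre's
  theorem.\<close>

definition coeff_scale :: "(nat \<Rightarrow> real) \<Rightarrow> complex poly \<Rightarrow> complex poly" where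
  "coeff_scale w f = (\<Sum>j\<le>degree f. monom (of_real (w j) * coeff f j) j)"

lemma coeff_coeff_scale: "coeff (coeff_scale w f) j = of_real (w j) * coeff f j"
  unfolding coeff_scale_def by (auto simp: coeff_sum coeff_eq_0 not_le)

lemma degree_coeff_scale:
  assumes "\<And>j. w j \<noteq> 0"
  shows "degree (coeff_scale w f) = degree f"
proof (rule antisym)
  show "degree (coeff_scale w f) \<le> degree f"
    by (rule degree_le) (auto simp: coeff_coeff_scale coeff_eq_0)
  show "degree f \<le> degree (coeff_scale w f)"
    by (rule degree_le) (metis assms coeff_coeff_scale coeff_eq_0 mult_eq_0_iff of_real_eq_0_iff)
qed

lemma poly_pderiv_prod_linear:
  fixes r :: "nat \<Rightarrow> 'a::field_char_0"
  assumes "\<And>i. i < d \<Longrightarrow> z \<noteq> r i"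
  shows "poly (pderiv (\<Prod>i<d. [:-r i, 1:])) z = poly (\<Prod>i<d. [:-r i, 1:]) z * (\<Sum>i<d. 1 / (z - r i))"
  using assms
proof (induction d)
  case (Suc d)
  have "z - r d \<noteq> 0" using Suc.prems[of d] by simp
  moreover define F where "F = (\<Prod>i<d. [:-r i, 1:])"
  ultimately have "poly (pderiv (F * [:- r d, 1:])) z = poly (F * [:- r d, 1:]) z * ((\<Sum>i<d. 1 / (z - r i)) + 1 / (z - r d))"
    unfolding pderiv_mult poly_add poly_mult using Suc.IH Suc.prems
    by (simp add: F_def[symmetric] pderiv_pCons) (simp add: field_simps)
  then show ?case by (simp only: prod.lessThan_Suc sum.lessThan_Suc F_def)
qed (simp add: pderiv_1)

text \<open>The new polynomial is z f' + \<beta> f, so a zero z off the positive axis satisfies: the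
  sum of z / (z - r) over the zeros r of f equals -\<beta>. Because each r is positive, the
  imaginary part of this sum vanishes only if z is real, hence z \<le> 0, or if
  \<open>B = 0\<close>. In both cases the real part is nonnegative, which contradicts \<beta> >
  0.\<close>

lemma pos_rooted_euler:
  assumes f: "pos_rooted f" and \<beta>: "\<beta> > 0"
  shows "pos_rooted (coeff_scale (\<lambda>j. real j + \<beta>) f)"
  unfolding pos_rooted_def
proof (intro allI impI, rule ccontr)
  fix z assume z: "poly (coeff_scale (\<lambda>j. real j + \<beta>) f) z = 0"
    and nz: "z \<notin> complex_of_real ` {0<..}"
  obtain r where r: "smult (lead_coeff f) (\<Prod>i<degree f. [:-r i, 1:]) = f"
    using complex_poly_decompose' by blast
  define d where "d = degree f"
  define c where "c = lead_coeff f"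
  have c: "c \<noteq> 0" using pos_rooted_nonzero[OF f] by (simp add: c_def)
  have f_eq: "f = smult c (\<Prod>i<d. [:-r i, 1:])" using r by (simp add: c_def d_def)
  have root: "r i \<in> complex_of_real ` {0<..}" if "i < d" for i
  proof -
    have "poly f (r i) = 0" unfolding f_eq using that by (auto simp: poly_prod)
    then show ?thesis using f by (simp add: pos_rooted_def)
  qed
  have zr: "z \<noteq> r i" if "i < d" for i using root[OF that] nz by auto
  have Re_root: "Re (r i) > 0" if "i < d" for i using root[OF that] by auto
  have fz: "poly f z \<noteq> 0" using f nz by (auto simp: pos_rooted_def)
  have eq: "coeff_scale (\<lambda>j. real j + \<beta>) f = pCons 0 (pderiv f) + smult (of_real \<beta>) f"
    by (rule poly_eqI) (auto simp: coeff_coeff_scale coeff_pCons coeff_pderiv algebra_simps split: nat.split)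
  define S where "S = (\<Sum>i<d. z / (z - r i))"
  have "poly (pderiv f) z = poly f z * (\<Sum>i<d. 1 / (z - r i))"
    using poly_pderiv_prod_linear[of d z r, OF zr] unfolding f_eq by (simp add: pderiv_smult)
  then have "poly f z * (S + of_real \<beta>) = 0"
    using z unfolding eq S_def by (simp add: algebra_simps sum_distrib_left)
  then have S: "S = - of_real \<beta>" using fz by (simp add: add_eq_0_iff2)
  define A where "A = (\<Sum>i<d. 1 / (cmod (z - r i))\<^sup>2)"
  define B where "B = (\<Sum>i<d. Re (r i) / (cmod (z - r i))\<^sup>2)"
  have A0: "A \<ge> 0" unfolding A_def by (intro sum_nonneg) auto
  have B0: "B \<ge> 0" unfolding B_def using Re_root by (intro sum_nonneg divide_nonneg_nonneg) (auto simp: less_imp_le)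
  have summand: "z / (z - r i) = Complex (((cmod z)\<^sup>2 - Re z * Re (r i)) / (cmod (z - r i))\<^sup>2)
        (- Im z * Re (r i) / (cmod (z - r i))\<^sup>2)" if i: "i < d" for i
  proof -
    obtain \<rho> where \<rho>: "r i = of_real \<rho>" using root[OF i] by auto
    show ?thesis unfolding \<rho> complex_div_cnj[of z]
      by (simp add: complex_eq_iff Re_divide_of_real Im_divide_of_real cmod_power2 diff_divide_distrib[symmetric] add_divide_distrib[symmetric])
        (simp add: algebra_simps power2_eq_square)
  qed
  have "Re S = (\<Sum>i<d. ((cmod z)\<^sup>2 - Re z * Re (r i)) / (cmod (z - r i))\<^sup>2)"
    unfolding S_def Re_sum by (intro sum.cong refl) (simp add: summand)
  also have "\<dots> = (cmod z)\<^sup>2 * A - Re z * B"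
    unfolding A_def B_def sum_distrib_left sum_subtractf[symmetric]
    by (intro sum.cong refl) (simp add: diff_divide_distrib)
  finally have ReS: "Re S = (cmod z)\<^sup>2 * A - Re z * B" .
  have "Im S = (\<Sum>i<d. - Im z * Re (r i) / (cmod (z - r i))\<^sup>2)"
    unfolding S_def Im_sum by (intro sum.cong refl) (simp add: summand)
  also have "\<dots> = - Im z * B"
    unfolding B_def sum_distrib_left by (intro sum.cong refl) simp
  finally have "Im z * B = 0" using S by simp
  moreover have "Im z = 0 \<Longrightarrow> Re z \<le> 0"
    using nz by (metis complex_is_Real_iff greaterThan_iff imageI not_le of_real_Re)
  ultimately have "Re z * B \<le> 0" using B0 by (auto simp: mult_nonpos_nonneg)
  then have "Re S \<ge> 0" unfolding ReS using A0 by (smt (verit) mult_nonneg_nonneg zero_le_power2)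
  then show False using S \<beta> by simp
qed

text \<open>A Hurwitz argument made quantitative: at distance \<delta> from the half line, a
  polynomial with positive zeros is at least its leading coefficient times a power of \<delta>.
  Constant degree keeps the leading coefficients away from 0, and the nonzero constant term prevents
  zeros of the limit at the origin.\<close>

lemma pos_rooted_limit:
  assumes g: "\<And>m::nat. pos_rooted (g m)" and d: "\<And>m. degree (g m) = degree f"
    and lim: "\<And>j. (\<lambda>m. coeff (g m) j) \<longlonglongrightarrow> coeff f j" and f0: "coeff f 0 \<noteq> 0"
  shows "pos_rooted f"
  unfolding pos_rooted_def
proof (intro allI impI, rule ccontr)
  fix z assume z: "poly f z = 0" and nz: "z \<notin> complex_of_real ` {0<..}"
  have z0: "z \<noteq> 0" using z f0 by (auto simp: poly_0_coeff_0)
  \<comment> \<open>The distance from z to the closed half line: the nearest point is 0 in the left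
    half plane and the real part of z otherwise.\<close>
  define \<delta> where "\<delta> = (if Re z \<le> 0 then cmod z else \<bar>Im z\<bar>)"
  have "Im z = 0 \<Longrightarrow> Re z \<le> 0"
    using nz by (metis complex_is_Real_iff greaterThan_iff imageI not_le of_real_Re)
  then have \<delta>: "\<delta> > 0" using z0 by (auto simp: \<delta>_def)
  have far: "\<delta> \<le> cmod (z - of_real \<rho>)" if "\<rho> > 0" for \<rho>
  proof (cases "Re z \<le> 0")
    case True
    have "(Re z)\<^sup>2 \<le> (Re z - \<rho>)\<^sup>2"
      using True that by (simp add: abs_le_square_iff[symmetric])
    then have "(cmod z)\<^sup>2 \<le> (cmod (z - of_real \<rho>))\<^sup>2" unfolding cmod_power2 by simp
    then show ?thesis using True by (simp add: \<delta>_def power2_le_iff_abs_le)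
  next
    case False
    then show ?thesis using abs_Im_le_cmod[of "z - of_real \<rho>"] by (simp add: \<delta>_def)
  qed
  have "cmod (coeff (g m) (degree f)) * \<delta> ^ degree f \<le> cmod (poly (g m) z)" for m
  proof -
    obtain r where r: "smult (lead_coeff (g m)) (\<Prod>i<degree f. [:-r i, 1:]) = g m"
      using complex_poly_decompose'[of "g m"] d by metis
    have root: "r i \<in> complex_of_real ` {0<..}" if "i < degree f" for i
    proof -
      have "poly (g m) (r i) = 0" by (subst r[symmetric]) (use that in \<open>auto simp: poly_prod\<close>)
      then show ?thesis using g[of m] by (simp add: pos_rooted_def)
    qed
    have "\<delta> ^ degree f = (\<Prod>i<degree f. \<delta>)" by simp
    also have "\<dots> \<le> (\<Prod>i<degree f. cmod (z - r i))"
      using root far \<delta> by (intro prod_mono) fastforce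
    finally have "cmod (lead_coeff (g m)) * \<delta> ^ degree f \<le> cmod (lead_coeff (g m)) * (\<Prod>i<degree f. cmod (z - r i))"
      by (intro mult_left_mono) auto
    also have "\<dots> = cmod (poly (g m) z)"
      by (subst (2) r[symmetric]) (simp add: poly_prod norm_mult prod_norm)
    finally show ?thesis unfolding d .
  qed
  moreover have "(\<lambda>m. cmod (coeff (g m) (degree f)) * \<delta> ^ degree f) \<longlonglongrightarrow> cmod (coeff f (degree f)) * \<delta> ^ degree f"
    by (intro tendsto_intros lim)
  moreover have "(\<lambda>m. cmod (poly (g m) z)) \<longlonglongrightarrow> cmod (poly f z)"
    unfolding poly_altdef d by (intro tendsto_intros lim)
  ultimately have "cmod (coeff f (degree f)) * \<delta> ^ degree f \<le> cmod (poly f z)"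
    by (intro LIMSEQ_le) auto
  moreover have "f \<noteq> 0" using f0 by auto
  ultimately show False using z zero_less_power[OF \<delta>, of "degree f"] by (simp add: mult_le_0_iff not_le)
qed

lemma pos_rooted_rescale:
  assumes f: "pos_rooted f" and c: "c > 0"
  shows "pos_rooted (coeff_scale (\<lambda>j. c ^ j) f)"
  unfolding pos_rooted_def
proof (intro allI impI)
  fix z assume z: "poly (coeff_scale (\<lambda>j. c ^ j) f) z = 0"
  have "coeff_scale (\<lambda>j. c ^ j) f = pcompose f [:0, of_real c:]"
    by (rule poly_eqI) (simp add: coeff_coeff_scale coeff_pcompose_linear)
  then have "poly f (of_real c * z) = 0" using z by (simp add: poly_pcompose mult.commute)
  then obtain \<rho> where "of_real c * z = complex_of_real \<rho>" "\<rho> > 0" using f by (auto simp: pos_rooted_def)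
  then have "z = of_real (\<rho> / c)" using c by (simp add: field_simps)
  moreover have "\<rho> / c \<in> {0<..}" using c \<open>\<rho> > 0\<close> by simp
  ultimately show "z \<in> complex_of_real ` {0<..}" by blast
qed

lemma pos_rooted_smult:
  assumes f: "pos_rooted f" and c: "c \<noteq> 0"
  shows "pos_rooted (smult c f)"
  using assms by (auto simp: pos_rooted_def)

text \<open>Laguerre's multiplier sequence, obtained as the limit of the first-order operators
  \<open>x d/dx + \<alpha> + i\<close> applied for \<open>i \<le> m\<close> and followed by the dilation by \<open>1/m\<close>.\<close>

lemma pos_rooted_pochhammer:
  assumes f: "pos_rooted f" and z: "z > 0"
  shows "pos_rooted (coeff_scale (\<lambda>j. 1 / pochhammer z j) f)"
proof -
  have A: "pos_rooted (coeff_scale (\<lambda>j. pochhammer (z + real j) m) f)" for m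
  proof (induction m)
    case 0
    have "coeff_scale (\<lambda>j. pochhammer (z + real j) 0) f = f" by (rule poly_eqI) (simp add: coeff_coeff_scale)
    then show ?case using f by simp
  next
    case (Suc m)
    have "coeff_scale (\<lambda>j. pochhammer (z + real j) (Suc m)) f
        = coeff_scale (\<lambda>j. real j + (z + real m)) (coeff_scale (\<lambda>j. pochhammer (z + real j) m) f)"
      by (rule poly_eqI) (simp add: coeff_coeff_scale pochhammer_Suc algebra_simps)
    then show ?case using pos_rooted_euler[OF Suc, of "z + real m"] z by simp
  qed
  define W where "W m j = pochhammer (z + real j) m / pochhammer z m * (1 / real m) ^ j" for m j
  have B: "pos_rooted (coeff_scale (W (Suc m)) f)" for m
  proof -
    have "pos_rooted (smult (of_real (1 / pochhammer z (Suc m))) (coeff_scale (\<lambda>j. (1 / real (Suc m)) ^ j) (coeff_scale (\<lambda>j. pochhammer (z + real j) (Suc m)) f)))"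
      using pochhammer_pos[OF z, of "Suc m"] by (intro pos_rooted_smult pos_rooted_rescale A) auto
    also have "(smult (of_real (1 / pochhammer z (Suc m))) (coeff_scale (\<lambda>j. (1 / real (Suc m)) ^ j) (coeff_scale (\<lambda>j. pochhammer (z + real j) (Suc m)) f)))
      = coeff_scale (W (Suc m)) f"
      by (rule poly_eqI) (simp add: coeff_coeff_scale W_def)
    finally show ?thesis .
  qed
  \<comment> \<open>Splitting the Pochhammer symbol of length m + j in two ways trades m factors for
    j factors, each asymptotic to m; the power of 1/m then makes every factor tend to 1.\<close>
  have W: "W m j = (\<Prod>i<j. (z + real m + real i) / real m) / pochhammer z j" for m j
  proof -
    have "pochhammer z m * pochhammer (z + real m) j = pochhammer z j * pochhammer (z + real j) m"
      using pochhammer_product'[of z m j] pochhammer_product'[of z j m] by (simp add: add.commute)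
    then have "pochhammer (z + real j) m / pochhammer z m = pochhammer (z + real m) j / pochhammer z j"
      using pochhammer_pos[OF z, of m] pochhammer_pos[OF z, of j] by (simp add: field_simps)
    moreover have "pochhammer (z + real m) j * (1 / real m) ^ j = (\<Prod>i<j. (z + real m + real i) / real m)"
      unfolding pochhammer_prod by (simp add: prod_dividef power_one_over atLeast0LessThan)
    ultimately show ?thesis unfolding W_def by simp
  qed
  have lim: "(\<lambda>m. W (Suc m) j) \<longlonglongrightarrow> 1 / pochhammer z j" for j
  proof -
    have "(\<lambda>m. (z + real m + real i) / real m) \<longlonglongrightarrow> 1" for i by real_asymp
    then have "(\<lambda>m. (\<Prod>i<j. (z + real m + real i) / real m) / pochhammer z j) \<longlonglongrightarrow> (\<Prod>i<j. 1) / pochhammer z j"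
      using pochhammer_pos[OF z, of j] by (intro tendsto_intros) auto
    then have "(\<lambda>m. W m j) \<longlonglongrightarrow> 1 / pochhammer z j" unfolding W[symmetric] by simp
    then show ?thesis by (rule LIMSEQ_Suc)
  qed
  show ?thesis
  proof (rule pos_rooted_limit[where g = "\<lambda>m. coeff_scale (W (Suc m)) f"])
    show "degree (coeff_scale (W (Suc m)) f) = degree (coeff_scale (\<lambda>j. 1 / pochhammer z j) f)" for m
    proof -
      have "W (Suc m) j \<noteq> 0" for j using pochhammer_pos[OF z, of "Suc m"] pochhammer_pos[of "z + real j" "Suc m"] z
        by (simp add: W_def)
      moreover have "1 / pochhammer z j \<noteq> 0" for j using pochhammer_pos[OF z, of j] by simp
      ultimately show ?thesis by (simp add: degree_coeff_scale)
    qed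
    show "(\<lambda>m. coeff (coeff_scale (W (Suc m)) f) j) \<longlonglongrightarrow> coeff (coeff_scale (\<lambda>j. 1 / pochhammer z j) f) j" for j
      unfolding coeff_coeff_scale by (intro tendsto_intros lim)
    have "poly f 0 \<noteq> 0" using f by (auto simp: pos_rooted_def)
    then show "coeff (coeff_scale (\<lambda>j. 1 / pochhammer z j) f) 0 \<noteq> 0"
      by (simp add: coeff_coeff_scale poly_0_coeff_0)
  qed (rule B)
qed

text \<open>With \<open>\<theta> = x d/dx\<close> and \<open>a\<^sub>i = x / (x - r\<^sub>i)\<close> one has \<open>\<theta> a\<^sub>i = a\<^sub>i - a\<^sub>i\<^sup>2\<close>.\<close>

definition euler :: "real poly \<Rightarrow> real poly" where
  "euler f = pCons 0 (pderiv f)"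

lemma coeff_euler: "coeff (euler f) j = real j * coeff f j"
  by (auto simp: euler_def coeff_pCons coeff_pderiv split: nat.split)

lemma euler_mult: "euler (f * g) = euler f * g + f * euler g"
  by (simp add: euler_def pderiv_mult)

lemma euler_add: "euler (f + g) = euler f + euler g"
  by (simp add: euler_def pderiv_add)

text \<open>\<open>T1\<close> and \<open>T2\<close> are the first and second Euler derivatives of
  \<open>T\<close>, the logarithmic Euler derivative of f; the right-hand sides come from iterating
  \<theta>(f g) = f (T g + \<theta> g). Induction on the linear factors avoids differentiating
  rational functions.\<close>

lemma poly_euler_prod_linear:
  fixes r :: "nat \<Rightarrow> real"
  assumes "\<And>i. i < d \<Longrightarrow> x \<noteq> r i"
  defines "f \<equiv> \<lambda>d. \<Prod>i<d. [:-r i, 1:]"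
  defines "a \<equiv> \<lambda>i. x / (x - r i)"
  defines "T \<equiv> \<lambda>d. \<Sum>i<d. a i"
  defines "T1 \<equiv> \<lambda>d. \<Sum>i<d. a i - (a i)^2"
  defines "T2 \<equiv> \<lambda>d. \<Sum>i<d. (1 - 2 * a i) * (a i - (a i)^2)"
  shows "poly (euler (f d)) x = poly (f d) x * T d \<and>
    poly (euler (euler (f d))) x = poly (f d) x * ((T d)^2 + T1 d) \<and>
    poly (euler (euler (euler (f d)))) x = poly (f d) x * ((T d)^3 + 3 * T d * T1 d + T2 d)"
  using assms(1)
proof (induction d)
  case 0
  then show ?case by (simp add: f_def T_def T1_def T2_def euler_def pderiv_1)
next
  case (Suc d)
  define l where "l = [:-r d, 1:]"
  have f: "f (Suc d) = f d * l" by (simp add: f_def l_def)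
  have l: "euler l = [:0,1:]" and x: "euler [:0,1:] = ([:0,1:] :: real poly)"
    by (simp_all add: l_def euler_def pderiv_pCons)
  note IH = Suc.IH[OF Suc.prems]
  have xr: "x - r d \<noteq> 0" using Suc.prems[of d] by simp
  have lx: "poly l x = x - r d" by (simp add: l_def)
  have ax: "x = a d * (x - r d)" using xr by (simp add: a_def)
  have T: "T (Suc d) = T d + a d" "T1 (Suc d) = T1 d + (a d - (a d)^2)"
    "T2 (Suc d) = T2 d + (1 - 2 * a d) * (a d - (a d)^2)"
    by (simp_all add: T_def T1_def T2_def)
  define F where "F = poly (f d) x"
  define L where "L = x - r d"
  have x': "x = a d * L" using ax by (simp add: L_def)
  have 1: "poly (euler (f (Suc d))) x = L * (F * T d) + x * F"
    unfolding f euler_mult l using IH by (simp add: lx F_def L_def)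
  have 2: "poly (euler (euler (f (Suc d)))) x = L * (F * ((T d)^2 + T1 d)) + 2 * x * (F * T d) + x * F"
    unfolding f euler_mult euler_add l x using IH by (simp add: lx F_def L_def) (simp add: algebra_simps)
  have 3: "poly (euler (euler (euler (f (Suc d))))) x =
      L * (F * ((T d)^3 + 3 * T d * T1 d + T2 d)) + 3 * x * (F * ((T d)^2 + T1 d)) + 3 * x * (F * T d) + x * F"
    unfolding f euler_mult euler_add l x using IH by (simp add: lx F_def L_def) (simp add: algebra_simps)
  have 4: "poly (f (Suc d)) x = F * L" unfolding f by (simp add: F_def L_def lx)
  have "X = a d * L \<Longrightarrow> L * (F * T d) + X * F = F * L * (T d + a d)"
    "X = a d * L \<Longrightarrow> L * (F * ((T d)^2 + T1 d)) + 2 * X * (F * T d) + X * F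
       = F * L * ((T d + a d)^2 + (T1 d + (a d - (a d)^2)))"
    "X = a d * L \<Longrightarrow> L * (F * ((T d)^3 + 3 * T d * T1 d + T2 d)) + 3 * X * (F * ((T d)^2 + T1 d)) + 3 * X * (F * T d) + X * F
       = F * L * ((T d + a d)^3 + 3 * (T d + a d) * (T1 d + (a d - (a d)^2)) + (T2 d + (1 - 2 * a d) * (a d - (a d)^2)))" for X
    by (simp_all add: algebra_simps power2_eq_square power3_eq_cube)
  from this[OF x'] show ?case unfolding 1 2 3 4 T by blast
qed

section \<open>Stieltjes transforms of the zero measures\<close>

lemma e_coeff_pochhammer:
  "e_coeff p q n j = pochhammer (p * real n + 1) j * pochhammer (p * real n + q * real n + 1) j / (real n ^ 2) ^ j"
  by (induction j) (simp_all add: e_coeff_Suc w_coeff_def pochhammer_Suc field_simps)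

text \<open>Starting from (1 - n^2 x)^k, whose only possible zero is 1/n^2, two applications of the
  Pochhammer multiplier produce the 1F2 coefficients.\<close>

lemma pos_rooted_P_poly:
  assumes p: "p > 0" "q > 0" "n > 0"
  shows "pos_rooted (map_poly complex_of_real (P_poly p q n k))"
proof -
  define f0 :: "complex poly" where "f0 = [:1, - (of_nat n)\<^sup>2:] ^ k"
  have "poly f0 z = 0 \<longrightarrow> z \<in> complex_of_real ` {0<..}" for z
  proof
    assume "poly f0 z = 0"
    then have "1 - of_nat n ^ 2 * z = 0" by (auto simp: f0_def mult.commute)
    then have "z = of_real (1 / real n ^ 2)" using p by (simp add: field_simps)
    moreover have "1 / real n ^ 2 \<in> {0<..}" using p by simp
    ultimately show "z \<in> complex_of_real ` {0<..}" by blast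
  qed
  then have 0: "pos_rooted f0" by (simp add: pos_rooted_def)
  have c0: "coeff f0 j = of_nat (k choose j) * (- (of_nat n)\<^sup>2) ^ j" for j
  proof (cases "j \<le> k")
    case True
    then show ?thesis unfolding f0_def by (subst coeff_linear_poly_power) auto
  next
    case False
    have "degree f0 \<le> k" unfolding f0_def by (rule order.trans[OF degree_power_le]) simp
    then show ?thesis using False by (simp add: coeff_eq_0 binomial_eq_0)
  qed
  have "pos_rooted (smult (of_real ((-1) ^ k * e_coeff p q n k))
     (coeff_scale (\<lambda>j. 1 / pochhammer (p * real n + 1) j)
     (coeff_scale (\<lambda>j. 1 / pochhammer (p * real n + q * real n + 1) j) f0)))"
    using p e_coeff_pos[OF p, of k] by (intro pos_rooted_smult pos_rooted_pochhammer 0) (auto intro!: add_pos_pos)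
  also have "smult (of_real ((-1) ^ k * e_coeff p q n k))
     (coeff_scale (\<lambda>j. 1 / pochhammer (p * real n + 1) j)
     (coeff_scale (\<lambda>j. 1 / pochhammer (p * real n + q * real n + 1) j) f0)) = map_poly complex_of_real (P_poly p q n k)"
  proof (rule poly_eqI)
    fix j
    have "(- ((real n)\<^sup>2)) ^ j = (-1) ^ j * (real n ^ 2) ^ j" by (rule power_minus)
    then have "(-1) ^ k * e_coeff p q n k * (1 / pochhammer (p * real n + 1) j * (1 / pochhammer (p * real n + q * real n + 1) j * (real (k choose j) * (- (real n)\<^sup>2) ^ j))) = coeff (P_poly p q n k) j"
      unfolding coeff_P_poly[OF p] h_coeff_def e_coeff_pochhammer[of p q n j] by simp
    from arg_cong[OF this, of complex_of_real]
    show "coeff (smult (of_real ((-1) ^ k * e_coeff p q n k))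
     (coeff_scale (\<lambda>j. 1 / pochhammer (p * real n + 1) j)
     (coeff_scale (\<lambda>j. 1 / pochhammer (p * real n + q * real n + 1) j) f0))) j = coeff (map_poly complex_of_real (P_poly p q n k)) j"
      by (simp add: coeff_coeff_scale c0 coeff_map_poly)
  qed
  finally show ?thesis .
qed

lemma poly_map_poly_of_real: "poly (map_poly complex_of_real f) (of_real x) = of_real (poly f x)"
  by (induction f) (simp_all add: map_poly_pCons)

lemma degree_P_poly:
  assumes p: "p > 0" "q > 0" "n > 0"
  shows "degree (P_poly p q n k) = k" "lead_coeff (P_poly p q n k) = 1"
proof -
  have "coeff (P_poly p q n k) k = ((-1) ^ k * (-1) ^ k) * (e_coeff p q n k / e_coeff p q n k)"
    unfolding coeff_P_poly[OF p] h_coeff_def by simp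
  then have 1: "coeff (P_poly p q n k) k = 1"
    using e_coeff_pos[OF p, of k] by (simp add: power_mult_distrib[symmetric])
  have 2: "degree (P_poly p q n k) \<le> k"
    by (rule degree_le) (auto simp: coeff_P_poly[OF p] h_coeff_def binomial_eq_0)
  from 1 2 show "degree (P_poly p q n k) = k" by (metis antisym le_degree zero_neq_one)
  with 1 show "lead_coeff (P_poly p q n k) = 1" by simp
qed

lemma P_poly_positive_roots:
  assumes p: "p > 0" "q > 0" "n > 0"
  obtains r where "P_poly p q n k = (\<Prod>i<k. [:- r i, 1:])" "\<And>i. i < k \<Longrightarrow> r i > 0"
proof -
  let ?P = "map_poly complex_of_real (P_poly p q n k)"
  have d: "degree ?P = k" "lead_coeff ?P = 1" using degree_P_poly[OF p]
    by (auto simp: degree_map_poly coeff_map_poly)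
  obtain z where z: "smult (lead_coeff ?P) (\<Prod>i<degree ?P. [:-z i, 1:]) = ?P"
    using complex_poly_decompose' by blast
  then have z: "?P = (\<Prod>i<k. [:-z i, 1:])" by (simp only: d(2) smult_1_left) (simp only: d(1))
  have "z i \<in> complex_of_real ` {0<..}" if "i < k" for i
  proof -
    have "poly ?P (z i) = 0" unfolding z using that by (auto simp: poly_prod)
    then show ?thesis using pos_rooted_P_poly[OF p, of k] by (simp add: pos_rooted_def)
  qed
  then have zi: "z i = of_real (Re (z i)) \<and> Re (z i) > 0" if "i < k" for i using that by fastforce
  show ?thesis
  proof (rule that[of "\<lambda>i. Re (z i)"])
    have "poly (P_poly p q n k) = poly (\<Prod>i<k. [:- Re (z i), 1:])"
    proof
      fix x
      have "complex_of_real (poly (P_poly p q n k) x) = poly ?P (of_real x)"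
        by (rule poly_map_poly_of_real[symmetric])
      also have "\<dots> = (\<Prod>i<k. of_real x - z i)" unfolding z by (simp add: poly_prod)
      also have "\<dots> = (\<Prod>i<k. of_real x - of_real (Re (z i)))"
        using zi by (intro prod.cong refl) auto
      also have "\<dots> = complex_of_real (poly (\<Prod>i<k. [:- Re (z i), 1:]) x)"
        by (simp add: poly_prod)
      finally show "poly (P_poly p q n k) x = poly (\<Prod>i<k. [:- Re (z i), 1:]) x"
        by (simp only: of_real_eq_iff)
    qed
    then show "P_poly p q n k = (\<Prod>i<k. [:- Re (z i), 1:])" by (simp only: poly_eq_poly_eq_iff)
  qed (use zi in auto)
qed

text \<open>The left side is the expanded product \<theta> (\<theta> + \<alpha>) (\<theta> +
  \<alpha> + \<nu>) applied to f, with \<theta> = \<open>euler\<close>. On monomials these operators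
  are scalars, so the equation is the two-term relation \<open>coeff_P_poly_lower\<close>.\<close>

lemma P_poly_ode:
  fixes p q :: real and n k :: nat
  assumes p: "p > 0" "q > 0" "n > 0"
  defines "f \<equiv> P_poly p q n k"
  shows "euler (euler (euler f)) + smult (2 * p * real n + q * real n) (euler (euler f))
     + smult (p * real n * (p * real n + q * real n)) (euler f)
     = smult (real n ^ 2) (pCons 0 (euler f - smult (real k) f))"
proof (rule poly_eqI)
  fix j
  show "coeff (euler (euler (euler f)) + smult (2 * p * real n + q * real n) (euler (euler f))
     + smult (p * real n * (p * real n + q * real n)) (euler f)) j
     = coeff (smult (real n ^ 2) (pCons 0 (euler f - smult (real k) f))) j"
  proof (cases j)
    case (Suc i)
    have "real n ^ 2 * (real (Suc i) * w_coeff p q n (Suc i) * coeff f (Suc i)) = real n ^ 2 * ((real i - real k) * coeff f i)"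
      unfolding f_def coeff_P_poly_lower[OF p] ..
    then show ?thesis using p
      by (simp add: Suc coeff_euler w_coeff_def) (simp add: algebra_simps)
  qed (simp add: coeff_euler)
qed

text \<open>The logarithmic derivative satisfies a Riccati equation which becomes algebraic in the limit.\<close>

lemma log_derivative_bound:
  assumes p: "p > 0" "q > 0" "n > 0" and y: "y > 0"
    and r: "P_poly p q n k = (\<Prod>i<k. [:- r i, 1:])" "\<And>i. i < k \<Longrightarrow> r i > 0"
  defines "u \<equiv> (\<Sum>i<k. y / (y + r i)) / real n"
  defines "\<kappa> \<equiv> real k / real n"
  shows "0 \<le> u" "u \<le> \<kappa>"
    "\<bar>u * (u + p) * (u + p + q) - y * (\<kappa> - u)\<bar> \<le> (3 * \<kappa>\<^sup>2 + \<kappa> / real n + (2 * p + q) * \<kappa>) / real n"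
proof -
  define N where "N = real n"
  have N: "N > 0" using p by (simp add: N_def)
  define x where "x = - y"
  define a where "a i = x / (x - r i)" for i
  have a: "a i = y / (y + r i)" for i
  proof -
    have "- y - r i = - (y + r i)" by simp
    then show ?thesis unfolding a_def x_def by (simp only: minus_divide_divide)
  qed
  \<comment> \<open>Evaluation at a negative point pays off here: \<open>a i\<close> in (0, 1]
    bounds \<open>T1\<close> and \<open>T2\<close> by k, so the correction terms are of order N^2
    (for bounded k/N) against a leading order N^3.\<close>
  have a01: "0 < a i" "a i \<le> 1" if "i < k" for i unfolding a using y r(2)[OF that] by auto
  define T where "T = (\<Sum>i<k. a i)"
  define T1 where "T1 = (\<Sum>i<k. a i - (a i)^2)"
  define T2 where "T2 = (\<Sum>i<k. (1 - 2 * a i) * (a i - (a i)^2))"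
  have T: "0 \<le> T" "T \<le> real k"
    unfolding T_def using a01 sum_mono[of "{..<k}" a "\<lambda>_. 1"] by (auto intro!: sum_nonneg simp: less_imp_le)
  have aa: "0 \<le> a i - (a i)^2" "a i - (a i)^2 \<le> 1" if "i < k" for i
  proof -
    have "(a i)^2 \<le> a i" using a01[OF that] by (simp add: power2_eq_square mult_left_le)
    then show "0 \<le> a i - (a i)^2" "a i - (a i)^2 \<le> 1" using a01[OF that] zero_le_power2[of "a i"] by linarith+
  qed
  have T1: "\<bar>T1\<bar> \<le> real k"
  proof -
    have "\<bar>T1\<bar> \<le> (\<Sum>i<k. \<bar>a i - (a i)^2\<bar>)" unfolding T1_def by (rule sum_abs)
    also have "\<dots> \<le> (\<Sum>i<k. 1)" using aa by (intro sum_mono) auto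
    finally show ?thesis by simp
  qed
  have T2: "\<bar>T2\<bar> \<le> real k"
  proof -
    have "\<bar>T2\<bar> \<le> (\<Sum>i<k. \<bar>(1 - 2 * a i) * (a i - (a i)^2)\<bar>)" unfolding T2_def by (rule sum_abs)
    also have "\<dots> \<le> (\<Sum>i<k. 1)"
    proof (intro sum_mono)
      fix i assume "i \<in> {..<k}"
      then have "\<bar>1 - 2 * a i\<bar> \<le> 1" "\<bar>a i - (a i)^2\<bar> \<le> 1" using a01[of i] aa[of i] by auto
      then show "\<bar>(1 - 2 * a i) * (a i - (a i)^2)\<bar> \<le> 1" unfolding abs_mult by (simp add: mult_le_one)
    qed
    finally show ?thesis by simp
  qed
  have u: "u = T / N" unfolding u_def T_def a N_def ..
  show "0 \<le> u" "u \<le> \<kappa>" unfolding u \<kappa>_def using T N by (auto simp: N_def divide_right_mono)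
  define f where "f = P_poly p q n k"
  have xr: "x \<noteq> r i" if "i < k" for i using r(2)[OF that] y by (simp add: x_def)
  have F: "poly f x \<noteq> 0" unfolding f_def r(1) using xr by (auto simp: poly_prod)
  have e: "poly (euler f) x = poly f x * T" "poly (euler (euler f)) x = poly f x * (T^2 + T1)"
    "poly (euler (euler (euler f))) x = poly f x * (T^3 + 3 * T * T1 + T2)"
    using poly_euler_prod_linear[of k x r, OF xr] unfolding f_def r(1) T_def T1_def T2_def a_def by auto
  have "poly f x * ((T^3 + 3 * T * T1 + T2) + (2 * p * N + q * N) * (T^2 + T1) + p * N * (p * N + q * N) * T)
     = poly f x * (N ^ 2 * (x * (T - real k)))"
    using arg_cong[OF P_poly_ode[OF p, of k], of "\<lambda>g. poly g x"] unfolding f_def[symmetric] N_def[symmetric]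
    unfolding poly_add poly_smult poly_pCons poly_diff e
    by (simp add: algebra_simps del: mult_cancel_left mult_cancel_right)
  then have "(T^3 + 3 * T * T1 + T2) + (2 * p * N + q * N) * (T^2 + T1) + p * N * (p * N + q * N) * T = N ^ 2 * (x * (T - real k))"
    using F by (metis mult_left_cancel)
  then have eq: "(T^3 + 3 * T * T1 + T2) + (2 * p * N + q * N) * (T^2 + T1) + p * N * (p * N + q * N) * T = - (N ^ 2 * y * (T - real k))"
    unfolding x_def by simp
  have Tu: "T = u * N" "real k = \<kappa> * N" using N unfolding u \<kappa>_def N_def[symmetric] by auto
  have "N^3 * (u * (u + p) * (u + p + q) - y * (\<kappa> - u)) = - (3 * (u * N) * T1 + T2 + (2 * p * N + q * N) * T1)"
    using eq unfolding Tu by (simp add: algebra_simps power2_eq_square power3_eq_cube)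
  then have "N^3 * \<bar>u * (u + p) * (u + p + q) - y * (\<kappa> - u)\<bar> = \<bar>3 * (u * N) * T1 + T2 + (2 * p * N + q * N) * T1\<bar>"
    using N by (metis (no_types) abs_minus_cancel abs_mult abs_of_pos zero_less_power)
  also have "\<dots> \<le> 3 * T * \<bar>T1\<bar> + \<bar>T2\<bar> + (2 * p * N + q * N) * \<bar>T1\<bar>"
  proof -
    have "\<bar>3 * T * T1\<bar> = 3 * T * \<bar>T1\<bar>" "\<bar>(2 * p * N + q * N) * T1\<bar> = (2 * p * N + q * N) * \<bar>T1\<bar>"
      using T p N by (auto simp: abs_mult)
    then show ?thesis unfolding Tu(1)[symmetric] by linarith
  qed
  also have "\<dots> \<le> 3 * real k * real k + real k + (2 * p * N + q * N) * real k"
    using T T1 T2 p N by (intro add_mono mult_mono) auto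
  also have "\<dots> = N^3 * ((3 * \<kappa>\<^sup>2 + \<kappa> / N + (2 * p + q) * \<kappa>) / N)"
    unfolding Tu(2) using N by (simp add: field_simps power2_eq_square power3_eq_cube)
  finally show "\<bar>u * (u + p) * (u + p + q) - y * (\<kappa> - u)\<bar> \<le> (3 * \<kappa>\<^sup>2 + \<kappa> / real n + (2 * p + q) * \<kappa>) / real n"
    unfolding N_def[symmetric] by (rule mult_left_le_imp_le) (use N in simp)
qed

text \<open>The exact equation is H U + y U = y \<xi> with H increasing on the nonnegative axis. Its
  left side grows at rate at least y, so an approximate solution u lies within (error / y) of U.
  Dividing u by \<kappa> y returns the transform.\<close>

lemma stieltjes_zeros_limit:
  fixes p q \<xi> y U :: real and k n :: "nat \<Rightarrow> nat"
  assumes p: "p > 0" "q > 0" and \<xi>: "\<xi> > 0" and y: "y > 0"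
    and U: "U \<ge> 0" "U * (U + p) * (U + p + q) = y * (\<xi> - U)"
    and n: "filterlim n at_top sequentially" and kn: "(\<lambda>j. real (k j) / real (n j)) \<longlonglongrightarrow> \<xi>"
    and r: "\<And>j. n j > 0 \<Longrightarrow> P_poly p q (n j) (k j) = (\<Prod>i<k j. [:- r j i, 1:])"
      "\<And>j i. n j > 0 \<Longrightarrow> i < k j \<Longrightarrow> r j i > 0"
  shows "(\<lambda>j. (\<Sum>i<k j. 1 / (y + r j i)) / real (k j)) \<longlonglongrightarrow> U / (\<xi> * y)"
proof -
  define \<kappa> where "\<kappa> j = real (k j) / real (n j)" for j
  define u where "u j = (\<Sum>i<k j. y / (y + r j i)) / real (n j)" for j
  have \<kappa>: "\<kappa> \<longlonglongrightarrow> \<xi>" using kn unfolding \<kappa>_def[abs_def] .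
  have npos: "eventually (\<lambda>j. n j > 0) sequentially" using eventually_gt_at_top[of 0] n by (rule eventually_compose_filterlim)
  have ninv: "(\<lambda>j. 1 / real (n j)) \<longlonglongrightarrow> 0"
    by (intro real_tendsto_divide_at_top[OF tendsto_const] filterlim_compose[OF filterlim_real_sequentially n])
  define B where "B j = (3 * (\<kappa> j)\<^sup>2 + \<kappa> j / real (n j) + (2 * p + q) * \<kappa> j) / real (n j) + y * \<bar>\<kappa> j - \<xi>\<bar>" for j
  have "(\<lambda>j. (3 * (\<kappa> j)\<^sup>2 + \<kappa> j * (1 / real (n j)) + (2 * p + q) * \<kappa> j) * (1 / real (n j)) + y * \<bar>\<kappa> j - \<xi>\<bar>)
      \<longlonglongrightarrow> (3 * \<xi>\<^sup>2 + \<xi> * 0 + (2 * p + q) * \<xi>) * 0 + y * \<bar>\<xi> - \<xi>\<bar>"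
    by (intro tendsto_intros \<kappa> ninv)
  then have B: "B \<longlonglongrightarrow> 0" unfolding B_def by simp
  have bound: "y * \<bar>u j - U\<bar> \<le> B j" if "n j > 0" for j
  proof -
    note b = log_derivative_bound[OF p that y r(1)[OF that] r(2)[OF that], folded \<kappa>_def u_def]
    define H where "H u = u * (u + p) * (u + p + q)" for u
    have mono: "H u \<le> H v" if "0 \<le> u" "u \<le> v" for u v
      unfolding H_def using that p by (intro mult_mono add_mono mult_nonneg_nonneg) auto
    have "H (u j) - H U + y * (u j - U) = (H (u j) - y * (\<kappa> j - u j)) + y * (\<kappa> j - \<xi>)"
      using U unfolding H_def by (simp add: algebra_simps)
    then have "\<bar>H (u j) - H U + y * (u j - U)\<bar> \<le> B j"
      using b(3) y abs_triangle_ineq[of "H (u j) - y * (\<kappa> j - u j)" "y * (\<kappa> j - \<xi>)"]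
      unfolding H_def B_def by (simp add: abs_mult)
    moreover have "y * \<bar>u j - U\<bar> \<le> \<bar>H (u j) - H U + y * (u j - U)\<bar>"
    proof (cases "u j \<le> U")
      case True
      then have "H (u j) \<le> H U" "y * (u j - U) \<le> 0" using mono b(1) y by (auto simp: mult_nonneg_nonpos)
      then show ?thesis using True by (simp add: right_diff_distrib)
    next
      case False
      then have "H U \<le> H (u j)" "y * (u j - U) \<ge> 0" using mono U y by (auto)
      then show ?thesis using False by (simp add: right_diff_distrib)
    qed
    ultimately show ?thesis by linarith
  qed
  have "(\<lambda>j. y * \<bar>u j - U\<bar>) \<longlonglongrightarrow> 0"
    by (rule tendsto_sandwich[OF _ _ tendsto_const B]) (use npos bound y in \<open>auto elim: eventually_mono\<close>)
  then have "(\<lambda>j. y * \<bar>u j - U\<bar> / y) \<longlonglongrightarrow> 0 / y" using y by (intro tendsto_divide tendsto_const) auto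
  then have "(\<lambda>j. \<bar>u j - U\<bar>) \<longlonglongrightarrow> 0" using y by simp
  then have u: "u \<longlonglongrightarrow> U" by (simp add: LIM_zero_iff tendsto_rabs_zero_iff)
  have "(\<lambda>j. u j / (\<kappa> j * y)) \<longlonglongrightarrow> U / (\<xi> * y)"
    using \<xi> y by (intro tendsto_intros u \<kappa>) auto
  moreover have "eventually (\<lambda>j. u j / (\<kappa> j * y) = (\<Sum>i<k j. 1 / (y + r j i)) / real (k j)) sequentially"
    using npos
  proof eventually_elim
    case (elim j)
    have "(\<Sum>i<k j. y / (y + r j i)) = y * (\<Sum>i<k j. 1 / (y + r j i))" by (simp add: sum_distrib_left)
    then show ?case unfolding u_def \<kappa>_def using elim y by simp
  qed
  ultimately show ?thesis by (rule Lim_transform_eventually)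
qed

section \<open>The curve of conjugate zeros\<close>

lemma has_real_derivative_inverse_strong:
  fixes f g :: "real \<Rightarrow> real"
  assumes "(f has_real_derivative D) (at x)" "D \<noteq> 0" "open S" "x \<in> S" "continuous_on S f"
    and "\<And>z. z \<in> S \<Longrightarrow> g (f z) = z"
  shows "(g has_real_derivative inverse D) (at (f x))"
  using assms unfolding has_field_derivative_def
  by (intro has_derivative_inverse_strong[of S x f g "(*) D"]) auto

locale triple =
  fixes a b c :: real
  assumes a_pos: "0 < a" and ab: "a < b" and bc: "b < c"
begin

section \<open>The cubic in terms of its largest zero u\<close>

definition "sig = a + b + c"
definition "e2 = a * b + a * c + b * c"
definition "e3 = a * b * c"
definition "X u = (u - a) * (u - b) * (u - c) / u"
text \<open>The derivative of \<open>X\<close>, grouped as the product rule for (u - a) (u - b)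
  times (u - c) / u, so that every summand is visibly nonnegative for u \<ge> c.\<close>

definition "Xd u = ((u - b) * (u - c) + (u - a) * (u - c)) / u + (u - a) * (u - b) * c / u\<^sup>2"
text \<open>If u is one zero, the other two have sum sig - u and product e3 / u; when they are
  conjugate, \<open>kap u\<close> is minus the cosine of their argument.\<close>

definition "kap u = (u - sig) * sqrt u / (2 * sqrt e3)"
definition "kapd u = (3 * u - sig) / (4 * sqrt e3 * sqrt u)"

definition "W \<kappa> = (THE u. u > c \<and> kap u = \<kappa>)"

lemma b_pos: "0 < b" and c_pos: "0 < c" using a_pos ab bc by auto
lemma e3_pos: "e3 > 0" using a_pos b_pos c_pos by (simp add: e3_def)
lemma sig_pos: "sig > 0" using a_pos b_pos c_pos by (simp add: sig_def)

lemma Xd_alt: "u \<noteq> 0 \<Longrightarrow> Xd u = 2 * u - sig + e3 / u\<^sup>2"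
  unfolding Xd_def sig_def e3_def by (simp add: field_simps power2_eq_square)

lemma X_alt: "u \<noteq> 0 \<Longrightarrow> X u = u\<^sup>2 - sig * u + e2 - e3 / u"
  unfolding X_def sig_def e2_def e3_def by (simp add: field_simps power2_eq_square)

lemma X_deriv:
  assumes "u \<noteq> 0"
  shows "(X has_real_derivative Xd u) (at u)"
  unfolding X_def Xd_def using assms
  by (auto intro!: derivative_eq_intros) (simp add: field_simps power2_eq_square)

lemma Xd_pos: "u \<ge> c \<Longrightarrow> Xd u > 0"
  unfolding Xd_def using a_pos ab bc
  by (intro add_nonneg_pos divide_pos_pos divide_nonneg_pos add_nonneg_nonneg mult_nonneg_nonneg mult_pos_pos) auto

lemma X_mono:
  assumes "c \<le> u" "u < v" shows "X u < X v"
proof (rule DERIV_pos_imp_increasing[OF assms(2)])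
  fix x assume "u \<le> x" "x \<le> v"
  then show "\<exists>y. (X has_real_derivative y) (at x) \<and> 0 < y"
    using X_deriv[of x] Xd_pos[of x] assms c_pos by (intro exI[of _ "Xd x"]) auto
qed

lemma X_pos: "u > c \<Longrightarrow> X u > 0"
  unfolding X_def using a_pos ab bc by simp

lemma kap_deriv:
  assumes "u > 0" shows "(kap has_real_derivative kapd u) (at u)"
  unfolding kap_def kapd_def using assms e3_pos
  by (auto intro!: derivative_eq_intros) (simp add: field_simps)

lemma kapd_pos: "u \<ge> c \<Longrightarrow> kapd u > 0"
  unfolding kapd_def using e3_pos a_pos ab bc by (auto simp: sig_def intro!: divide_pos_pos)

lemma kap_mono:
  assumes "c \<le> u" "u < v" shows "kap u < kap v"
proof (rule DERIV_pos_imp_increasing[OF assms(2)])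
  fix x assume "u \<le> x" "x \<le> v"
  then show "\<exists>y. (kap has_real_derivative y) (at x) \<and> 0 < y"
    using kap_deriv[of x] kapd_pos[of x] assms c_pos by (intro exI[of _ "kapd x"]) auto
qed

lemma kap_less_iff: "c \<le> u \<Longrightarrow> c \<le> v \<Longrightarrow> kap u < kap v \<longleftrightarrow> u < v"
  using kap_mono by (metis less_asym linorder_neqE)

lemma kap_cont: "continuous_on {c..} kap"
proof (rule DERIV_continuous_on)
  fix x assume "x \<in> {c..}"
  then show "(kap has_real_derivative kapd x) (at x within {c..})"
    using kap_deriv[of x] c_pos has_field_derivative_at_within by auto
qed

text \<open>Two elementary inequalities combine: (u - a) (c - u) \<ge> 0, and the
  arithmetic-geometric mean inequality for b and a + c - u. The result says that for u between a and
  c the other two zeros are real, so the arc belongs to u > c.\<close>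

lemma sig_sq_ge:
  assumes u: "a \<le> u" "u \<le> c" shows "4 * e3 \<le> (sig - u)\<^sup>2 * u"
proof -
  have "(u - a) * (c - u) \<ge> 0" using u by simp
  then have 1: "a * c \<le> u * (a + c - u)" by (simp add: algebra_simps)
  have "4 * (b * (a + c - u)) \<le> (sig - u)\<^sup>2"
    using zero_le_power2[of "b - (a + c - u)"] by (simp add: sig_def power2_eq_square algebra_simps)
  then have "4 * (b * (a + c - u)) * u \<le> (sig - u)\<^sup>2 * u" using u a_pos by (intro mult_right_mono) auto
  moreover have "b * (a * c) \<le> b * (u * (a + c - u))" using 1 b_pos by simp
  ultimately show ?thesis by (simp add: e3_def algebra_simps)
qed

lemma kap_eq:
  assumes "0 \<le> u" "u \<le> sig" shows "kap u = - sqrt ((sig - u)\<^sup>2 * u / (4 * e3))"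
  using assms e3_pos by (simp add: kap_def real_sqrt_mult real_sqrt_divide field_simps)

lemma kap_le:
  assumes u: "a \<le> u" "u \<le> c" shows "kap u \<le> -1"
proof -
  have "1 \<le> (sig - u)\<^sup>2 * u / (4 * e3)" using sig_sq_ge[OF u] e3_pos by (simp add: field_simps)
  then show ?thesis using kap_eq[of u] u a_pos b_pos by (simp add: sig_def)
qed

text \<open>For u = c the other two zeros are a and b, and a < b makes the inequality strict. This
  leaves room around [-1, 1], so \<open>W\<close> is differentiable at every -cos \<theta>,
  including the end points.\<close>

lemma kap_c: "kap c < -1"
proof -
  have "(a - b)\<^sup>2 > 0" using ab by simp
  then have "4 * (a * b) < (sig - c)\<^sup>2" by (simp add: sig_def power2_eq_square algebra_simps)
  then have "4 * (a * b) * c < (sig - c)\<^sup>2 * c" using c_pos by simp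
  then have "4 * e3 < (sig - c)\<^sup>2 * c" by (simp add: e3_def mult_ac)
  then have "1 < (sig - c)\<^sup>2 * c / (4 * e3)" using e3_pos by (simp add: field_simps)
  then show ?thesis using kap_eq[of c] c_pos a_pos b_pos by (simp add: sig_def)
qed

lemma W_unique: "u > c \<Longrightarrow> W (kap u) = u"
  unfolding W_def using kap_mono by (intro the_equality) (auto, metis less_irrefl less_imp_le linorder_neqE)

lemma W_props:
  assumes k: "\<kappa> > kap c"
  shows "W \<kappa> > c" "kap (W \<kappa>) = \<kappa>"
proof -
  \<comment> \<open>Chosen so that \<open>kap (sig + M)\<close> is |\<kappa>| times a quotient of
    square roots that is at least 1; this supplies the upper point for the intermediate value
    theorem.\<close>
  define M where "M = 2 * sqrt e3 * \<bar>\<kappa>\<bar> / sqrt sig"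
  have M: "M \<ge> 0" using e3_pos sig_pos by (simp add: M_def)
  have "kap (sig + M) = \<bar>\<kappa>\<bar> * (sqrt (sig + M) / sqrt sig)"
    unfolding kap_def using e3_pos sig_pos by (simp add: M_def)
  moreover have "sqrt (sig + M) / sqrt sig \<ge> 1" using M sig_pos by simp
  ultimately have "\<bar>\<kappa>\<bar> \<le> kap (sig + M)" by (metis abs_ge_zero mult.right_neutral mult_left_mono)
  then have up: "\<kappa> \<le> kap (sig + M)" by linarith
  have "c \<le> sig + M" using M a_pos b_pos by (simp add: sig_def)
  moreover have "continuous_on {c..sig + M} kap" by (rule continuous_on_subset[OF kap_cont]) auto
  ultimately obtain u where u: "c \<le> u" "u \<le> sig + M" "kap u = \<kappa>"
    using IVT'[of kap c \<kappa> "sig + M"] up k by auto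
  have "u > c" using u k by (cases "u = c") auto
  then have "W \<kappa> = u" using W_unique u by auto
  with \<open>u > c\<close> u show "W \<kappa> > c" "kap (W \<kappa>) = \<kappa>" by auto
qed

lemma W_deriv:
  assumes "\<kappa> > kap c" shows "(W has_real_derivative inverse (kapd (W \<kappa>))) (at \<kappa>)"
proof -
  note w = W_props[OF assms]
  have "(W has_real_derivative inverse (kapd (W \<kappa>))) (at (kap (W \<kappa>)))"
  proof (rule has_real_derivative_inverse_strong[where S = "{c<..}" and f = kap and x = "W \<kappa>"])
    show "(kap has_real_derivative kapd (W \<kappa>)) (at (W \<kappa>))" using kap_deriv w c_pos by auto
    show "kapd (W \<kappa>) \<noteq> 0" using kapd_pos[of "W \<kappa>"] w by auto
    show "continuous_on {c<..} kap" by (rule continuous_on_subset[OF kap_cont]) auto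
  qed (use W_unique w in auto)
  then show ?thesis using w by simp
qed

text \<open>Defined for every real angle; being even and 2 pi periodic, it later closes the curve
  and folds the full turn onto [0, pi].\<close>

definition "u_of \<theta> = W (- cos \<theta>)"

lemma neg_cos_gt: "- cos \<theta> > kap c" using kap_c cos_le_one[of \<theta>] by linarith

lemma u_of: "u_of \<theta> > c" "kap (u_of \<theta>) = - cos \<theta>" "u_of \<theta> > 0"
  using W_props[OF neg_cos_gt] c_pos by (auto simp: u_of_def intro: less_trans)

lemma u_of_deriv: "(u_of has_real_derivative sin \<theta> / kapd (u_of \<theta>)) (at \<theta>)"
proof -
  have "((\<lambda>\<theta>. - cos \<theta>) has_real_derivative sin \<theta>) (at \<theta>)" by (auto intro!: derivative_eq_intros)
  from DERIV_chain2[OF W_deriv[OF neg_cos_gt] this] show ?thesis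
    unfolding u_of_def[abs_def] by (simp add: field_simps)
qed

lemma u_of_cont: "continuous_on S u_of"
  by (rule DERIV_continuous_on) (auto intro: has_field_derivative_at_within u_of_deriv)

lemma kapd_u_of_cont: "continuous_on S (\<lambda>\<theta>. kapd (u_of \<theta>))"
  unfolding kapd_def using u_of(3) e3_pos
  by (intro continuous_intros u_of_cont) (auto simp: less_imp_neq[symmetric])

lemma Xd_u_of_cont: "continuous_on S (\<lambda>\<theta>. Xd (u_of \<theta>))"
  unfolding Xd_def using u_of(3)
  by (intro continuous_intros u_of_cont) (auto simp: less_imp_neq[symmetric])

text \<open>The complex numbers \<open>r e\<^sup>i\<^sup>\<theta>\<close> with \<open>r\<^sup>2 = e3 / u\<close> and \<open>2 r cos \<theta> = sig - u\<close> form, together with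
  \<open>u = u_of \<theta>\<close>, the zeros of \<open>(w - a)(w - b)(w - c) - X u w\<close>.\<close>

lemma cubic_factor:
  assumes "u \<noteq> 0"
  shows "(w - of_real a) * (w - of_real b) * (w - of_real c) - of_real (X u) * w
    = (w - of_real u) * (w\<^sup>2 - of_real (sig - u) * w + of_real (e3 / u) :: complex)"
  unfolding X_alt[OF assms] sig_def e2_def e3_def using assms by (simp add: field_simps power2_eq_square)

text \<open>The logarithm of the modulus of \<open>zeta\<close>. Writing \<open>zeta\<close> as an
  exponential provides a continuous logarithm along the curve, from which the winding number and the
  logarithmic derivatives are read off.\<close>

definition "lr \<theta> = (ln e3 - ln (u_of \<theta>)) / 2"
definition "lrd \<theta> = - sin \<theta> / (2 * kapd (u_of \<theta>) * u_of \<theta>)"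
definition "zeta \<theta> = exp (Complex (lr \<theta>) \<theta>)"

lemma lr_deriv: "(lr has_real_derivative lrd \<theta>) (at \<theta>)"
  unfolding lr_def[abs_def] lrd_def using u_of(3)[of \<theta>] kapd_pos[of "u_of \<theta>"] u_of(1)[of \<theta>]
  by (auto intro!: derivative_eq_intros u_of_deriv simp: field_simps)

lemma exp_lr: "exp (lr \<theta>) = sqrt (e3 / u_of \<theta>)"
proof -
  have "lr \<theta> = ln (sqrt (e3 / u_of \<theta>))" using e3_pos u_of(3)[of \<theta>] by (simp add: lr_def ln_sqrt ln_div)
  then show ?thesis using e3_pos u_of(3)[of \<theta>] by simp
qed

lemma norm_zeta: "norm (zeta \<theta>) = sqrt (e3 / u_of \<theta>)"
  by (simp add: zeta_def norm_exp_eq_Re exp_lr)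

lemma Re_zeta: "2 * Re (zeta \<theta>) = sig - u_of \<theta>"
proof -
  have k: "cos \<theta> = (sig - u_of \<theta>) * sqrt (u_of \<theta>) / (2 * sqrt e3)" using u_of(2)[of \<theta>]
    by (simp add: kap_def left_diff_distrib diff_divide_distrib)
  have "Re (zeta \<theta>) = sqrt (e3 / u_of \<theta>) * cos \<theta>" by (simp add: zeta_def Re_exp exp_lr)
  then show ?thesis unfolding k using e3_pos u_of(3)[of \<theta>] by (simp add: real_sqrt_divide)
qed

lemma zeta_quadratic: "(zeta \<theta>)\<^sup>2 - of_real (sig - u_of \<theta>) * zeta \<theta> + of_real (e3 / u_of \<theta>) = 0"
proof -
  have "(norm (zeta \<theta>))\<^sup>2 = e3 / u_of \<theta>" unfolding norm_zeta using e3_pos u_of(3)[of \<theta>] by simp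
  then have "of_real (e3 / u_of \<theta>) = zeta \<theta> * cnj (zeta \<theta>)" by (metis complex_norm_square)
  moreover have "of_real (sig - u_of \<theta>) = zeta \<theta> + cnj (zeta \<theta>)" unfolding Re_zeta[symmetric]
    by (simp add: complex_add_cnj)
  ultimately show ?thesis by (simp add: algebra_simps power2_eq_square)
qed

lemma zeta_cubic: "(zeta \<theta> - of_real a) * (zeta \<theta> - of_real b) * (zeta \<theta> - of_real c) = of_real (X (u_of \<theta>)) * zeta \<theta>"
  using cubic_factor[of "u_of \<theta>" "zeta \<theta>"] u_of(3)[of \<theta>] by (simp add: zeta_quadratic del: of_real_diff of_real_divide)

text \<open>Since a < b and c < u, the squared modulus a b c / u is below b^2. The radius b suits
  both needs of the Cauchy formula: the disc contains the curve, and the remaining quadratic factor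
  has no zero in it.\<close>

lemma norm_zeta_less: "norm (zeta \<theta>) < b"
proof -
  have "e3 / u_of \<theta> < b\<^sup>2"
  proof -
    have "a * c < b * c" using ab c_pos by simp
    also have "\<dots> < b * u_of \<theta>" using u_of(1)[of \<theta>] b_pos by simp
    finally have "b * (a * c) < b * (b * u_of \<theta>)" using b_pos by simp
    then show ?thesis using u_of(3)[of \<theta>] by (simp add: e3_def field_simps power2_eq_square)
  qed
  then show ?thesis unfolding norm_zeta using b_pos by (metis real_sqrt_less_mono real_sqrt_abs abs_of_pos)
qed

text \<open>The closed curve \<open>zeta\<close> winds once around the zero \<open>v < a\<close> of the cubic \<open>(w - a)(w - b)(w - c) + y w\<close>
  and lies in a disc that contains no other zero; Cauchy's formula then evaluates the integral.\<close>

definition "loop \<tau> = zeta (2 * pi * \<tau>)"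

lemma log_loop_deriv:
  "((\<lambda>\<tau>. of_real (lr (2 * pi * \<tau>)) + \<i> * of_real (2 * pi * \<tau>)) has_vector_derivative
      of_real (2 * pi * lrd (2 * pi * \<tau>)) + 2 * of_real pi * \<i>) (at \<tau>)"
proof -
  have 1: "((\<lambda>\<tau>. lr (2 * pi * \<tau>)) has_real_derivative lrd (2 * pi * \<tau>) * (2 * pi)) (at \<tau>)"
    by (rule DERIV_chain2[OF lr_deriv]) (auto intro!: derivative_eq_intros)
  have 2: "((\<lambda>\<tau>. 2 * pi * \<tau>) has_real_derivative 2 * pi) (at \<tau>)"
    by (auto intro!: derivative_eq_intros)
  have 3: "of_real (lrd (2 * pi * \<tau>) * (2 * pi)) + \<i> * of_real (2 * pi) = of_real (2 * pi * lrd (2 * pi * \<tau>)) + 2 * of_real pi * \<i>"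
    by (simp add: mult_ac)
  show ?thesis
    using has_vector_derivative_add[OF has_vector_derivative_of_real[OF 1] has_vector_derivative_mult_right[OF has_vector_derivative_of_real[OF 2], of \<i>]]
    unfolding 3 .
qed

lemma loop_deriv: "(loop has_vector_derivative (of_real (2 * pi * lrd (2 * pi * \<tau>)) + 2 * of_real pi * \<i>) * loop \<tau>) (at \<tau>)"
  using field_vector_diff_chain_at[OF log_loop_deriv[of \<tau>] DERIV_exp]
  unfolding loop_def[abs_def] zeta_def Complex_eq comp_def .

lemma lrd_cont: "continuous_on S lrd"
  unfolding lrd_def[abs_def] using u_of(3) kapd_pos u_of(1)
  by (intro continuous_intros u_of_cont kapd_u_of_cont) (auto simp: less_imp_neq[symmetric] less_imp_le)

lemma valid_path_loop: "valid_path loop"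
proof -
  have "continuous_on {0..1} loop"
    by (rule continuous_on_vector_derivative) (auto intro: has_vector_derivative_at_within loop_deriv)
  then have "loop C1_differentiable_on {0..1}"
    unfolding C1_differentiable_on_def
    by (intro exI[of _ "\<lambda>\<tau>. (of_real (2 * pi * lrd (2 * pi * \<tau>)) + 2 * of_real pi * \<i>) * loop \<tau>"] conjI ballI loop_deriv continuous_intros
      continuous_on_compose2[OF lrd_cont[of UNIV]]) auto
  then show ?thesis unfolding valid_path_def by (rule C1_differentiable_imp_piecewise)
qed

lemma lr_periodic: "lr (2 * pi) = lr 0" by (simp add: lr_def u_of_def)

lemma loop_closed: "pathfinish loop = pathstart loop"
  unfolding pathfinish_def pathstart_def loop_def zeta_def by (simp add: lr_periodic exp_eq_polar Complex_eq exp_add)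

lemma zeta_nonzero: "zeta \<theta> \<noteq> 0" by (simp add: zeta_def)

text \<open>The integral of dw / w is the increment of the explicit logarithm: its real part returns
  to its value, its imaginary part grows by 2 pi.\<close>

lemma winding_loop_0: "winding_number loop 0 = 1"
proof -
  have z: "0 \<notin> path_image loop" by (auto simp: path_image_def loop_def zeta_nonzero)
  have "((\<lambda>\<tau>. of_real (2 * pi * lrd (2 * pi * \<tau>)) + 2 * of_real pi * \<i>) has_integral
     (of_real (lr (2 * pi * 1)) + \<i> * of_real (2 * pi * 1)) - (of_real (lr (2 * pi * 0)) + \<i> * of_real (2 * pi * 0))) {0..1::real}"
  proof (rule fundamental_theorem_of_calculus)
    show "((\<lambda>\<tau>. of_real (lr (2 * pi * \<tau>)) + \<i> * of_real (2 * pi * \<tau>)) has_vector_derivative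
      of_real (2 * pi * lrd (2 * pi * \<tau>)) + 2 * of_real pi * \<i>) (at \<tau> within {0..1})" for \<tau>
      by (rule has_vector_derivative_at_within[OF log_loop_deriv])
  qed auto
  then have "((\<lambda>\<tau>. of_real (2 * pi * lrd (2 * pi * \<tau>)) + 2 * of_real pi * \<i>) has_integral 2 * of_real pi * \<i>) {0..1::real}"
    by (simp add: lr_periodic mult.commute[of \<i>])
  then have "((\<lambda>w. 1 / (w - 0)) has_contour_integral 2 * of_real pi * \<i>) loop"
    unfolding has_contour_integral
    by (rule has_integral_eq[rotated]) (simp add: vector_derivative_at[OF loop_deriv] vector_derivative_within_cbox loop_def zeta_nonzero
       has_vector_derivative_at_within vector_derivative_at_within_ivl[OF loop_deriv])
  then have "contour_integral loop (\<lambda>w. 1 / (w - 0)) = 2 * of_real pi * \<i>" by (rule contour_integral_unique)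
  then show ?thesis unfolding winding_number_valid_path[OF valid_path_loop z] by simp
qed

text \<open>On the curve (w - v) Q(w) = (X + y) w, so dw / ((w - v) Q(w)) is 1 / (y + X) times dw /
  w = d(log r) + i d\<theta>, and the imaginary part isolates d\<theta>. The residue at v is 1 /
  Q(v), where Q(v) is the derivative at v of (w - a) (w - b) (w - c) + y w.\<close>

lemma stieltjes_curve:
  assumes y: "y > 0" and v: "0 < v" "v < a" "(v - a) * (v - b) * (v - c) = - y * v"
  shows "((\<lambda>\<theta>. 1 / (y + X (u_of \<theta>))) has_integral
     pi / ((v - b) * (v - c) + (v - a) * (v - c) + (v - a) * (v - b) + y)) {0..pi}"
proof -
  define Q where "Q w = w\<^sup>2 - of_real (sig - v) * w + of_real (e3 / v)" for w :: complex
  define D where "D = (v - b) * (v - c) + (v - a) * (v - c) + (v - a) * (v - b) + y"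
  have Xv: "X v = - y" using v by (simp add: X_def)
  have fac: "(w - of_real a) * (w - of_real b) * (w - of_real c) + of_real y * w = (w - of_real v) * Q w" for w
    using cubic_factor[of v w] v(1) by (simp add: Xv Q_def)
  have Q_real: "Q (of_real t) = of_real (t\<^sup>2 - (sig - v) * t + e3 / v)" for t by (simp add: Q_def)
  have facr: "(t - a) * (t - b) * (t - c) + y * t = (t - v) * (t\<^sup>2 - (sig - v) * t + e3 / v)" for t
    using fac[of "of_real t"] unfolding Q_real of_real_mult[symmetric] of_real_diff[symmetric] of_real_add[symmetric] of_real_eq_iff .
  have Qv: "v\<^sup>2 - (sig - v) * v + e3 / v = D"
  proof -
    have "y = - ((v - a) * (v - b) * (v - c)) / v" using v by (simp add: field_simps)
    then show ?thesis unfolding D_def sig_def e3_def using v(1) by (simp add: field_simps power2_eq_square)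
  qed
  have e3v: "e3 / v > b\<^sup>2"
  proof -
    have "v * b\<^sup>2 < a * b\<^sup>2" using v b_pos by simp
    also have "\<dots> < e3" unfolding e3_def using a_pos b_pos bc by (simp add: power2_eq_square)
    finally show ?thesis using v(1) by (simp add: field_simps)
  qed
  \<comment> \<open>Left of a the quadratic is at least its value at a, which the factorization
    shows to be positive; between a and b the cubic itself is positive.\<close>
  have Q_pos: "t\<^sup>2 - (sig - v) * t + e3 / v > 0" if "t < b" for t
  proof (cases "t \<le> a")
    case True
    have "(a - v) * (a\<^sup>2 - (sig - v) * a + e3 / v) = y * a" using facr[of a] by simp
    then have "(a - v) * (a\<^sup>2 - (sig - v) * a + e3 / v) > 0" using y a_pos by simp
    then have 1: "a\<^sup>2 - (sig - v) * a + e3 / v > 0" using v(2)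
      by (meson diff_gt_0_iff_gt zero_less_mult_pos)
    have "(a - t) * (sig - v - a - t) \<ge> 0" using True v ab bc by (intro mult_nonneg_nonneg) (auto simp: sig_def)
    then show ?thesis using 1 by (simp add: algebra_simps power2_eq_square)
  next
    case False
    have "(t - a) * (t - b) < 0" using False that by (intro mult_pos_neg) auto
    then have "(t - a) * (t - b) * (t - c) > 0" using that bc by (intro mult_neg_neg) auto
    moreover have "y * t > 0" using y False a_pos by simp
    ultimately have "(t - v) * (t\<^sup>2 - (sig - v) * t + e3 / v) > 0" unfolding facr[symmetric] by linarith
    then show ?thesis using False v by (simp add: zero_less_mult_iff)
  qed
  \<comment> \<open>A nonreal zero of Q has its conjugate as the other zero, so its squared modulus
    is e3 / v, which exceeds b^2 because v < a and b < c.\<close>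
  have Q_nz: "Q w \<noteq> 0" if w: "norm w < b" for w
  proof
    assume 0: "Q w = 0"
    show False
    proof (cases "Im w = 0")
      case True
      then obtain t where t: "w = of_real t" by (metis complex_is_Real_iff Reals_cases)
      then have "t < b" using w by simp
      then show False using Q_pos[of t] 0 unfolding t Q_real of_real_eq_0_iff by simp
    next
      case False
      have "Im (Q w) = 2 * Re w * Im w - (sig - v) * Im w" "Re (Q w) = (Re w)\<^sup>2 - (Im w)\<^sup>2 - (sig - v) * Re w + e3 / v"
        by (simp_all add: Q_def Re_power2 Im_power2)
      then have "(2 * Re w - (sig - v)) * Im w = 0" "(Re w)\<^sup>2 - (Im w)\<^sup>2 - (sig - v) * Re w + e3 / v = 0" using 0
        by (simp_all add: algebra_simps)
      moreover from this(1) have "sig - v = 2 * Re w" using False by simp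
      ultimately have "e3 / v = (norm w)\<^sup>2" unfolding cmod_power2 by (simp add: power2_eq_square)
      also have "\<dots> < b\<^sup>2" using w by (intro power_strict_mono) auto
      finally show False using e3v by simp
    qed
  qed
  have D_pos: "D > 0" using Q_pos[of v] v ab unfolding Qv by simp
  \<comment> \<open>On the curve the cubic equals X w with X > 0, whereas it is negative on (0, a);
    the curve therefore meets the positive axis only at or beyond a.\<close>
  have on_curve: "t > v" if "zeta \<theta> = of_real t" "t \<ge> 0" for \<theta> t
  proof -
    have t0: "t > 0" using that zeta_nonzero[of \<theta>] by (cases "t = 0") auto
    have "(t - a) * (t - b) * (t - c) = X (u_of \<theta>) * t"
      using zeta_cubic[of \<theta>] unfolding that(1) of_real_mult[symmetric] of_real_diff[symmetric] of_real_eq_iff .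
    then have "(t - a) * (t - b) * (t - c) > 0" using X_pos[OF u_of(1)] t0 by simp
    moreover have "(t - a) * (t - b) * (t - c) < 0" if "t < a"
      using that ab bc by (intro mult_pos_neg mult_neg_neg) auto
    ultimately have "t \<ge> a" by force
    then show ?thesis using v by simp
  qed
  \<comment> \<open>This lets v inherit the winding number, which the explicit logarithm gives only
    at 0.\<close>
  have seg: "closed_segment 0 (of_real v) \<inter> path_image loop = {}"
  proof -
    have "w \<notin> path_image loop" if w_seg: "w \<in> closed_segment 0 (of_real v)" for w
    proof
      assume "w \<in> path_image loop"
      then obtain \<tau> where \<tau>: "w = zeta (2 * pi * \<tau>)" by (auto simp: path_image_def loop_def)
      obtain s where s: "0 \<le> s" "s \<le> 1" "w = of_real (s * v)" using w_seg
        by (auto simp: in_segment scaleR_conv_of_real simp flip: of_real_mult)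
      then have "s * v > v" using on_curve[of "2 * pi * \<tau>" "s * v"] \<tau> v(1) by auto
      then show False using s v(1) by (simp add: mult_le_cancel_right2)
    qed
    then show ?thesis by blast
  qed
  have "winding_number loop (of_real v) = winding_number loop 0"
    by (rule winding_number_eq[OF valid_path_imp_path[OF valid_path_loop] loop_closed _ _ _ seg]) auto
  then have wind: "winding_number loop (of_real v) = 1" using winding_loop_0 by simp
  have nv: "zeta \<theta> \<noteq> of_real v" for \<theta> using on_curve[of \<theta> v] v by auto
  have "((\<lambda>w. (1 / Q w) / (w - of_real v)) has_contour_integral (2*pi * \<i> * winding_number loop (of_real v) * (1 / Q (of_real v)))) loop"
  proof (rule Cauchy_integral_formula_convex_simple[where S = "ball 0 b"])
    show "(\<lambda>w. 1 / Q w) holomorphic_on ball 0 b"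
    proof (intro holomorphic_on_divide holomorphic_on_const)
      show "Q holomorphic_on ball 0 b" unfolding Q_def[abs_def] by (intro holomorphic_intros)
    qed (use Q_nz in auto)
    show "of_real v \<in> interior (ball 0 b :: complex set)" using v ab by (simp add: interior_open)
    show "path_image loop \<subseteq> ball 0 b - {of_real v}" using norm_zeta_less nv by (auto simp: path_image_def loop_def)
  qed (use valid_path_loop loop_closed in auto)
  then have ci: "((\<lambda>w. (1 / Q w) / (w - of_real v)) has_contour_integral (of_real (2 * pi / D) * \<i>)) loop"
    unfolding wind Q_real Qv by (simp add: mult_ac)
  define \<phi> where "\<phi> \<theta> = 1 / (y + X (u_of \<theta>))" for \<theta>
  have "((\<lambda>\<tau>. of_real (\<phi> (2 * pi * \<tau>)) * (of_real (2 * pi * lrd (2 * pi * \<tau>)) + 2 * of_real pi * \<i>)) has_integral (of_real (2 * pi / D) * \<i>)) {0..1}"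
    using ci unfolding has_contour_integral
  proof (rule has_integral_eq[rotated])
    fix \<tau> :: real
    have vd: "vector_derivative loop (at \<tau>) = (of_real (2 * pi * lrd (2 * pi * \<tau>)) + 2 * of_real pi * \<i>) * loop \<tau>"
      by (rule vector_derivative_at[OF loop_deriv])
    define \<theta> where "\<theta> = 2 * pi * \<tau>"
    have "1 / Q (zeta \<theta>) / (zeta \<theta> - of_real v) = 1 / ((of_real (X (u_of \<theta>)) + of_real y) * zeta \<theta>)"
      using fac[of "zeta \<theta>"] unfolding zeta_cubic by (simp add: algebra_simps)
    then have key: "1 / Q (zeta \<theta>) / (zeta \<theta> - of_real v) * zeta \<theta> = of_real (\<phi> \<theta>)"
      using zeta_nonzero[of \<theta>] by (simp add: \<phi>_def add.commute)
    then show "1 / Q (loop \<tau>) / (loop \<tau> - of_real v) * vector_derivative loop (at \<tau>) =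
      of_real (\<phi> (2 * pi * \<tau>)) * (of_real (2 * pi * lrd (2 * pi * \<tau>)) + 2 * of_real pi * \<i>)"
      unfolding vd loop_def \<theta>_def[symmetric] key[symmetric] by (simp only: mult.assoc mult.commute[of "zeta \<theta>"])
  qed
  from has_integral_Im[OF this] have int1: "((\<lambda>\<tau>. \<phi> (2 * pi * \<tau>) * (2 * pi)) has_integral (2 * pi / D)) {0..1}"
    by simp
  have Xu: "X (u_of \<theta>) > 0" for \<theta> using X_pos[OF u_of(1)] .
  have "continuous_on {0..pi} (\<lambda>\<theta>. X (u_of \<theta>))"
    unfolding X_def using u_of(3) by (intro continuous_intros u_of_cont) (auto simp: less_imp_neq[symmetric])
  then have "continuous_on {0..pi} \<phi>"
    unfolding \<phi>_def using Xu y by (intro continuous_intros) (auto simp: add_pos_pos less_imp_neq[symmetric])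
  then have "\<phi> integrable_on {0..pi}" by (rule integrable_continuous_real)
  then obtain I where I: "(\<phi> has_integral I) (cbox 0 pi)" by (auto simp: integrable_on_def)
  \<comment> \<open>The two half turns contribute equally, so the integral over [0, pi] is half of
    the one over the closed curve.\<close>
  have refl: "\<phi> (2 * pi - \<theta>) = \<phi> \<theta>" for \<theta> by (simp add: \<phi>_def u_of_def)
  have h1: "((\<lambda>\<tau>. \<phi> (2 * pi * \<tau>)) has_integral I / (2 * pi)) {0..1/2}"
    using has_integral_affinity[OF I, of "2 * pi" 0] by (simp add: image_mult_atLeastAtMost)
  have im: "(\<lambda>x. 1 - x / (2 * pi)) ` {0..pi} = {1/2..1}"
  proof -
    have "(\<lambda>x. 1 - x / (2 * pi)) = (\<lambda>x. (- 1 / (2 * pi)) * x + 1)" by auto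
    then show ?thesis by (simp only: image_affinity_atLeastAtMost) (simp add: divide_simps)
  qed
  have h2: "((\<lambda>\<tau>. \<phi> (2 * pi * \<tau>)) has_integral I / (2 * pi)) {1/2..1}"
    using has_integral_affinity[OF I, of "- 2 * pi" "2 * pi"] refl by (simp add: im)
  from has_integral_combine[OF _ _ h1 h2] have "((\<lambda>\<tau>. \<phi> (2 * pi * \<tau>)) has_integral I / (2 * pi) + I / (2 * pi)) {0..1}"
    by simp
  then have "((\<lambda>\<tau>. \<phi> (2 * pi * \<tau>) * (2 * pi)) has_integral (I / (2 * pi) + I / (2 * pi)) * (2 * pi)) {0..1}"
    by (rule has_integral_mult_left)
  with int1 have "(I / (2 * pi) + I / (2 * pi)) * (2 * pi) = 2 * pi / D" by (metis has_integral_unique)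
  then have "I = pi / D" by simp
  then show ?thesis using I unfolding \<phi>_def D_def by simp
qed

end

section \<open>The algebraic function\<close>

context triple
begin

text \<open>Moduli increase here while they decrease in \<open>ordered_solutions\<close>: the change
  of variable z = -e3 / w inverts them, so the dominant z corresponds to \<open>U1\<close>.\<close>

definition roots3 :: "complex \<Rightarrow> complex \<Rightarrow> complex \<Rightarrow> complex \<Rightarrow> bool" where
  "roots3 x U1 U2 U3 \<longleftrightarrow>
     (\<forall>v. (v - U1) * (v - U2) * (v - U3) = (v - of_real a) * (v - of_real b) * (v - of_real c) - x * v) \<and>
     norm U1 \<le> norm U2 \<and> norm U2 \<le> norm U3"

lemma roots3_eq:
  "roots3 x U1 U2 U3 \<Longrightarrow> (v - U1) * (v - U2) * (v - U3) = (v - of_real a) * (v - of_real b) * (v - of_real c) - x * v"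
  by (simp add: roots3_def)

lemma roots3D:
  assumes "roots3 x U1 U2 U3"
  shows "U1 + U2 + U3 = of_real sig" "U1 * U2 + U1 * U3 + U2 * U3 = of_real e2 - x" "U1 * U2 * U3 = of_real e3"
    "norm U1 \<le> norm U2" "norm U2 \<le> norm U3"
proof -
  have eq: "(v - U1) * (v - U2) * (v - U3) = (v - of_real a) * (v - of_real b) * (v - of_real c) - x * v" for v
    using assms by (simp add: roots3_def)
  have 0: "U1 * U2 * U3 = of_real e3" using eq[of 0] by (simp add: e3_def)
  define A where "A = U1 + U2 + U3 - of_real sig"
  define B where "B = U1 * U2 + U1 * U3 + U2 * U3 - (of_real e2 - x)"
  have "- A * v\<^sup>2 + B * v = 0" for v
    using eq[of v] 0 unfolding A_def B_def sig_def e2_def e3_def by (simp add: algebra_simps power2_eq_square)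
  from this[of 1] this[of "-1"] have "A = 0" "B = 0" by auto
  then show "U1 + U2 + U3 = of_real sig" "U1 * U2 + U1 * U3 + U2 * U3 = of_real e2 - x"
    by (simp_all add: A_def B_def)
  show "U1 * U2 * U3 = of_real e3" by (rule 0)
qed (use assms in \<open>auto simp: roots3_def\<close>)

lemma roots3_cnj:
  assumes "roots3 x U1 U2 U3"
  shows "roots3 (cnj x) (cnj U1) (cnj U2) (cnj U3)"
proof -
  have "(v - cnj U1) * (v - cnj U2) * (v - cnj U3) = (v - of_real a) * (v - of_real b) * (v - of_real c) - cnj x * v" for v
  proof -
    have "cnj ((cnj v - U1) * (cnj v - U2) * (cnj v - U3)) = cnj ((cnj v - of_real a) * (cnj v - of_real b) * (cnj v - of_real c) - x * cnj v)"
      using assms by (simp add: roots3_def)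
    then show ?thesis by simp
  qed
  then show ?thesis using assms by (simp add: roots3_def)
qed

section \<open>Ordered zeros near the arc and ties in modulus\<close>

lemma zeta_split:
  "(v - of_real a) * (v - of_real b) * (v - of_real c) - of_real (X (u_of \<theta>)) * v
     = (v - of_real (u_of \<theta>)) * (v - zeta \<theta>) * (v - cnj (zeta \<theta>))"
proof -
  have "(norm (zeta \<theta>))\<^sup>2 = e3 / u_of \<theta>" unfolding norm_zeta using e3_pos u_of(3)[of \<theta>] by simp
  then have 1: "of_real (e3 / u_of \<theta>) = zeta \<theta> * cnj (zeta \<theta>)" by (metis complex_norm_square)
  have 2: "of_real (sig - u_of \<theta>) = zeta \<theta> + cnj (zeta \<theta>)" unfolding Re_zeta[symmetric]
    by (simp add: complex_add_cnj)
  have "u_of \<theta> \<noteq> 0" using u_of(3)[of \<theta>] by simp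
  from cubic_factor[OF this, of v] show ?thesis unfolding 1 2 by (simp add: algebra_simps power2_eq_square)
qed

lemma Im_zeta_pos: "0 < \<theta> \<Longrightarrow> \<theta> < pi \<Longrightarrow> Im (zeta \<theta>) > 0"
  by (simp add: zeta_def Im_exp sin_gt_zero)

text \<open>If \<rho> is a zero of the cubic at X u, the product of its distances to the zeros at w
  is |w - X u| |\<rho>|; when this is below e^3, some zero at w lies within e of \<rho>. Modulus
  then singles out the zero near u as \<open>U3\<close>, leaving \<open>U1\<close> and
  \<open>U2\<close> for the conjugate pair in either order.\<close>

lemma roots3_perturb:
  assumes \<theta>: "0 < \<theta>" "\<theta> < pi" and \<eta>: "\<eta> > 0"
  defines "u \<equiv> u_of \<theta>" and "\<zeta> \<equiv> zeta \<theta>"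
  obtains \<delta> where "\<delta> > 0"
    "\<And>w U1 U2 U3. norm (w - of_real (X u)) < \<delta> \<Longrightarrow> roots3 w U1 U2 U3 \<Longrightarrow>
       norm (U3 - of_real u) < \<eta> \<and> (norm (U1 - \<zeta>) < \<eta> \<and> norm (U2 - cnj \<zeta>) < \<eta> \<or> norm (U1 - cnj \<zeta>) < \<eta> \<and> norm (U2 - \<zeta>) < \<eta>)"
proof -
  have u: "u > c" "u > 0" using u_of by (auto simp: u_def)
  have \<zeta>: "norm \<zeta> < u" "Im \<zeta> > 0" using norm_zeta_less[of \<theta>] bc u Im_zeta_pos[OF \<theta>] by (auto simp: \<zeta>_def)
  \<comment> \<open>Half the modulus gap separates the disc around u from the other two, and Im
    \<zeta> separates those two, so no zero is claimed twice.\<close>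
  define e where "e = min \<eta> (min ((u - norm \<zeta>) / 2) (Im \<zeta>))"
  have e: "e > 0" "e \<le> \<eta>" "2 * e \<le> u - norm \<zeta>" "e \<le> Im \<zeta>" using \<eta> \<zeta> by (auto simp: e_def min_def)
  define \<delta> where "\<delta> = e ^ 3 / u"
  have \<delta>: "\<delta> > 0" using e u by (simp add: \<delta>_def)
  show ?thesis
  proof (rule that[OF \<delta>])
    fix w U1 U2 U3 assume w: "norm (w - of_real (X u)) < \<delta>" and U: "roots3 w U1 U2 U3"
    have near: "norm (\<rho> - U1) < e \<or> norm (\<rho> - U2) < e \<or> norm (\<rho> - U3) < e"
      if \<rho>: "\<rho> = of_real u \<or> \<rho> = \<zeta> \<or> \<rho> = cnj \<zeta>" for \<rho>
    proof (rule ccontr)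
      assume "\<not> ?thesis"
      then have ge: "e \<le> norm (\<rho> - U1)" "e \<le> norm (\<rho> - U2)" "e \<le> norm (\<rho> - U3)" by auto
      have "(\<rho> - of_real a) * (\<rho> - of_real b) * (\<rho> - of_real c) - of_real (X u) * \<rho> = 0"
        using zeta_split[of \<rho> \<theta>] \<rho> by (auto simp: u_def \<zeta>_def)
      then have "(\<rho> - U1) * (\<rho> - U2) * (\<rho> - U3) = (of_real (X u) - w) * \<rho>"
        unfolding roots3_eq[OF U] by (simp add: algebra_simps)
      then have "norm (\<rho> - U1) * norm (\<rho> - U2) * norm (\<rho> - U3) = norm (w - of_real (X u)) * norm \<rho>"
        by (metis norm_mult norm_minus_commute)
      moreover have "e * e * e \<le> norm (\<rho> - U1) * norm (\<rho> - U2) * norm (\<rho> - U3)"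
        using ge e by (intro mult_mono mult_nonneg_nonneg) auto
      moreover have "norm (w - of_real (X u)) * norm \<rho> < \<delta> * u"
      proof -
        have "norm \<rho> \<le> u" using \<rho> \<zeta> u by auto
        then have "norm (w - of_real (X u)) * norm \<rho> \<le> norm (w - of_real (X u)) * u" by (intro mult_left_mono) auto
        also have "\<dots> < \<delta> * u" using w u by simp
        finally show ?thesis .
      qed
      ultimately show False using u by (simp add: \<delta>_def power3_eq_cube)
    qed
    have order: "norm U1 \<le> norm U2" "norm U2 \<le> norm U3" using roots3D[OF U] by auto
    have big: "norm V > norm \<zeta> + e" if "norm (of_real u - V) < e" for V :: complex
      using norm_triangle_ineq2[of "of_real u" V] that u e by simp
    have small: "norm V < norm \<zeta> + e" if "norm (\<zeta> - V) < e \<or> norm (cnj \<zeta> - V) < e" for V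
      using norm_triangle_ineq2[of V \<zeta>] norm_triangle_ineq2[of V "cnj \<zeta>"] that by (auto simp: norm_minus_commute)
    have excl: "\<not> (norm (\<zeta> - V) < e \<and> norm (cnj \<zeta> - V) < e)" for V
    proof
      assume *: "norm (\<zeta> - V) < e \<and> norm (cnj \<zeta> - V) < e"
      have "2 * Im \<zeta> \<le> norm (\<zeta> - cnj \<zeta>)" using abs_Im_le_cmod[of "\<zeta> - cnj \<zeta>"] \<zeta> by simp
      also have "\<dots> = norm ((\<zeta> - V) - (cnj \<zeta> - V))" by simp
      also have "\<dots> < 2 * e" using norm_triangle_ineq4[of "\<zeta> - V" "cnj \<zeta> - V"] * by linarith
      finally show False using e by simp
    qed
    have n1: "norm (of_real u - U1) < e \<or> norm (of_real u - U2) < e \<or> norm (of_real u - U3) < e"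
      and n2: "norm (\<zeta> - U1) < e \<or> norm (\<zeta> - U2) < e \<or> norm (\<zeta> - U3) < e"
      and n3: "norm (cnj \<zeta> - U1) < e \<or> norm (cnj \<zeta> - U2) < e \<or> norm (cnj \<zeta> - U3) < e"
      using near by blast+
    have c1: "\<not> norm (of_real u - U1) < e" using big[of U1] small[of U1] small[of U2] small[of U3] n2 order by linarith
    have c2: "\<not> norm (of_real u - U2) < e" using big[of U2] small[of U2] small[of U3] n2 n3 order excl[of U1] by linarith
    have c3: "norm (of_real u - U3) < e" using n1 c1 c2 by blast
    have "norm (\<zeta> - U1) < e \<and> norm (cnj \<zeta> - U2) < e \<or> norm (\<zeta> - U2) < e \<and> norm (cnj \<zeta> - U1) < e"
      using n2 n3 big[OF c3] small[of U3] excl[of U1] excl[of U2] by linarith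
    then show "norm (U3 - of_real u) < \<eta> \<and> (norm (U1 - \<zeta>) < \<eta> \<and> norm (U2 - cnj \<zeta>) < \<eta> \<or> norm (U1 - cnj \<zeta>) < \<eta> \<and> norm (U2 - \<zeta>) < \<eta>)"
      using c3 e(2) by (auto simp: norm_minus_commute)
  qed
qed

text \<open>The perturbation lemma is used at the unperturbed point: \<open>U1\<close> and
  \<open>U2\<close> are arbitrarily close to two numbers of equal modulus, whichever listing was
  chosen.\<close>

lemma roots3_tie:
  assumes \<theta>: "0 < \<theta>" "\<theta> < pi" and U: "roots3 (of_real (X (u_of \<theta>))) U1 U2 U3"
  shows "norm U1 = norm U2"
proof (rule ccontr)
  assume ne: "norm U1 \<noteq> norm U2"
  define \<eta> where "\<eta> = \<bar>norm U1 - norm U2\<bar> / 2"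
  have "\<eta> > 0" using ne by (simp add: \<eta>_def)
  from roots3_perturb[OF \<theta> this] obtain \<delta> where "\<delta> > 0" and
    \<delta>: "\<And>w U1 U2 U3. norm (w - of_real (X (u_of \<theta>))) < \<delta> \<Longrightarrow> roots3 w U1 U2 U3 \<Longrightarrow>
       norm (U3 - of_real (u_of \<theta>)) < \<eta> \<and> (norm (U1 - zeta \<theta>) < \<eta> \<and> norm (U2 - cnj (zeta \<theta>)) < \<eta> \<or> norm (U1 - cnj (zeta \<theta>)) < \<eta> \<and> norm (U2 - zeta \<theta>) < \<eta>)"
    by blast
  from \<delta>[OF _ U] \<open>\<delta> > 0\<close> have "norm (U1 - zeta \<theta>) < \<eta> \<and> norm (U2 - cnj (zeta \<theta>)) < \<eta> \<or> norm (U1 - cnj (zeta \<theta>)) < \<eta> \<and> norm (U2 - zeta \<theta>) < \<eta>"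
    by simp
  moreover have "\<bar>norm U1 - norm (zeta \<theta>)\<bar> \<le> norm (U1 - zeta \<theta>)" "\<bar>norm U2 - norm (zeta \<theta>)\<bar> \<le> norm (U2 - zeta \<theta>)"
     "\<bar>norm U1 - norm (zeta \<theta>)\<bar> \<le> norm (U1 - cnj (zeta \<theta>))" "\<bar>norm U2 - norm (zeta \<theta>)\<bar> \<le> norm (U2 - cnj (zeta \<theta>))"
    using norm_triangle_ineq3[of U1 "zeta \<theta>"] norm_triangle_ineq3[of U2 "zeta \<theta>"]
      norm_triangle_ineq3[of U1 "cnj (zeta \<theta>)"] norm_triangle_ineq3[of U2 "cnj (zeta \<theta>)"] by auto
  ultimately show False unfolding \<eta>_def by (smt (verit) field_sum_of_halves)
qed

text \<open>Candidates for accidental ties: opposite real zeros force the third to be sig; a double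
  zero d forces the third to be sig - 2 d; a real zero with the modulus of a conjugate pair is the
  cube root of e3. A finite superset is enough, since it is a null set for the density.\<close>

definition tie_exceptions :: "real set" where
  "tie_exceptions = X ` ({sig, root 3 e3} \<union> {d. d\<^sup>2 * (sig - 2 * d) = e3})"

lemma finite_tie_exceptions: "finite tie_exceptions"
proof -
  have "{d. d\<^sup>2 * (sig - 2 * d) = e3} = {d. poly [:- e3, 0, sig, -2:] d = 0}"
    by (auto simp: algebra_simps power2_eq_square)
  moreover have "finite {d. poly [:- e3, 0, sig, -2:] d = 0}" by (rule poly_roots_finite) simp
  ultimately show ?thesis unfolding tie_exceptions_def by simp
qed

lemma roots3_real_root:
  assumes "roots3 (of_real x) U1 U2 U3" "of_real r \<in> {U1, U2, U3}"
  shows "x = X r" "r \<noteq> 0"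
proof -
  have "(of_real r - U1) * (of_real r - U2) * (of_real r - U3) = 0" using assms(2) by auto
  then have "complex_of_real ((r - a) * (r - b) * (r - c) - x * r) = 0"
    unfolding roots3_eq[OF assms(1)] by simp
  then have 1: "(r - a) * (r - b) * (r - c) = x * r" unfolding of_real_eq_0_iff by simp
  show 2: "r \<noteq> 0" using roots3D(3)[OF assms(1)] assms(2) e3_pos by auto
  show "x = X r" using 1 2 by (simp add: X_def field_simps)
qed

text \<open>Nonreal zeros occur in conjugate pairs. If \<open>U1\<close> and \<open>U2\<close> form
  such a pair, the third zero u is real with |kap u| < 1, which puts x on the open arc; every other
  configuration of equal moduli is one of the exceptions.\<close>

lemma roots3_tieD:
  assumes U: "roots3 (of_real x) U1 U2 U3" and eq: "norm U1 = norm U2"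
  shows "(\<exists>\<theta>. 0 < \<theta> \<and> \<theta> < pi \<and> x = X (u_of \<theta>)) \<or> x \<in> tie_exceptions"
proof -
  note D = roots3D[OF U]
  have conj: "cnj V = U1 \<or> cnj V = U2 \<or> cnj V = U3" if "V = U1 \<or> V = U2 \<or> V = U3" for V
  proof -
    have "(V - U1) * (V - U2) * (V - U3) = 0" using that by auto
    then have "(V - of_real a) * (V - of_real b) * (V - of_real c) - of_real x * V = 0"
      unfolding roots3_eq[OF U] .
    then have "cnj ((V - of_real a) * (V - of_real b) * (V - of_real c) - of_real x * V) = 0" by simp
    then have "(cnj V - U1) * (cnj V - U2) * (cnj V - U3) = 0" unfolding roots3_eq[OF U] by simp
    then show ?thesis by auto
  qed
  have cube: "x \<in> tie_exceptions" if r: "of_real r \<in> {U1, U2, U3}" "r * \<bar>r\<bar>\<^sup>2 = e3" for r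
  proof -
    have "r ^ 3 = e3" using r(2) by (simp add: power2_eq_square power3_eq_cube)
    then have "r = root 3 e3" using odd_real_root_power_cancel[of 3 r] by simp
    then show ?thesis using roots3_real_root(1)[OF U r(1)] by (auto simp: tie_exceptions_def)
  qed
  have pair: "V * cnj V = of_real ((norm V)\<^sup>2)" for V :: complex by (metis complex_norm_square)
  show ?thesis
  proof (cases "U1 \<in> \<real>")
    case True
    then obtain r where r: "U1 = of_real r" by (auto elim: Reals_cases)
    show ?thesis
    proof (cases "U2 \<in> \<real>")
      case True
      then obtain t where t: "U2 = of_real t" by (auto elim: Reals_cases)
      have "t = r \<or> t = - r" using eq unfolding r t by auto
      then show ?thesis
      proof
        assume "t = r"
        then have 3: "U3 = of_real (sig - 2 * r)" using D(1) unfolding r t by (simp add: algebra_simps)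
        have "complex_of_real (r * r * (sig - 2 * r)) = of_real e3" using D(3) unfolding 3 r t \<open>t = r\<close> by simp
        then have "r\<^sup>2 * (sig - 2 * r) = e3" unfolding of_real_eq_iff by (simp add: power2_eq_square)
        then show ?thesis using roots3_real_root(1)[OF U, of r] r by (auto simp: tie_exceptions_def)
      next
        assume "t = - r"
        then have "U3 = of_real sig" using D(1) unfolding r t by (simp add: algebra_simps)
        then show ?thesis using roots3_real_root(1)[OF U, of sig] by (auto simp: tie_exceptions_def)
      qed
    next
      case False
      then have "cnj U2 \<noteq> U2" "cnj U2 \<noteq> U1" using True by (auto simp: Reals_cnj_iff)
      then have "U3 = cnj U2" using conj[of U2] by auto
      then have "U1 * (U2 * cnj U2) = of_real e3" using D(3) by (simp add: mult_ac)
      then have "complex_of_real (r * \<bar>r\<bar>\<^sup>2) = of_real e3" unfolding pair eq[symmetric] r by simp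
      then show ?thesis using cube[of r] r unfolding of_real_eq_iff by simp
    qed
  next
    case False
    then have "cnj U1 \<noteq> U1" by (simp add: Reals_cnj_iff)
    then consider "cnj U1 = U2" | "cnj U1 = U3" "cnj U1 \<noteq> U2" using conj[of U1] by auto
    then show ?thesis
    proof cases
      case 1
      define N where "N = (norm U1)\<^sup>2"
      have U1: "U1 \<noteq> 0" using False by auto
      then have N: "N > 0" by (simp add: N_def)
      have "of_real N * U3 = of_real e3" using D(3) unfolding 1[symmetric] pair N_def .
      then have 3: "U3 = of_real (e3 / N)" using N by (simp add: field_simps)
      define u where "u = e3 / N"
      have u: "u > 0" using e3_pos N by (simp add: u_def)
      have Re: "2 * Re U1 = sig - u"
      proof -
        have "U1 + cnj U1 + of_real u = of_real sig" using D(1) unfolding 1[symmetric] 3 u_def by simp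
        then have "complex_of_real (2 * Re U1 + u) = of_real sig" by (simp add: complex_add_cnj)
        then show ?thesis unfolding of_real_eq_iff by simp
      qed
      have xu: "x = X u" using roots3_real_root(1)[OF U, of u] 3 u_def by auto
      have Im: "Im U1 \<noteq> 0" using False by (simp add: complex_is_Real_iff)
      have "(Re U1)\<^sup>2 < N" using Im unfolding N_def cmod_power2 by simp
      then have "(sig - u)\<^sup>2 < 4 * N" unfolding Re[symmetric] by (simp add: power_mult_distrib)
      moreover have "N = e3 / u" using N e3_pos by (simp add: u_def)
      ultimately have "(sig - u)\<^sup>2 < 4 * (e3 / u)" by simp
      then have k1: "(sig - u)\<^sup>2 * u / (4 * e3) < 1" using u e3_pos by (simp add: field_simps)
      have "(kap u)\<^sup>2 = (sig - u)\<^sup>2 * u / (4 * e3)"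
        unfolding kap_def power2_commute[of sig u] using u e3_pos by (simp add: power_divide power_mult_distrib)
      then have "\<bar>kap u\<bar> < 1" using k1 abs_square_less_1[of "kap u"] by simp
      then have k: "-1 < kap u" "kap u < 1" by auto
      \<comment> \<open>Here u is the zero of largest modulus, so u \<le> a would make the product
        of all three zeros at most a^3, less than a b c.\<close>
      have "a < u"
      proof (rule ccontr)
        assume "\<not> a < u"
        then have le: "u \<le> a" by simp
        have "norm U1 \<le> u" using D(4,5) unfolding 3 u_def[symmetric] using u by simp
        then have "N \<le> u\<^sup>2" unfolding N_def by (intro power_mono) auto
        then have "N * u \<le> u\<^sup>2 * u" using u by simp
        then have "e3 \<le> u ^ 3" using N by (simp add: u_def power3_eq_cube power2_eq_square)
        also have "\<dots> \<le> a ^ 3" using le u by (intro power_mono) auto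
        also have "\<dots> = a * (a * a)" by (simp add: power3_eq_cube)
        also have "\<dots> < a * (b * c)" using a_pos ab bc by (intro mult_strict_left_mono mult_strict_mono) auto
        finally show False by (simp add: e3_def)
      qed
      then have uc: "u > c" using kap_le[of u] k by force
      define \<theta> where "\<theta> = arccos (- kap u)"
      have "cos \<theta> = - kap u" unfolding \<theta>_def using k by (intro cos_arccos) auto
      then have "u_of \<theta> = u" using W_unique[OF uc] by (simp add: u_of_def)
      moreover have "0 < \<theta> \<and> \<theta> < pi" using arccos_lt_bounded[of "- kap u"] k by (simp add: \<theta>_def)
      ultimately show ?thesis using xu by auto
    next
      case 2
      have "U2 = of_real sig - (U1 + cnj U1)" using D(1) 2(1) by (simp add: algebra_simps)
      then have "U2 = of_real (sig - 2 * Re U1)" by (simp add: complex_add_cnj)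
      then obtain r where r: "U2 = of_real r" by blast
      have "U2 * (U1 * cnj U1) = of_real e3" using D(3) 2 by (simp add: mult_ac)
      then have "complex_of_real (r * \<bar>r\<bar>\<^sup>2) = of_real e3" unfolding pair eq r by simp
      then show ?thesis using cube[of r] r unfolding of_real_eq_iff by simp
    qed
  qed
qed

text \<open>Near u the factor relating Im w to Im U3 is close to \<open>Xd u > 0\<close>, so Im U3 >
  0. With v the principal root of U3, the numbers y1 = -U1 v and y2 = -U2 v have product e3 > 0 and
  a sum with positive imaginary part; the smaller one must then have negative imaginary part. Thus
  Im (U1 v) > 0, which fails when U1 is near the conjugate of \<zeta>.\<close>

lemma roots3_sign:
  assumes \<theta>: "0 < \<theta>" "\<theta> < pi"
  obtains \<eta> where "\<eta> > 0"
    "\<And>w U1 U2 U3. roots3 w U1 U2 U3 \<Longrightarrow> Im w > 0 \<Longrightarrow> norm (U3 - of_real (u_of \<theta>)) < \<eta> \<Longrightarrow> \<not> norm (U1 - cnj (zeta \<theta>)) < \<eta>"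
proof -
  define u \<zeta> where "u = u_of \<theta>" and "\<zeta> = zeta \<theta>"
  have u: "u > c" "u > 0" using u_of by (auto simp: u_def)
  have \<zeta>: "Im \<zeta> > 0" using Im_zeta_pos[OF \<theta>] by (simp add: \<zeta>_def)
  \<comment> \<open>The forbidden limit of the pair (U1, U3). The three inequalities that the
    argument needs are strict at this point, hence hold in a neighbourhood of it.\<close>
  define P where "P = (cnj \<zeta>, complex_of_real u)"
  have np: "snd P \<notin> \<real>\<^sub>\<le>\<^sub>0" using u by (simp add: P_def)
  have fs: "((\<lambda>x. fst x) \<longlongrightarrow> fst P) (nhds P)" "((\<lambda>x. snd x) \<longlongrightarrow> snd P) (nhds P)"
    by (rule tendsto_fst tendsto_snd, rule filterlim_ident)+
  have cs: "((\<lambda>x. csqrt (snd x)) \<longlongrightarrow> csqrt (snd P)) (nhds P)"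
    by (rule isCont_tendsto_compose[OF continuous_at_csqrt[OF np] fs(2)])
  have csP: "csqrt (snd P) = of_real (sqrt u)" using u by (simp add: P_def)
  have "((\<lambda>x. 2 * Re (snd x) - sig + e3 / (norm (snd x))\<^sup>2) \<longlongrightarrow> 2 * Re (snd P) - sig + e3 / (norm (snd P))\<^sup>2) (nhds P)"
    by (rule tendsto_add[OF tendsto_diff[OF tendsto_mult[OF tendsto_const tendsto_Re[OF fs(2)]] tendsto_const]
      tendsto_divide[OF tendsto_const tendsto_power[OF tendsto_norm[OF fs(2)]]]]) (use u in \<open>auto simp: P_def\<close>)
  moreover have "2 * Re (snd P) - sig + e3 / (norm (snd P))\<^sup>2 > 0"
    using Xd_pos[of u] Xd_alt[of u] u by (simp add: P_def)
  ultimately have ev1: "eventually (\<lambda>x. 2 * Re (snd x) - sig + e3 / (norm (snd x))\<^sup>2 > 0) (nhds P)"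
    by (rule order_tendstoD)
  have "((\<lambda>x. 3 * (Re (csqrt (snd x)))\<^sup>2 - (Im (csqrt (snd x)))\<^sup>2 - sig) \<longlongrightarrow> 3 * (Re (csqrt (snd P)))\<^sup>2 - (Im (csqrt (snd P)))\<^sup>2 - sig) (nhds P)"
    by (rule tendsto_diff[OF tendsto_diff[OF tendsto_mult[OF tendsto_const tendsto_power[OF tendsto_Re[OF cs]]]
      tendsto_power[OF tendsto_Im[OF cs]]] tendsto_const])
  moreover have "3 * (Re (csqrt (snd P)))\<^sup>2 - (Im (csqrt (snd P)))\<^sup>2 - sig > 0"
    unfolding csP using u ab bc by (simp add: sig_def)
  ultimately have ev2: "eventually (\<lambda>x. 3 * (Re (csqrt (snd x)))\<^sup>2 - (Im (csqrt (snd x)))\<^sup>2 - sig > 0) (nhds P)"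
    by (rule order_tendstoD)
  have "((\<lambda>x. Im (fst x * csqrt (snd x))) \<longlongrightarrow> Im (fst P * csqrt (snd P))) (nhds P)"
    by (rule tendsto_Im[OF tendsto_mult[OF fs(1) cs]])
  moreover have "Im (fst P * csqrt (snd P)) < 0"
    unfolding csP using u \<zeta> by (simp add: P_def)
  ultimately have ev3: "eventually (\<lambda>x. Im (fst x * csqrt (snd x)) < 0) (nhds P)"
    by (rule order_tendstoD)
  from eventually_conj[OF ev1 eventually_conj[OF ev2 ev3]]
  obtain e where e: "e > 0" and E: "\<And>x. dist x P < e \<Longrightarrow> 2 * Re (snd x) - sig + e3 / (norm (snd x))\<^sup>2 > 0 \<and>
      3 * (Re (csqrt (snd x)))\<^sup>2 - (Im (csqrt (snd x)))\<^sup>2 - sig > 0 \<and> Im (fst x * csqrt (snd x)) < 0"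
    unfolding eventually_nhds_metric by blast
  show ?thesis
  proof (rule that[of "e / 2"])
    show "e / 2 > 0" using e by simp
    fix w U1 U2 U3
    assume U: "roots3 w U1 U2 U3" and w: "Im w > 0" and 3: "norm (U3 - of_real (u_of \<theta>)) < e / 2"
    show "\<not> norm (U1 - cnj (zeta \<theta>)) < e / 2"
    proof
      assume 1: "norm (U1 - cnj (zeta \<theta>)) < e / 2"
      have "dist (U1, U3) P \<le> dist U1 (cnj \<zeta>) + dist U3 (of_real u)"
        unfolding P_def dist_Pair_Pair by (rule sqrt_sum_squares_le_sum) auto
      also have "\<dots> < e" using 1 3 by (simp add: dist_norm u_def \<zeta>_def)
      finally have "dist (U1, U3) P < e" .
      from E[OF this] have
        A: "2 * Re U3 - sig + e3 / (norm U3)\<^sup>2 > 0"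
        and B: "3 * (Re (csqrt U3))\<^sup>2 - (Im (csqrt U3))\<^sup>2 - sig > 0"
        and C: "Im (U1 * csqrt U3) < 0" by auto
      note D = roots3D[OF U]
      have nz: "U1 \<noteq> 0" "U2 \<noteq> 0" "U3 \<noteq> 0" using D(3) e3_pos by auto
      have "w = of_real e2 - (U1 + U2) * U3 - U1 * U2" using D(2) by (simp add: algebra_simps)
      also have "U1 + U2 = of_real sig - U3" using D(1) by (simp add: algebra_simps)
      also have "U1 * U2 = of_real e3 / U3" using D(3) nz by (simp add: field_simps)
      finally have "w = of_real e2 - (of_real sig - U3) * U3 - of_real e3 / U3" .
      moreover have "of_real e3 / U3 = of_real (e3 / (norm U3)\<^sup>2) * cnj U3"
        using complex_div_cnj[of "of_real e3" U3] by simp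
      ultimately have "w = of_real e2 - (of_real sig - U3) * U3 - of_real (e3 / (norm U3)\<^sup>2) * cnj U3" by simp
      then have "Im w = - Im ((of_real sig - U3) * U3) + e3 / (norm U3)\<^sup>2 * Im U3" by simp
      then have "Im w = Im U3 * (2 * Re U3 - sig + e3 / (norm U3)\<^sup>2)"
        by (simp add: algebra_simps)
      then have Im3: "Im U3 > 0" using w A by (simp add: zero_less_mult_iff)
      \<comment> \<open>Multiplying by a square root of U3 makes the product of the two small zeros
        real, so their imaginary parts have opposite signs and can be compared by modulus.\<close>
      define v where "v = csqrt U3"
      have vv: "v * v = U3" unfolding v_def by (metis power2_csqrt power2_eq_square)
      have "Im U3 = 2 * Re v * Im v" unfolding vv[symmetric] by simp
      moreover have "Re v \<ge> 0" using csqrt_principal[of U3] unfolding v_def by linarith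
      ultimately have Imv: "Im v > 0" using Im3 by (auto simp: zero_less_mult_iff)
      define y1 where "y1 = - U1 * v"
      define y2 where "y2 = - U2 * v"
      have "y1 * y2 = U1 * U2 * (v * v)" by (simp add: y1_def y2_def)
      then have y12: "y1 * y2 = of_real e3" using D(3) by (simp add: vv)
      have "y1 + y2 = - (U1 + U2) * v" by (simp add: y1_def y2_def algebra_simps)
      also have "U1 + U2 = of_real sig - U3" using D(1) by (simp add: algebra_simps)
      also have "- (of_real sig - U3) * v = (v * v - of_real sig) * v" by (simp add: vv)
      finally have "Im (y1 + y2) = Im ((v * v - of_real sig) * v)" by simp
      also have "\<dots> = Im v * (3 * (Re v)\<^sup>2 - (Im v)\<^sup>2 - sig)" by (simp add: algebra_simps power2_eq_square)
      also have "\<dots> > 0" using B Imv by (simp add: v_def)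
      finally have pos: "Im y1 + Im y2 > 0" by simp
      have le: "norm y1 \<le> norm y2" unfolding y1_def y2_def using D(4) by (simp add: norm_mult mult_right_mono)
      have y1: "norm y1 > 0" using y12 e3_pos by auto
      have "norm y1 * norm y2 = e3" using y12 e3_pos by (metis norm_mult norm_of_real abs_of_pos)
      then have e3y: "(norm y1)\<^sup>2 \<le> e3" using le y1 by (metis mult_left_mono norm_ge_zero power2_eq_square)
      have "y2 * (norm y1)\<^sup>2 = y2 * (y1 * cnj y1)" by (simp only: complex_norm_square)
      also have "\<dots> = (y1 * y2) * cnj y1" by (simp only: mult_ac)
      also have "\<dots> = of_real e3 * cnj y1" unfolding y12 ..
      finally have "Im (y2 * (norm y1)\<^sup>2) = Im (of_real e3 * cnj y1)" by simp
      then have "Im y2 * (norm y1)\<^sup>2 = - e3 * Im y1" by (simp flip: of_real_power)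
      then have "(Im y1 + Im y2) * (norm y1)\<^sup>2 = Im y1 * ((norm y1)\<^sup>2 - e3)" by (simp add: algebra_simps)
      moreover have "(Im y1 + Im y2) * (norm y1)\<^sup>2 > 0" using pos y1 by simp
      ultimately have "Im y1 * ((norm y1)\<^sup>2 - e3) > 0" by simp
      then have "Im y1 < 0" using e3y by (auto simp: zero_less_mult_iff)
      then show False using C by (simp add: y1_def v_def)
    qed
  qed
qed

text \<open>\<open>f\<close> is any selection of a zero of least modulus. From above,
  \<open>roots3_sign\<close> removes one of the two orders allowed by \<open>roots3_perturb\<close>;
  the limit from below follows by conjugation.\<close>

lemma roots3_limit:
  assumes \<theta>: "0 < \<theta>" "\<theta> < pi"
    and U: "\<And>w. \<exists>U2 U3. roots3 w (f w) U2 U3"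
  shows "(f \<longlongrightarrow> zeta \<theta>) (at (of_real (X (u_of \<theta>))) within {w. Im w > 0})"
    "(f \<longlongrightarrow> cnj (zeta \<theta>)) (at (of_real (X (u_of \<theta>))) within {w. Im w < 0})"
proof -
  define x where "x = complex_of_real (X (u_of \<theta>))"
  have main: "\<exists>\<delta>>0. \<forall>w U1 U2 U3. norm (w - x) < \<delta> \<longrightarrow> Im w > 0 \<longrightarrow> roots3 w U1 U2 U3 \<longrightarrow> norm (U1 - zeta \<theta>) < e"
    if "e > 0" for e
  proof -
    obtain \<eta> where \<eta>: "\<eta> > 0"
      "\<And>w U1 U2 U3. roots3 w U1 U2 U3 \<Longrightarrow> Im w > 0 \<Longrightarrow> norm (U3 - of_real (u_of \<theta>)) < \<eta> \<Longrightarrow> \<not> norm (U1 - cnj (zeta \<theta>)) < \<eta>"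
      using roots3_sign[OF \<theta>] by blast
    have "min e \<eta> > 0" using that \<eta> by simp
    from roots3_perturb[OF \<theta> this] obtain \<delta> where \<delta>: "\<delta> > 0" "\<And>w U1 U2 U3. norm (w - x) < \<delta> \<Longrightarrow> roots3 w U1 U2 U3 \<Longrightarrow>
       norm (U3 - of_real (u_of \<theta>)) < min e \<eta> \<and> (norm (U1 - zeta \<theta>) < min e \<eta> \<and> norm (U2 - cnj (zeta \<theta>)) < min e \<eta> \<or> norm (U1 - cnj (zeta \<theta>)) < min e \<eta> \<and> norm (U2 - zeta \<theta>) < min e \<eta>)"
      unfolding x_def by blast
    have "norm (U1 - zeta \<theta>) < e" if "norm (w - x) < \<delta>" "Im w > 0" "roots3 w U1 U2 U3" for w U1 U2 U3
      using \<delta>(2)[OF that(1,3)] \<eta>(2)[OF that(3,2)] by auto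
    then show ?thesis using \<delta>(1) by blast
  qed
  show "(f \<longlongrightarrow> zeta \<theta>) (at (of_real (X (u_of \<theta>))) within {w. Im w > 0})"
    unfolding x_def[symmetric] Lim_within dist_norm
  proof (intro allI impI)
    fix e :: real assume "e > 0"
    from main[OF this] obtain \<delta> where \<delta>: "\<delta> > 0" "\<And>w U1 U2 U3. norm (w - x) < \<delta> \<Longrightarrow> Im w > 0 \<Longrightarrow> roots3 w U1 U2 U3 \<Longrightarrow> norm (U1 - zeta \<theta>) < e"
      by blast
    have "norm (f w - zeta \<theta>) < e" if w: "Im w > 0" "norm (w - x) < \<delta>" for w
    proof -
      obtain U2 U3 where "roots3 w (f w) U2 U3" using U by blast
      from \<delta>(2)[OF w(2,1) this] show ?thesis .
    qed
    then show "\<exists>d>0. \<forall>w\<in>{w. Im w > 0}. 0 < norm (w - x) \<and> norm (w - x) < d \<longrightarrow> norm (f w - zeta \<theta>) < e"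
      using \<delta>(1) by auto
  qed
  show "(f \<longlongrightarrow> cnj (zeta \<theta>)) (at (of_real (X (u_of \<theta>))) within {w. Im w < 0})"
    unfolding x_def[symmetric] Lim_within dist_norm
  proof (intro allI impI)
    fix e :: real assume "e > 0"
    from main[OF this] obtain \<delta> where \<delta>: "\<delta> > 0" "\<And>w U1 U2 U3. norm (w - x) < \<delta> \<Longrightarrow> Im w > 0 \<Longrightarrow> roots3 w U1 U2 U3 \<Longrightarrow> norm (U1 - zeta \<theta>) < e"
      by blast
    have "norm (f w - cnj (zeta \<theta>)) < e" if w: "Im w < 0" "norm (w - x) < \<delta>" for w
    proof -
      obtain U2 U3 where "roots3 w (f w) U2 U3" using U by blast
      from roots3_cnj[OF this] have r: "roots3 (cnj w) (cnj (f w)) (cnj U2) (cnj U3)" .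
      have "cnj w - x = cnj (w - x)" by (simp add: x_def)
      then have "norm (cnj w - x) = norm (w - x)" by (simp only: complex_mod_cnj)
      then have "norm (cnj (f w) - zeta \<theta>) < e" using \<delta>(2)[OF _ _ r] w by simp
      moreover have "norm (cnj (f w) - zeta \<theta>) = norm (cnj (f w - cnj (zeta \<theta>)))" by simp
      ultimately show ?thesis by (metis complex_mod_cnj)
    qed
    then show "\<exists>d>0. \<forall>w\<in>{w. Im w < 0}. 0 < norm (w - x) \<and> norm (w - x) < d \<longrightarrow> norm (f w - cnj (zeta \<theta>)) < e"
      using \<delta>(1) by auto
  qed
qed

text \<open>Since ab, ac, bc are e3 / c, e3 / b, e3 / a, the substitution z = -e3 / w carries one
  cubic into the other; this is verified on the elementary symmetric functions.\<close>

lemma roots3_of_factorization: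
  assumes z: "\<And>w. w \<noteq> 0 \<Longrightarrow> (w + of_real (a * b)) * (w + of_real (a * c)) * (w + of_real (b * c)) / w ^ 2 - x
        = (w - z1) * (w - z2) * (w - z3) / w ^ 2"
    and n: "norm z1 \<ge> norm z2" "norm z2 \<ge> norm z3" "norm z3 > 0"
  shows "roots3 x (- of_real e3 / z1) (- of_real e3 / z2) (- of_real e3 / z3)"
proof -
  have nz: "z1 \<noteq> 0" "z2 \<noteq> 0" "z3 \<noteq> 0" using n by auto
  have eq: "(w + of_real (a * b)) * (w + of_real (a * c)) * (w + of_real (b * c)) - x * w^2
        = (w - z1) * (w - z2) * (w - z3)" if "w \<noteq> 0" for w
    using z[OF that] that by (simp add: field_simps)
  define A where "A = of_real e2 - x + z1 + z2 + z3"
  define B where "B = of_real (e3 * sig) - (z1 * z2 + z1 * z3 + z2 * z3)"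
  define C where "C = of_real (e3^2) + z1 * z2 * z3"
  have "A * w^2 + B * w + C = 0" if "w \<noteq> 0" for w
    using eq[OF that] unfolding A_def B_def C_def e2_def e3_def sig_def
    by (simp add: algebra_simps power2_eq_square)
  \<comment> \<open>The identity is known only off the pole at 0, so the coefficients of the
    quadratic are eliminated by three nonzero points.\<close>
  from this[of 1] this[of "-1"] this[of 2] have "A + B + C = 0" "A - B + C = 0" "A * 4 + B * 2 + C = 0" by simp_all
  note ABC = this
  have "2 * B = (A + B + C) - (A - B + C)" by simp
  then have B0: "B = 0" unfolding ABC by simp
  have "3 * A = (A * 4 + B * 2 + C) - (A + B + C) - B" by simp
  then have A0: "A = 0" unfolding ABC using B0 by simp
  have "C = 0" using ABC(1) unfolding A0 B0 by simp
  note A0 B0 this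
  then have 1: "z1 + z2 + z3 = x - of_real e2" and 2: "z1 * z2 + z1 * z3 + z2 * z3 = of_real (e3 * sig)"
    and 3: "z1 * z2 * z3 = - of_real (e3^2)"
    by (simp_all add: A_def B_def C_def algebra_simps add_eq_0_iff2)
  define E where "E = complex_of_real e3"
  have E: "E \<noteq> 0" using e3_pos by (simp add: E_def)
  have S3: "z1 * z2 * z3 = - E * E" using 3 by (simp add: E_def power2_eq_square)
  have S2: "z1 * z2 + z1 * z3 + z2 * z3 = E * of_real sig" using 2 by (simp add: E_def)
  have P1: "(- E / z1) + (- E / z2) + (- E / z3) = of_real sig"
  proof -
    have "(- E / z1) + (- E / z2) + (- E / z3) = - E * (z1 * z2 + z1 * z3 + z2 * z3) / (z1 * z2 * z3)"
      using nz by (simp add: field_simps)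
    then show ?thesis unfolding S2 S3 using E by simp
  qed
  have P2: "(- E / z1) * (- E / z2) + (- E / z1) * (- E / z3) + (- E / z2) * (- E / z3) = of_real e2 - x"
  proof -
    have "(- E / z1) * (- E / z2) + (- E / z1) * (- E / z3) + (- E / z2) * (- E / z3) = E * E * (z1 + z2 + z3) / (z1 * z2 * z3)"
      using nz by (simp add: field_simps)
    then show ?thesis unfolding 1 S3 using E by simp
  qed
  have P3: "(- E / z1) * (- E / z2) * (- E / z3) = E"
  proof -
    have "(- E / z1) * (- E / z2) * (- E / z3) = - E * E * E / (z1 * z2 * z3)" using nz by (simp add: field_simps)
    then show ?thesis unfolding S3 using E by simp
  qed
  have cub: "(v - U1) * (v - U2) * (v - U3) = v^3 - (U1 + U2 + U3) * v^2 + (U1 * U2 + U1 * U3 + U2 * U3) * v - U1 * U2 * U3"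
    for v U1 U2 U3 :: complex by (simp add: algebra_simps power2_eq_square power3_eq_cube)
  have "(v - (- E / z1)) * (v - (- E / z2)) * (v - (- E / z3)) = (v - of_real a) * (v - of_real b) * (v - of_real c) - x * v" for v
    unfolding cub P1 P2 P3 unfolding E_def e3_def e2_def sig_def by (simp add: algebra_simps)
  moreover have "norm (- E / z1) \<le> norm (- E / z2)" "norm (- E / z2) \<le> norm (- E / z3)"
    unfolding norm_divide using n nz by (intro divide_left_mono; simp)+
  ultimately show ?thesis unfolding roots3_def E_def by blast
qed

text \<open>Supplies the witness that makes the choice in \<open>zsol\<close> meaningful. No
  solution is 0, because the numerator of the symbol at 0 is (a b c)^2.\<close>

lemma factorization_exists:
  fixes x :: complex
  obtains z1 z2 z3 where "\<And>w. w \<noteq> 0 \<Longrightarrow> (w + of_real (a * b)) * (w + of_real (a * c)) * (w + of_real (b * c)) / w ^ 2 - x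
        = (w - z1) * (w - z2) * (w - z3) / w ^ 2"
    "norm z1 \<ge> norm z2" "norm z2 \<ge> norm z3" "norm z3 > (0::real)"
proof -
  define f :: "complex poly" where "f = [:of_real (e3^2), of_real (e3 * sig), of_real e2 - x, 1:]"
  obtain r where r: "smult (lead_coeff f) (\<Prod>i<degree f. [:-r i, 1:]) = f" using complex_poly_decompose' by blast
  have "degree f = 3" "lead_coeff f = 1" by (simp_all add: f_def)
  then have "f = (\<Prod>i<3. [:-r i, 1:])" using r by simp
  then have "poly f w = (w - r 0) * (w - r 1) * (w - r 2)" for w by (simp add: poly_prod eval_nat_numeral) (simp add: algebra_simps)
  moreover have "poly f w = (w + of_real (a * b)) * (w + of_real (a * c)) * (w + of_real (b * c)) - x * w^2" for w
    unfolding f_def e2_def e3_def sig_def by (simp add: algebra_simps power2_eq_square)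
  ultimately have eq: "(w + of_real (a * b)) * (w + of_real (a * c)) * (w + of_real (b * c)) - x * w^2 = (w - r 0) * (w - r 1) * (w - r 2)" for w
    by simp
  have "\<exists>z1 z2 z3. (\<forall>w. (w - r 0) * (w - r 1) * (w - r 2) = (w - z1) * (w - z2) * (w - z3)) \<and> norm z1 \<ge> norm z2 \<and> norm z2 \<ge> norm z3"
  proof -
    consider "norm (r 0) \<ge> norm (r 1) \<and> norm (r 1) \<ge> norm (r 2)"
      | "norm (r 0) \<ge> norm (r 2) \<and> norm (r 2) \<ge> norm (r 1)"
      | "norm (r 1) \<ge> norm (r 0) \<and> norm (r 0) \<ge> norm (r 2)"
      | "norm (r 1) \<ge> norm (r 2) \<and> norm (r 2) \<ge> norm (r 0)"
      | "norm (r 2) \<ge> norm (r 0) \<and> norm (r 0) \<ge> norm (r 1)"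
      | "norm (r 2) \<ge> norm (r 1) \<and> norm (r 1) \<ge> norm (r 0)"
      by linarith
    then show ?thesis
    proof cases
      case 1
      then show ?thesis by (intro exI[of _ "r 0"] exI[of _ "r 1"] exI[of _ "r 2"]) (simp add: mult_ac)
    next
      case 2
      then show ?thesis by (intro exI[of _ "r 0"] exI[of _ "r 2"] exI[of _ "r 1"]) (simp add: mult_ac)
    next
      case 3
      then show ?thesis by (intro exI[of _ "r 1"] exI[of _ "r 0"] exI[of _ "r 2"]) (simp add: mult_ac)
    next
      case 4
      then show ?thesis by (intro exI[of _ "r 1"] exI[of _ "r 2"] exI[of _ "r 0"]) (simp add: mult_ac)
    next
      case 5
      then show ?thesis by (intro exI[of _ "r 2"] exI[of _ "r 0"] exI[of _ "r 1"]) (simp add: mult_ac)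
    next
      case 6
      then show ?thesis by (intro exI[of _ "r 2"] exI[of _ "r 1"] exI[of _ "r 0"]) (simp add: mult_ac)
    qed
  qed
  then obtain z1 z2 z3 where z: "\<And>w. (w - r 0) * (w - r 1) * (w - r 2) = (w - z1) * (w - z2) * (w - z3)" "norm z1 \<ge> norm z2" "norm z2 \<ge> norm z3"
    by blast
  have nz: "z3 \<noteq> 0"
  proof
    assume "z3 = 0"
    then have "of_real (a * b) * of_real (a * c) * of_real (b * c) = (0::complex)" using eq[of 0] z(1)[of 0] by simp
    then show False using a_pos b_pos c_pos by simp
  qed
  show ?thesis
  proof (rule that[of z1 z2 z3])
    fix w :: complex assume "w \<noteq> 0"
    then show "(w + of_real (a * b)) * (w + of_real (a * c)) * (w + of_real (b * c)) / w ^ 2 - x = (w - z1) * (w - z2) * (w - z3) / w ^ 2"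
      unfolding z(1)[symmetric] eq[symmetric] by (simp add: field_simps)
  qed (use z nz in auto)
qed

end

section \<open>The measure for a single parameter\<close>

context triple
begin

definition "Y \<theta> = X (u_of \<theta>)"
definition "Yd \<theta> = Xd (u_of \<theta>) * sin \<theta> / kapd (u_of \<theta>)"
definition "Theta x = (THE \<theta>. 0 < \<theta> \<and> \<theta> < pi \<and> Y \<theta> = x)"

lemma Y_deriv: "(Y has_real_derivative Yd \<theta>) (at \<theta>)"
proof -
  have "u_of \<theta> \<noteq> 0" using u_of(3)[of \<theta>] by simp
  from DERIV_chain2[OF X_deriv[OF this] u_of_deriv] show ?thesis
    unfolding Y_def[abs_def] Yd_def by simp
qed

lemma Yd_nonneg: "0 \<le> \<theta> \<Longrightarrow> \<theta> \<le> pi \<Longrightarrow> Yd \<theta> \<ge> 0"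
  unfolding Yd_def using Xd_pos[of "u_of \<theta>"] kapd_pos[of "u_of \<theta>"] u_of(1)[of \<theta>]
  by (intro divide_nonneg_pos mult_nonneg_nonneg sin_ge_zero) auto

lemma Yd_pos: "0 < \<theta> \<Longrightarrow> \<theta> < pi \<Longrightarrow> Yd \<theta> > 0"
  unfolding Yd_def using Xd_pos[of "u_of \<theta>"] kapd_pos[of "u_of \<theta>"] u_of(1)[of \<theta>]
  by (intro divide_pos_pos mult_pos_pos sin_gt_zero) auto

lemma Yd_cont: "continuous_on S Yd"
  unfolding Yd_def[abs_def] using kapd_pos u_of(1)
  by (intro continuous_intros kapd_u_of_cont Xd_u_of_cont) (metis less_imp_le less_irrefl)

lemma Y_cont: "continuous_on S Y"
  by (rule DERIV_continuous_on) (auto intro: has_field_derivative_at_within Y_deriv)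

lemma Y_pos: "Y \<theta> > 0"
  unfolding Y_def by (rule X_pos[OF u_of(1)])

lemma Y_mono:
  assumes "0 \<le> s" "s < t" "t \<le> pi" shows "Y s < Y t"
proof -
  have "- cos s < - cos t" using cos_monotone_0_pi[of s t] assms by simp
  then have "kap (u_of s) < kap (u_of t)" by (simp add: u_of)
  then have "u_of s < u_of t" using kap_less_iff u_of(1)[of s] u_of(1)[of t] by simp
  then show ?thesis unfolding Y_def using X_mono u_of(1)[of s] by simp
qed

lemma Y_image: "Y ` {0<..<pi} = {Y 0<..<Y pi}"
proof
  show "Y ` {0<..<pi} \<subseteq> {Y 0<..<Y pi}" using Y_mono by auto
  show "{Y 0<..<Y pi} \<subseteq> Y ` {0<..<pi}"
  proof
    fix x assume x: "x \<in> {Y 0<..<Y pi}"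
    then obtain \<theta> where \<theta>: "0 \<le> \<theta>" "\<theta> \<le> pi" "Y \<theta> = x"
      using IVT'[of Y 0 x pi] Y_cont by auto
    then have "\<theta> \<noteq> 0" "\<theta> \<noteq> pi" using x by auto
    then show "x \<in> Y ` {0<..<pi}" using \<theta> by auto
  qed
qed

lemma Theta_Y: "0 < \<theta> \<Longrightarrow> \<theta> < pi \<Longrightarrow> Theta (Y \<theta>) = \<theta>"
  unfolding Theta_def using Y_mono
  by (intro the_equality) (auto, metis less_imp_le less_irrefl linorder_neqE)

lemma Theta_deriv:
  assumes "0 < \<theta>" "\<theta> < pi" shows "(Theta has_real_derivative inverse (Yd \<theta>)) (at (Y \<theta>))"
  by (rule has_real_derivative_inverse_strong[where S = "{0<..<pi}" and f = Y and x = \<theta>])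
    (use assms Y_deriv Yd_pos[OF assms] Y_cont Theta_Y in auto)

text \<open>The density of the image of the uniform distribution on (0, pi) under \<open>Y\<close>,
  by the change of variables formula.\<close>

definition "dens x = (if x \<in> {Y 0<..<Y pi} then inverse (Yd (Theta x)) / pi else 0)"

lemma dens_Y: "0 < \<theta> \<Longrightarrow> \<theta> < pi \<Longrightarrow> dens (Y \<theta>) = inverse (Yd \<theta>) / pi"
  unfolding dens_def using Y_mono Theta_Y by auto

lemma dens_measurable: "dens \<in> borel_measurable borel"
proof -
  have "continuous_on {Y 0<..<Y pi} Theta"
  proof (rule DERIV_continuous_on[where D = "\<lambda>x. inverse (Yd (Theta x))"])
    fix x assume "x \<in> {Y 0<..<Y pi}"
    then obtain \<theta> where "0 < \<theta>" "\<theta> < pi" "x = Y \<theta>" unfolding Y_image[symmetric] by auto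
    then show "(Theta has_real_derivative inverse (Yd (Theta x))) (at x within {Y 0<..<Y pi})"
      using has_field_derivative_at_within[OF Theta_deriv] Theta_Y by simp
  qed
  then have "continuous_on {Y 0<..<Y pi} (\<lambda>x. Yd (Theta x))"
    using continuous_on_compose2[OF Yd_cont[of UNIV]] by simp
  moreover have "Yd (Theta x) \<noteq> 0" if x: "x \<in> {Y 0<..<Y pi}" for x
  proof -
    obtain \<theta> where "0 < \<theta>" "\<theta> < pi" "x = Y \<theta>" using x unfolding Y_image[symmetric] by auto
    then show ?thesis using Theta_Y Yd_pos[of \<theta>] by simp
  qed
  ultimately have "continuous_on {Y 0<..<Y pi} (\<lambda>x. inverse (Yd (Theta x)) / pi)"
    by (intro continuous_intros) auto
  then show ?thesis unfolding dens_def[abs_def]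
    by (intro borel_measurable_if_I borel_measurable_continuous_on_if continuous_on_const) auto
qed

section \<open>Boundary values of the dominant solution and the law of the angle\<close>

lemma at_upper_nontrivial: "at (complex_of_real x) within {w. Im w > 0} \<noteq> bot"
  and at_lower_nontrivial: "at (complex_of_real x) within {w. Im w < 0} \<noteq> bot"
proof -
  have "\<exists>w\<in>{w. Im w > 0}. w \<noteq> complex_of_real x \<and> dist w (of_real x) < e"
    "\<exists>w\<in>{w. Im w < 0}. w \<noteq> complex_of_real x \<and> dist w (of_real x) < e" if "e > 0" for e
  proof -
    show "\<exists>w\<in>{w. Im w > 0}. w \<noteq> complex_of_real x \<and> dist w (of_real x) < e"
      using that by (intro bexI[of _ "of_real x + \<i> * of_real (e / 2)"]) (auto simp: dist_norm norm_mult complex_eq_iff)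
    show "\<exists>w\<in>{w. Im w < 0}. w \<noteq> complex_of_real x \<and> dist w (of_real x) < e"
      using that by (intro bexI[of _ "of_real x - \<i> * of_real (e / 2)"]) (auto simp: dist_norm norm_mult complex_eq_iff)
  qed
  then show "at (complex_of_real x) within {w. Im w > 0} \<noteq> bot" "at (complex_of_real x) within {w. Im w < 0} \<noteq> bot"
    unfolding trivial_limit_within islimpt_approachable by blast+
qed

text \<open>Treats both sides at once: with \<open>C = -e3\<close>, the boundary value from above is
  C / \<zeta>, given by e = \<open>\<i>\<close>, and the one from below has e =
  \<open>-\<i>\<close>.\<close>

lemma boundary_vector_derivative:
  fixes C e :: complex
  assumes \<theta>: "0 < \<theta>" "\<theta> < pi"
  shows "((\<lambda>x. C * exp (- (of_real (lr (Theta x)) + e * of_real (Theta x)))) has_vector_derivative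
     - (of_real (lrd \<theta>) + e) * of_real (inverse (Yd \<theta>)) * (C * exp (- (of_real (lr \<theta>) + e * of_real \<theta>)))) (at (Y \<theta>))"
proof -
  note T = Theta_deriv[OF \<theta>]
  have "((\<lambda>x. lr (Theta x)) has_real_derivative lrd \<theta> * inverse (Yd \<theta>)) (at (Y \<theta>))"
    by (rule DERIV_chain2[OF _ T]) (simp add: Theta_Y \<theta> lr_deriv)
  then have "((\<lambda>x. of_real (lr (Theta x)) + e * of_real (Theta x)) has_vector_derivative
     of_real (lrd \<theta> * inverse (Yd \<theta>)) + e * of_real (inverse (Yd \<theta>))) (at (Y \<theta>))"
    by (intro has_vector_derivative_add has_vector_derivative_of_real has_vector_derivative_mult_right T)
  from has_vector_derivative_minus[OF this]
  have 1: "((\<lambda>x. - (of_real (lr (Theta x)) + e * of_real (Theta x))) has_vector_derivative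
     - (of_real (lrd \<theta> * inverse (Yd \<theta>)) + e * of_real (inverse (Yd \<theta>)))) (at (Y \<theta>))" .
  from has_vector_derivative_mult_right[OF field_vector_diff_chain_at[OF 1 DERIV_exp], of C]
  show ?thesis unfolding comp_def Theta_Y[OF \<theta>] by (simp add: algebra_simps)
qed

text \<open>\<open>Z\<close> stands for the solution of largest modulus.\<close>

lemma boundary_density:
  assumes Z: "\<And>w. \<exists>U1 U2 U3. roots3 w U1 U2 U3 \<and> Z w = - of_real e3 / U1"
  defines "zp \<equiv> \<lambda>x::real. Lim (at (of_real x) within {w. Im w > 0}) Z"
    and "zm \<equiv> \<lambda>x::real. Lim (at (of_real x) within {w. Im w < 0}) Z"
  assumes \<theta>: "0 < \<theta>" "\<theta> < pi"
  shows "1 / (2 * of_real pi * \<i>) * (vector_derivative zm (at (Y \<theta>)) / zm (Y \<theta>) - vector_derivative zp (at (Y \<theta>)) / zp (Y \<theta>))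
    = of_real (inverse (Yd \<theta>) / pi)"
proof -
  define f where "f w = - of_real e3 / Z w" for w
  have f: "\<exists>U2 U3. roots3 w (f w) U2 U3" and Zf: "Z w = - of_real e3 / f w" for w
  proof -
    obtain U1 U2 U3 where U: "roots3 w U1 U2 U3" "Z w = - of_real e3 / U1" using Z by blast
    have "U1 \<noteq> 0" using roots3D(3)[OF U(1)] e3_pos by auto
    then have "f w = U1" using e3_pos by (simp add: f_def U(2))
    then show "\<exists>U2 U3. roots3 w (f w) U2 U3" "Z w = - of_real e3 / f w" using U by auto
  qed
  have zeta: "zeta t = exp (of_real (lr t) + \<i> * of_real t)" "cnj (zeta t) = exp (of_real (lr t) + (- \<i>) * of_real t)" for t
    by (simp_all add: zeta_def Complex_eq exp_cnj)
  have zp: "zp (Y t) = (- of_real e3) * exp (- (of_real (lr t) + \<i> * of_real t))"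
    and zm: "zm (Y t) = (- of_real e3) * exp (- (of_real (lr t) + (- \<i>) * of_real t))" if t: "0 < t" "t < pi" for t
  proof -
    have "((\<lambda>w. - of_real e3 / f w) \<longlongrightarrow> - of_real e3 / zeta t) (at (of_real (Y t)) within {w. Im w > 0})"
      unfolding Y_def by (intro tendsto_divide tendsto_const roots3_limit(1)[OF t f]) (simp add: zeta_nonzero)
    then have "zp (Y t) = - of_real e3 / zeta t"
      unfolding zp_def Zf[symmetric] by (intro tendsto_Lim at_upper_nontrivial)
    then show "zp (Y t) = (- of_real e3) * exp (- (of_real (lr t) + \<i> * of_real t))"
      unfolding zeta(1) exp_minus divide_inverse .
    have "((\<lambda>w. - of_real e3 / f w) \<longlongrightarrow> - of_real e3 / cnj (zeta t)) (at (of_real (Y t)) within {w. Im w < 0})"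
      unfolding Y_def by (intro tendsto_divide tendsto_const roots3_limit(2)[OF t f]) (simp add: zeta_nonzero)
    then have "zm (Y t) = - of_real e3 / cnj (zeta t)"
      unfolding zm_def Zf[symmetric] by (intro tendsto_Lim at_lower_nontrivial)
    then show "zm (Y t) = (- of_real e3) * exp (- (of_real (lr t) + (- \<i>) * of_real t))"
      unfolding zeta(2) exp_minus divide_inverse .
  qed
  have mem: "Y \<theta> \<in> {Y 0<..<Y pi}" using \<theta> Y_mono by auto
  have loc: "\<exists>t. 0 < t \<and> t < pi \<and> x = Y t \<and> Theta x = t" if "x \<in> {Y 0<..<Y pi}" for x
    using that Theta_Y unfolding Y_image[symmetric] by auto
  define R where "R = complex_of_real (inverse (Yd \<theta>))"
  have "(zp has_vector_derivative - (of_real (lrd \<theta>) + \<i>) * R * zp (Y \<theta>)) (at (Y \<theta>))"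
    unfolding zp[OF \<theta>] R_def
    by (rule has_vector_derivative_transform_within_open[OF boundary_vector_derivative[OF \<theta>, of "- of_real e3" "\<i>"] open_greaterThanLessThan mem])
      (use loc zp in fastforce)
  then have vp: "vector_derivative zp (at (Y \<theta>)) = - (of_real (lrd \<theta>) + \<i>) * R * zp (Y \<theta>)"
    by (rule vector_derivative_at)
  have "(zm has_vector_derivative - (of_real (lrd \<theta>) + (- \<i>)) * R * zm (Y \<theta>)) (at (Y \<theta>))"
    unfolding zm[OF \<theta>] R_def
    by (rule has_vector_derivative_transform_within_open[OF boundary_vector_derivative[OF \<theta>, of "- of_real e3" "- \<i>"] open_greaterThanLessThan mem])
      (use loc zm in fastforce)
  then have vm: "vector_derivative zm (at (Y \<theta>)) = - (of_real (lrd \<theta>) + (- \<i>)) * R * zm (Y \<theta>)"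
    by (rule vector_derivative_at)
  have nz: "zp (Y \<theta>) \<noteq> 0" "zm (Y \<theta>) \<noteq> 0" using zp[OF \<theta>] zm[OF \<theta>] e3_pos by auto
  \<comment> \<open>The modulus terms \<open>lrd\<close> are common to both sides and cancel; the
    angle terms have opposite signs and add up.\<close>
  have "vector_derivative zm (at (Y \<theta>)) / zm (Y \<theta>) - vector_derivative zp (at (Y \<theta>)) / zp (Y \<theta>) = 2 * \<i> * R"
    unfolding vp vm nonzero_mult_div_cancel_right[OF nz(1)] nonzero_mult_div_cancel_right[OF nz(2)]
    by (simp add: algebra_simps)
  then show ?thesis by (simp add: R_def)
qed

text \<open>Substituting x = Y \<theta> cancels the density against \<open>Yd\<close> and leaves the
  constant 1 / pi. The function \<open>f\<close> is prescribed only off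
  \<open>tie_exceptions\<close>, a Lebesgue null set.\<close>

lemma density_eq_distr:
  fixes f :: "real \<Rightarrow> ennreal"
  assumes f: "\<And>x. x \<notin> tie_exceptions \<Longrightarrow> f x = ennreal (dens x)"
  shows "density lborel f = distr (uniform_measure lborel {0..pi}) borel Y"
proof (rule measure_eqI)
  show "sets (density lborel f) = sets (distr (uniform_measure lborel {0..pi}) borel Y)" by simp
  fix B assume "B \<in> sets (density lborel f)"
  then have B: "B \<in> sets borel" by simp
  have cnt: "countable tie_exceptions" using finite_tie_exceptions by (rule countable_finite)
  have dm: "(\<lambda>x. ennreal (dens x)) \<in> borel_measurable lborel" using dens_measurable by simp
  have fm: "f \<in> borel_measurable lborel"
    by (rule measurable_discrete_difference[OF dm cnt]) (use f in auto)
  have Ym: "Y \<in> borel_measurable borel" by (rule borel_measurable_continuous_onI[OF Y_cont])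
  have ae: "AE x in lborel. x \<notin> tie_exceptions"
    using countable_imp_null_set_lborel[OF cnt] by (rule AE_not_in)
  have "emeasure (density lborel f) B = (\<integral>\<^sup>+x. f x * indicator B x \<partial>lborel)"
    using fm B by (intro emeasure_density) auto
  also have "\<dots> = (\<integral>\<^sup>+x. ennreal (dens x * indicator B x * indicator {Y 0..Y pi} x) \<partial>lborel)"
    by (rule nn_integral_cong_AE) (use ae in eventually_elim, auto simp: f dens_def split: split_indicator)
  also have "\<dots> = (\<integral>\<^sup>+\<theta>. ennreal (dens (Y \<theta>) * indicator B (Y \<theta>) * Yd \<theta> * indicator {0..pi} \<theta>) \<partial>lborel)"
  proof (rule nn_integral_substitution[where f = "\<lambda>x. dens x * indicator B x"])
    show "set_borel_measurable borel {Y 0..Y pi} (\<lambda>x. dens x * indicator B x)"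
      unfolding set_borel_measurable_def using dens_measurable B by measurable
  qed (use Y_deriv Yd_cont Yd_nonneg in auto)
  also have "\<dots> = (\<integral>\<^sup>+\<theta>. ennreal (1 / pi) * indicator ({0..pi} \<inter> Y -` B) \<theta> \<partial>lborel)"
  proof (rule nn_integral_cong_AE)
    have "AE \<theta> in lborel. \<theta> \<notin> {0, pi}"
      using countable_imp_null_set_lborel[of "{0, pi}"] by (intro AE_not_in) auto
    then show "AE \<theta> in lborel. ennreal (dens (Y \<theta>) * indicator B (Y \<theta>) * Yd \<theta> * indicator {0..pi} \<theta>) = ennreal (1 / pi) * indicator ({0..pi} \<inter> Y -` B) \<theta>"
    proof eventually_elim
      case (elim \<theta>)
      show ?case
      proof (cases "0 < \<theta> \<and> \<theta> < pi")
        case True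
        then have "dens (Y \<theta>) * Yd \<theta> = 1 / pi" using dens_Y[of \<theta>] Yd_pos[of \<theta>] by simp
        then show ?thesis using True by (auto split: split_indicator)
      next
        case False
        then have "\<theta> \<notin> {0..pi}" using elim by auto
        then show ?thesis by (auto simp: indicator_def)
      qed
    qed
  qed
  also have "\<dots> = ennreal (1 / pi) * emeasure lborel ({0..pi} \<inter> Y -` B)"
    using measurable_sets[OF Ym B] by (subst nn_integral_cmult_indicator) auto
  also have "\<dots> = emeasure lborel ({0..pi} \<inter> Y -` B) / emeasure lborel {0..pi}"
    by (simp add: divide_ennreal_def mult.commute inverse_ennreal inverse_eq_divide)
  also have "\<dots> = emeasure (uniform_measure lborel {0..pi}) (Y -` B)"
    using measurable_sets[OF Ym B] by (intro emeasure_uniform_measure[symmetric]) auto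
  also have "\<dots> = emeasure (distr (uniform_measure lborel {0..pi}) borel Y) B"
    using Ym B by (subst emeasure_distr) auto
  finally show "emeasure (density lborel f) B = emeasure (distr (uniform_measure lborel {0..pi}) borel Y) B" .
qed

end

lemma triple_shift: "p > 0 \<Longrightarrow> q > 0 \<Longrightarrow> s > 0 \<Longrightarrow> triple s (s + p) (s + p + q)"
  by unfold_locales auto

lemma mu1_eq_distr:
  assumes "p > 0" "q > 0" "s > 0"
  shows "mu1 p q s = distr (uniform_measure lborel {0..pi}) borel (triple.Y s (s + p) (s + p + q))"
proof -
  interpret triple s "s + p" "s + p + q" by (rule triple_shift[OF assms])
  have zsol: "roots3 x (- of_real e3 / zsol p q 1 x s) (- of_real e3 / zsol p q 2 x s) (- of_real e3 / zsol p q 3 x s)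
      \<and> zsol p q 1 x s \<noteq> 0 \<and> zsol p q 2 x s \<noteq> 0" for x
  proof -
    obtain z1 z2 z3 where z: "\<And>w. w \<noteq> 0 \<Longrightarrow> (w + of_real (s * (s + p))) * (w + of_real (s * (s + p + q))) * (w + of_real ((s + p) * (s + p + q))) / w ^ 2 - x
        = (w - z1) * (w - z2) * (w - z3) / w ^ 2"
      "norm z1 \<ge> norm z2" "norm z2 \<ge> norm z3" "norm z3 > (0::real)"
      using factorization_exists by blast
    have "ordered_solutions p q s x (\<lambda>i. if i = 1 then z1 else if i = 2 then z2 else z3)"
      unfolding ordered_solutions_def A_symb_def using z by simp
    then have "ordered_solutions p q s x (SOME z. ordered_solutions p q s x z)"
      by (rule someI[where P = "ordered_solutions p q s x"])
    then have o: "ordered_solutions p q s x (\<lambda>i. zsol p q i x s)" unfolding zsol_def .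
    then have n: "norm (zsol p q 1 x s) \<ge> norm (zsol p q 2 x s)" "norm (zsol p q 2 x s) \<ge> norm (zsol p q 3 x s)" "norm (zsol p q 3 x s) > 0"
      unfolding ordered_solutions_def by auto
    have "roots3 x (- of_real e3 / zsol p q 1 x s) (- of_real e3 / zsol p q 2 x s) (- of_real e3 / zsol p q 3 x s)"
      by (rule roots3_of_factorization[OF _ n]) (use o in \<open>simp add: ordered_solutions_def A_symb_def\<close>)
    then show ?thesis using n by auto
  qed
  have Gamma: "of_real x \<in> Gamma1 p q s \<longleftrightarrow> norm (- of_real e3 / zsol p q 1 (of_real x) s) = norm (- of_real e3 / zsol p q 2 (of_real x) s)" for x :: real
    unfolding Gamma1_def using zsol[of "of_real x"] e3_pos by (auto simp: norm_divide field_simps)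
  have Z: "\<exists>U1 U2 U3. roots3 w U1 U2 U3 \<and> zsol p q 1 w s = - of_real e3 / U1" for w
    using zsol[of w] e3_pos by (intro exI[of _ "- of_real e3 / zsol p q 1 w s"] exI[of _ "- of_real e3 / zsol p q 2 w s"] exI[of _ "- of_real e3 / zsol p q 3 w s"]) auto
  have dens: "mu1_density p q s (Y \<theta>) = of_real (dens (Y \<theta>))" if "0 < \<theta>" "\<theta> < pi" for \<theta>
    using boundary_density[of "\<lambda>w. zsol p q 1 w s", OF Z that]
    unfolding mu1_density_def z1_plus_def[abs_def] z1_minus_def[abs_def] dens_Y[OF that] .
  show ?thesis unfolding mu1_def
  proof (rule density_eq_distr)
    fix x assume x: "x \<notin> tie_exceptions"
    show "ennreal (Re (mu1_density p q s x)) * indicator {x. of_real x \<in> Gamma1 p q s} x = ennreal (dens x)"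
    proof (cases "x \<in> {Y 0<..<Y pi}")
      case True
      then obtain \<theta> where \<theta>: "0 < \<theta>" "\<theta> < pi" "x = Y \<theta>" unfolding Y_image[symmetric] by auto
      have "of_real x \<in> Gamma1 p q s" unfolding Gamma using zsol[of "of_real x"] roots3_tie[OF \<theta>(1,2)] \<theta>(3) unfolding Y_def by blast
      then show ?thesis using dens[OF \<theta>(1,2)] \<theta>(3) by simp
    next
      case False
      have "of_real x \<notin> Gamma1 p q s"
      proof
        assume "of_real x \<in> Gamma1 p q s"
        with roots3_tieD zsol[of "of_real x"] x have "\<exists>\<theta>. 0 < \<theta> \<and> \<theta> < pi \<and> x = X (u_of \<theta>)" unfolding Gamma by blast
        then have "x \<in> Y ` {0<..<pi}" unfolding Y_def by auto
        then show False using False unfolding Y_image by blast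
      qed
      then show ?thesis using False by (auto simp: dens_def)
    qed
  qed
qed

section \<open>The averaged measure\<close>

text \<open>Extended by \<open>0\<close> to nonpositive \<open>s\<close>, so that it is jointly measurable on the whole plane.\<close>

definition support_point :: "real \<Rightarrow> real \<Rightarrow> real \<Rightarrow> real \<Rightarrow> real" where
  "support_point p q s \<theta> = (if s > 0 then triple.Y s (s + p) (s + p + q) \<theta> else 0)"

text \<open>\<open>u_of\<close> is an inverse function, so measurability is read off its superlevel
  sets: by monotonicity of \<open>kap\<close>, t < u means t < c or kap t < -cos \<theta>, an
  explicit condition in both variables.\<close>

lemma support_point_measurable:
  assumes p: "p > 0" "q > 0"
  shows "(\<lambda>x. support_point p q (fst x) (snd x)) \<in> borel_measurable (borel \<Otimes>\<^sub>M borel)"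
proof -
  \<comment> \<open>The value 1 for s \<le> 0 is a mere extension, matched by the clause
    \<open>t < 1\<close> in \<open>P\<close>.\<close>
  define U where "U s \<theta> = (if s > 0 then triple.u_of s (s + p) (s + p + q) \<theta> else 1)" for s \<theta>
  have "(\<lambda>x. U (fst x) (snd x)) \<in> borel_measurable (borel \<Otimes>\<^sub>M borel)"
  proof (rule borel_measurable_iff_greater[THEN iffD2], rule allI)
    fix t
    define P where "P s \<theta> \<longleftrightarrow> (0 < s \<and> (t < s + p + q \<or> (s + p + q \<le> t \<and>
        (t - (s + (s + p) + (s + p + q))) * sqrt t / (2 * sqrt (s * (s + p) * (s + p + q))) < - cos \<theta>)))
        \<or> (s \<le> 0 \<and> t < 1)" for s \<theta>
    have "t < U s \<theta> \<longleftrightarrow> P s \<theta>" for s \<theta>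
    proof (cases "s > 0")
      case True
      interpret triple s "s + p" "s + p + q" by (rule triple_shift[OF p True])
      have kt: "(t - (s + (s + p) + (s + p + q))) * sqrt t / (2 * sqrt (s * (s + p) * (s + p + q))) = kap t"
        unfolding kap_def sig_def e3_def ..
      have "s + p + q \<le> t \<Longrightarrow> kap t < - cos \<theta> \<longleftrightarrow> t < u_of \<theta>"
        using kap_less_iff[of t "u_of \<theta>"] u_of(1,2)[of \<theta>] by simp
      moreover have "t < s + p + q \<Longrightarrow> t < u_of \<theta>" using u_of(1)[of \<theta>] by simp
      ultimately show ?thesis unfolding U_def P_def kt using True by auto
    qed (auto simp: U_def P_def)
    then have "{w \<in> space (borel \<Otimes>\<^sub>M borel). t < U (fst w) (snd w)} = {w \<in> space (borel \<Otimes>\<^sub>M borel). P (fst w) (snd w)}"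
      by simp
    also have "\<dots> \<in> sets (borel \<Otimes>\<^sub>M borel)" unfolding P_def by measurable
    finally show "{w \<in> space (borel \<Otimes>\<^sub>M borel). t < U (fst w) (snd w)} \<in> sets (borel \<Otimes>\<^sub>M borel)" .
  qed
  note [measurable] = this
  have "support_point p q s \<theta> = (if s > 0 then (U s \<theta> - s) * (U s \<theta> - (s + p)) * (U s \<theta> - (s + p + q)) / U s \<theta> else 0)" for s \<theta>
  proof (cases "s > 0")
    case True
    interpret triple s "s + p" "s + p + q" by (rule triple_shift[OF p True])
    show ?thesis using True by (simp add: support_point_def U_def Y_def X_def)
  qed (simp add: support_point_def)
  then show ?thesis by simp
qed

lemma support_point_nonneg: "p > 0 \<Longrightarrow> q > 0 \<Longrightarrow> support_point p q s \<theta> \<ge> 0"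
  using triple.Y_pos[OF triple_shift, of p q s \<theta>] by (auto simp: support_point_def)

section \<open>The averaged measure as the image of a product of uniform distributions\<close>

abbreviation angle_measure :: "real measure" where
  "angle_measure \<equiv> uniform_measure lborel {0..pi}"

lemma prob_space_angle: "prob_space angle_measure"
  by (rule prob_space_uniform_measure) auto

lemma prob_space_parameter: "\<xi> > 0 \<Longrightarrow> prob_space (uniform_measure lborel {0<..<\<xi>})" for \<xi> :: real
  by (rule prob_space_uniform_measure) auto

definition parameter_measure :: "real \<Rightarrow> (real \<times> real) measure" where
  "parameter_measure \<xi> = uniform_measure lborel {0<..<\<xi>} \<Otimes>\<^sub>M angle_measure"

lemma sets_parameter_measure: "sets (parameter_measure \<xi>) = sets (borel \<Otimes>\<^sub>M borel)"
  unfolding parameter_measure_def by (intro sets_pair_measure_cong) auto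

lemma nn_integral_parameter:
  assumes \<xi>: "\<xi> > 0" and f: "f \<in> borel_measurable (borel \<Otimes>\<^sub>M borel)"
  shows "(\<integral>\<^sup>+x. f x \<partial>parameter_measure \<xi>) = (\<integral>\<^sup>+s. (\<integral>\<^sup>+\<theta>. f (s, \<theta>) \<partial>angle_measure) * indicator {0<..<\<xi>} s \<partial>lborel) / ennreal \<xi>"
proof -
  interpret A: prob_space angle_measure by (rule prob_space_angle)
  have f': "f \<in> borel_measurable (uniform_measure lborel {0<..<\<xi>} \<Otimes>\<^sub>M angle_measure)"
    using f by (subst measurable_cong_sets[OF sets_parameter_measure[unfolded parameter_measure_def] refl])
  have f'': "f \<in> borel_measurable (lborel \<Otimes>\<^sub>M angle_measure)"
    using f by (subst measurable_cong_sets[of _ "borel \<Otimes>\<^sub>M borel"]) (auto intro!: sets_pair_measure_cong)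
  have "(\<integral>\<^sup>+x. f x \<partial>parameter_measure \<xi>) = (\<integral>\<^sup>+s. (\<integral>\<^sup>+\<theta>. f (s, \<theta>) \<partial>angle_measure) \<partial>uniform_measure lborel {0<..<\<xi>})"
    unfolding parameter_measure_def using f' by (rule A.nn_integral_fst[symmetric])
  also have "\<dots> = (\<integral>\<^sup>+s. (\<integral>\<^sup>+\<theta>. f (s, \<theta>) \<partial>angle_measure) * indicator {0<..<\<xi>} s \<partial>lborel) / emeasure lborel {0<..<\<xi>}"
    using A.borel_measurable_nn_integral_fst[OF f''] by (intro nn_integral_uniform_measure) auto
  finally show ?thesis using \<xi> by simp
qed

text \<open>\<open>measure_of\<close> yields the zero measure unless its set function is countably
  additive. Fubini identifies that function with the image of a product measure, which settles
  additivity.\<close>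

lemma nu1_eq_distr:
  assumes p: "p > 0" "q > 0" and \<xi>: "\<xi> > 0"
  shows "nu1 p q \<xi> = distr (parameter_measure \<xi>) borel (\<lambda>x. support_point p q (fst x) (snd x))" (is "_ = ?N")
proof -
  note m = support_point_measurable[OF p]
  have m': "(\<lambda>x. support_point p q (fst x) (snd x)) \<in> measurable (parameter_measure \<xi>) borel"
    using m by (subst measurable_cong_sets[OF sets_parameter_measure refl])
  have eq: "ennreal (1 / \<xi>) * (\<integral>\<^sup>+s\<in>{0<..<\<xi>}. emeasure (mu1 p q s) B \<partial>lborel) = emeasure ?N B"
    if B: "B \<in> sets borel" for B
  proof -
    have [measurable]: "B \<in> sets borel" by fact
    note [measurable] = m
    have "emeasure ?N B = (\<integral>\<^sup>+x. indicator B x \<partial>?N)" using B by simp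
    also have "\<dots> = (\<integral>\<^sup>+x. indicator B (support_point p q (fst x) (snd x)) \<partial>parameter_measure \<xi>)"
      using B by (intro nn_integral_distr m') auto
    also have "\<dots> = (\<integral>\<^sup>+s. (\<integral>\<^sup>+\<theta>. indicator B (support_point p q s \<theta>) \<partial>angle_measure) * indicator {0<..<\<xi>} s \<partial>lborel) / ennreal \<xi>"
      by (subst nn_integral_parameter[OF \<xi>]) auto
    also have "(\<integral>\<^sup>+s. (\<integral>\<^sup>+\<theta>. indicator B (support_point p q s \<theta>) \<partial>angle_measure) * indicator {0<..<\<xi>} s \<partial>lborel)
       = (\<integral>\<^sup>+s\<in>{0<..<\<xi>}. emeasure (mu1 p q s) B \<partial>lborel)"
    proof (intro nn_integral_cong)
      fix s :: real
      show "(\<integral>\<^sup>+\<theta>. indicator B (support_point p q s \<theta>) \<partial>angle_measure) * indicator {0<..<\<xi>} s = emeasure (mu1 p q s) B * indicator {0<..<\<xi>} s"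
      proof (cases "s \<in> {0<..<\<xi>}")
        case True
        then have s: "s > 0" by simp
        interpret triple s "s + p" "s + p + q" by (rule triple_shift[OF p s])
        have Ym: "Y \<in> borel_measurable angle_measure" using borel_measurable_continuous_onI[OF Y_cont] by simp
        have "emeasure (mu1 p q s) B = (\<integral>\<^sup>+x. indicator B x \<partial>mu1 p q s)" using B by (simp add: mu1_eq_distr[OF p s])
        also have "\<dots> = (\<integral>\<^sup>+\<theta>. indicator B (Y \<theta>) \<partial>angle_measure)"
          unfolding mu1_eq_distr[OF p s] using B by (intro nn_integral_distr Ym) auto
        finally show ?thesis using s by (simp add: support_point_def)
      qed simp
    qed
    finally show ?thesis using \<xi> by (simp add: divide_ennreal_def mult.commute inverse_ennreal inverse_eq_divide)
  qed
  have "nu1 p q \<xi> = measure_of UNIV (sets borel) (emeasure ?N)"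
    unfolding nu1_def by (rule measure_of_eq) (use eq sets.sigma_sets_eq[of borel] in auto)
  also have "\<dots> = measure_of (space ?N) (sets ?N) (emeasure ?N)" by simp
  also have "\<dots> = ?N" by (rule measure_of_of_measure)
  finally show ?thesis .
qed

lemma prob_space_nu1:
  assumes p: "p > 0" "q > 0" and \<xi>: "\<xi> > 0"
  shows "prob_space (nu1 p q \<xi>)"
proof -
  interpret A: prob_space angle_measure by (rule prob_space_angle)
  interpret B: prob_space "uniform_measure lborel {0<..<\<xi>}" by (rule prob_space_parameter[OF \<xi>])
  interpret P: pair_prob_space "uniform_measure lborel {0<..<\<xi>}" angle_measure ..
  have "(\<lambda>x. support_point p q (fst x) (snd x)) \<in> measurable (parameter_measure \<xi>) borel"
    using support_point_measurable[OF p] by (subst measurable_cong_sets[OF sets_parameter_measure refl])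
  then show ?thesis unfolding nu1_eq_distr[OF assms] parameter_measure_def by (rule P.prob_space_distr)
qed

lemma AE_nu1_nonneg:
  assumes p: "p > 0" "q > 0" and \<xi>: "\<xi> > 0"
  shows "AE x in nu1 p q \<xi>. x \<ge> 0"
proof -
  have "(\<lambda>x. support_point p q (fst x) (snd x)) \<in> measurable (parameter_measure \<xi>) borel"
    using support_point_measurable[OF p] by (subst measurable_cong_sets[OF sets_parameter_measure refl])
  then show ?thesis unfolding nu1_eq_distr[OF assms]
    by (subst AE_distr_iff) (auto simp: support_point_nonneg[OF p])
qed

text \<open>This is \<open>stieltjes_curve\<close> at v = s - U: the distances from v to s, s + p, s
  + p + q are U, U + p, U + p + q, and s is chosen so that the cubic equation at -y holds.\<close>

lemma stieltjes_angle:
  assumes p: "p > 0" "q > 0" and y: "y > 0" and U: "U > 0"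
  defines "s \<equiv> U + U * (U + p) * (U + p + q) / y"
  shows "(\<integral>\<^sup>+\<theta>. ennreal (1 / (y + support_point p q s \<theta>)) \<partial>angle_measure)
    = ennreal (1 / ((U + p) * (U + p + q) + U * (U + p + q) + U * (U + p) + y))"
proof -
  have s: "s > U" "s > 0" using p y U by (auto simp: s_def add_pos_pos)
  interpret triple s "s + p" "s + p + q" by (rule triple_shift[OF p s(2)])
  define D where "D = (U + p) * (U + p + q) + U * (U + p + q) + U * (U + p) + y"
  have D: "D > 0" unfolding D_def using p y U by (intro add_pos_pos mult_pos_pos) auto
  have "y * (s - U) = U * (U + p) * (U + p + q)" using y by (simp add: s_def)
  then have "((s - U) - s) * ((s - U) - (s + p)) * ((s - U) - (s + p + q)) = - y * (s - U)"
    by (simp add: algebra_simps)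
  from stieltjes_curve[OF y _ _ this] s U
  have "((\<lambda>\<theta>. 1 / (y + X (u_of \<theta>))) has_integral
     pi / (((s - U) - (s + p)) * ((s - U) - (s + p + q)) + ((s - U) - s) * ((s - U) - (s + p + q)) + ((s - U) - s) * ((s - U) - (s + p)) + y)) {0..pi}"
    by simp
  also have "((s - U) - (s + p)) * ((s - U) - (s + p + q)) + ((s - U) - s) * ((s - U) - (s + p + q)) + ((s - U) - s) * ((s - U) - (s + p)) + y = D"
    by (simp add: D_def algebra_simps)
  finally have h: "((\<lambda>\<theta>. 1 / (y + Y \<theta>)) has_integral pi / D) {0..pi}" unfolding Y_def .
  have nonneg: "1 / (y + Y \<theta>) \<ge> 0" for \<theta> using y Y_pos[of \<theta>] by simp
  have meas: "(\<lambda>\<theta>. ennreal (1 / (y + Y \<theta>))) \<in> borel_measurable lborel"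
    using borel_measurable_continuous_onI[OF Y_cont] by simp
  have "(\<integral>\<^sup>+\<theta>. ennreal (1 / (y + support_point p q s \<theta>)) \<partial>angle_measure) = (\<integral>\<^sup>+\<theta>. ennreal (1 / (y + Y \<theta>)) * indicator {0..pi} \<theta> \<partial>lborel) / emeasure lborel {0..pi}"
    using s meas by (simp add: support_point_def nn_integral_uniform_measure)
  also have "(\<integral>\<^sup>+\<theta>. ennreal (1 / (y + Y \<theta>)) * indicator {0..pi} \<theta> \<partial>lborel) = (\<integral>\<^sup>+\<theta>. ennreal (indicator {0..pi} \<theta> * (1 / (y + Y \<theta>))) \<partial>lborel)"
    by (intro nn_integral_cong) (auto split: split_indicator)
  also have "\<dots> = ennreal (pi / D)"
    by (rule nn_integral_has_integral_lebesgue[OF nonneg h])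
  also have "ennreal (pi / D) / emeasure lborel {0..pi} = ennreal (1 / D)"
    using D by (simp add: divide_ennreal)
  finally show ?thesis unfolding D_def .
qed

lemma stieltjes_nu1:
  assumes p: "p > 0" "q > 0" and \<xi>: "\<xi> > 0" and y: "y > 0"
    and U: "U > 0" "U * (U + p) * (U + p + q) = y * (\<xi> - U)"
  shows "(\<integral>x. 1 / (y + x) \<partial>nu1 p q \<xi>) = U / (\<xi> * y)"
proof -
  define \<Phi> where "\<Phi> t = (t + p) * (t + p + q) + t * (t + p + q) + t * (t + p)" for t
  define S where "S t = t + t * (t + p) * (t + p + q) / y" for t
  define G where "G s = (\<integral>\<^sup>+\<theta>. ennreal (1 / (y + support_point p q s \<theta>)) \<partial>angle_measure)" for s
  \<comment> \<open>The cubic equation for U says precisely that the substitution ends at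
    \<xi>.\<close>
  have S0: "S 0 = 0" and SU: "S U = \<xi>" using U y by (simp_all add: S_def)
  have S_deriv: "(S has_real_derivative (\<Phi> t + y) / y) (at t)" for t
    unfolding S_def[abs_def] \<Phi>_def using y by (auto intro!: derivative_eq_intros simp: field_simps)
  have G: "G (S t) = ennreal (1 / (\<Phi> t + y))" if "t > 0" for t
    using stieltjes_angle[OF p y that] unfolding G_def S_def \<Phi>_def .
  have \<Phi>_pos: "\<Phi> t + y > 0" if "t \<ge> 0" for t
    unfolding \<Phi>_def using that p y by (intro add_nonneg_pos add_nonneg_nonneg mult_nonneg_nonneg) auto
  note [measurable] = support_point_measurable[OF p]
  have kern: "(\<lambda>x. ennreal (1 / (y + support_point p q (fst x) (snd x)))) \<in> borel_measurable (borel \<Otimes>\<^sub>M borel)" by measurable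
  interpret A: prob_space angle_measure by (rule prob_space_angle)
  have "(\<lambda>x. ennreal (1 / (y + support_point p q (fst x) (snd x)))) \<in> borel_measurable (borel \<Otimes>\<^sub>M angle_measure)"
    using kern by (subst measurable_cong_sets[of _ "borel \<Otimes>\<^sub>M borel"]) (auto intro!: sets_pair_measure_cong)
  from A.borel_measurable_nn_integral_fst[OF this] have Gm: "G \<in> borel_measurable borel" unfolding G_def[abs_def] by simp
  have "(\<integral>\<^sup>+s. G s * indicator {0<..<\<xi>} s \<partial>lborel) = (\<integral>\<^sup>+s. G s * indicator {S 0..S U} s \<partial>lborel)"
  proof (rule nn_integral_cong_AE)
    have "AE s in lborel. s \<notin> {0, \<xi>}"
      using countable_imp_null_set_lborel[of "{0, \<xi>}"] by (intro AE_not_in) auto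
    then show "AE s in lborel. G s * indicator {0<..<\<xi>} s = G s * indicator {S 0..S U} s"
      by eventually_elim (auto simp: S0 SU split: split_indicator)
  qed
  also have "\<dots> = (\<integral>\<^sup>+t. G (S t) * ennreal ((\<Phi> t + y) / y) * indicator {0..U} t \<partial>lborel)"
    by (rule nn_integral_substitution_aux[OF Gm _ S_deriv])
      (use U y \<Phi>_pos in \<open>auto simp: \<Phi>_def less_imp_le intro!: continuous_intros\<close>)
  also have "\<dots> = (\<integral>\<^sup>+t. ennreal (1 / y) * indicator {0..U} t \<partial>lborel)"
  proof (rule nn_integral_cong_AE)
    have "AE t in lborel. t \<notin> {0::real}"
      using countable_imp_null_set_lborel[of "{0::real}"] by (intro AE_not_in) auto
    then show "AE t in lborel. G (S t) * ennreal ((\<Phi> t + y) / y) * indicator {0..U} t = ennreal (1 / y) * indicator {0..U} t"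
    proof eventually_elim
      case (elim t)
      show ?case
      proof (cases "t \<in> {0..U}")
        case True
        then have t: "t > 0" using elim by simp
        have "G (S t) * ennreal ((\<Phi> t + y) / y) = ennreal (1 / (\<Phi> t + y) * ((\<Phi> t + y) / y))"
          unfolding G[OF t] using \<Phi>_pos[of t] t y by (intro ennreal_mult[symmetric]) auto
        also have "1 / (\<Phi> t + y) * ((\<Phi> t + y) / y) = 1 / y" using \<Phi>_pos[of t] t by simp
        finally show ?thesis by simp
      qed simp
    qed
  qed
  also have "\<dots> = ennreal (U / y)"
    using U y by (subst nn_integral_cmult_indicator) (auto simp: ennreal_mult[symmetric])
  finally have int: "(\<integral>\<^sup>+s. G s * indicator {0<..<\<xi>} s \<partial>lborel) = ennreal (U / y)" .
  have m': "(\<lambda>x. support_point p q (fst x) (snd x)) \<in> measurable (parameter_measure \<xi>) borel"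
    using support_point_measurable[OF p] by (subst measurable_cong_sets[OF sets_parameter_measure refl])
  have "(\<integral>\<^sup>+x. ennreal (1 / (y + x)) \<partial>nu1 p q \<xi>) = (\<integral>\<^sup>+x. ennreal (1 / (y + support_point p q (fst x) (snd x))) \<partial>parameter_measure \<xi>)"
    unfolding nu1_eq_distr[OF p \<xi>] by (intro nn_integral_distr m') auto
  also have "\<dots> = ennreal (U / y) / ennreal \<xi>"
    using nn_integral_parameter[OF \<xi> kern] int unfolding G_def by simp
  also have "\<dots> = ennreal (U / (\<xi> * y))" using U y \<xi> by (simp add: divide_ennreal mult.commute)
  finally have nn: "(\<integral>\<^sup>+x. ennreal (1 / (y + x)) \<partial>nu1 p q \<xi>) = ennreal (U / (\<xi> * y))" .
  have "(\<integral>x. 1 / (y + x) \<partial>nu1 p q \<xi>) = enn2real (\<integral>\<^sup>+x. ennreal (1 / (y + x)) \<partial>nu1 p q \<xi>)"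
  proof (rule integral_eq_nn_integral)
    have "sets (nu1 p q \<xi>) = sets borel" unfolding nu1_eq_distr[OF p \<xi>] by simp
    then show "(\<lambda>x. 1 / (y + x)) \<in> borel_measurable (nu1 p q \<xi>)" by (subst measurable_cong_sets[OF _ refl]) auto
    show "AE x in nu1 p q \<xi>. 0 \<le> 1 / (y + x)" using AE_nu1_nonneg[OF p \<xi>] by eventually_elim (use y in auto)
  qed
  then show ?thesis unfolding nn using U y \<xi> by simp
qed

section \<open>Weak convergence\<close>

lemma order_prod_linear:
  fixes r :: "nat \<Rightarrow> real"
  shows "order a (\<Prod>i<k. [:- r i, 1:]) = card {i. i < k \<and> r i = a}"
proof (induction k)
  case (Suc k)
  have 1: "order a [:- r k, 1:] = (if r k = a then 1 else 0)"
    using order_power_n_n[of a 1] by (auto intro: order_0I)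
  have "{i. i < Suc k \<and> r i = a} = (if r k = a then insert k {i. i < k \<and> r i = a} else {i. i < k \<and> r i = a})"
    by (auto simp: less_Suc_eq)
  moreover have "(\<Prod>i<k. [:- r i, 1:]) * [:- r k, 1:] \<noteq> 0" by (rule no_zero_divisors) auto
  ultimately show ?case unfolding prod.lessThan_Suc by (simp add: order_mult Suc.IH 1 del: mult_pCons_right)
qed simp

lemma integral_zero_measure:
  fixes f :: "real \<Rightarrow> real"
  assumes f: "f \<in> borel_measurable borel" and r: "P_poly p q n k = (\<Prod>i<k. [:- r i, 1:])"
  shows "(\<integral>x. f x \<partial>zero_measure p q n k) = (\<Sum>i<k. f (r i)) / real k"
proof -
  define A where "A = {x. poly (P_poly p q n k) x = 0}"
  have A: "A = r ` {..<k}" unfolding A_def r by (auto simp: poly_prod)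
  have "(\<integral>x. f x \<partial>zero_measure p q n k)
     = (\<integral>x. f x \<partial>point_measure A (\<lambda>x. ennreal (real (order x (P_poly p q n k)) / real k)))"
    unfolding zero_measure_def A_def[symmetric] using f by (subst integral_distr) (auto simp: point_measure_def)
  also have "\<dots> = (\<Sum>x\<in>A. (real (order x (P_poly p q n k)) / real k) *\<^sub>R f x)"
    by (rule lebesgue_integral_point_measure_finite) (auto simp: A)
  also have "\<dots> = (\<Sum>x\<in>A. real (card {i\<in>{..<k}. r i = x}) * f x) / real k"
    unfolding r order_prod_linear by (simp add: sum_divide_distrib)
  also have "(\<Sum>x\<in>A. real (card {i\<in>{..<k}. r i = x}) * f x) = (\<Sum>x\<in>A. \<Sum>i\<in>{i\<in>{..<k}. r i = x}. f (r i))"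
    by (intro sum.cong refl) simp
  also have "\<dots> = (\<Sum>i<k. f (r i))" by (rule sum.group) (auto simp: A)
  finally show ?thesis .
qed

text \<open>The good test functions form a vector space closed under uniform limits. Once it
  contains all powers of 1 / (1 + |x|), Weierstrass approximation gives every continuous function
  with a limit at infinity; a cutoff and the tightness of N cover the rest.\<close>

lemma weak_convergence_from_stieltjes:
  fixes r :: "nat \<Rightarrow> nat \<Rightarrow> real" and k :: "nat \<Rightarrow> nat" and N :: "real measure" and f :: "real \<Rightarrow> real"
  assumes N: "prob_space N" "sets N = sets borel" "AE x in N. x \<ge> 0"
    and k: "eventually (\<lambda>j. k j > 0) sequentially"
    and r: "eventually (\<lambda>j. \<forall>i<k j. r j i \<ge> 0) sequentially"
    and st: "\<And>y. y > 0 \<Longrightarrow> (\<lambda>j. (\<Sum>i<k j. 1 / (y + r j i)) / real (k j)) \<longlonglongrightarrow> (\<integral>x. 1 / (y + x) \<partial>N)"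
    and f: "continuous_on UNIV f" "bounded (range f)"
  shows "(\<lambda>j. (\<Sum>i<k j. f (r j i)) / real (k j)) \<longlonglongrightarrow> (\<integral>x. f x \<partial>N)"
proof -
  interpret prob_space N by (rule N)
  define I where "I j g = (\<Sum>i<k j. g (r j i)) / real (k j)" for j and g :: "real \<Rightarrow> real"
  define good where "good g \<longleftrightarrow> g \<in> borel_measurable borel \<and> (\<exists>K. \<forall>x. \<bar>g x\<bar> \<le> K) \<and> (\<lambda>j. I j g) \<longlonglongrightarrow> (\<integral>x. g x \<partial>N)" for g
  have integ: "integrable N g" if "g \<in> borel_measurable borel" "\<forall>x. \<bar>g x\<bar> \<le> K" for g :: "real \<Rightarrow> real" and K
    by (rule integrable_const_bound[where B = K]) (use that in \<open>auto simp: measurable_cong_sets[OF N(2) refl]\<close>)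
  have good_integ: "integrable N g" if "good g" for g
    using that integ unfolding good_def by blast
  have good_add: "good (\<lambda>x. g x + h x)" if g: "good g" and h: "good h" for g h
  proof -
    obtain K K' where "\<forall>x. \<bar>g x\<bar> \<le> K" "\<forall>x. \<bar>h x\<bar> \<le> K'" using g h unfolding good_def by blast
    then have "\<forall>x. \<bar>g x + h x\<bar> \<le> K + K'" by (intro allI order.trans[OF abs_triangle_ineq] add_mono) auto
    moreover have "(\<lambda>j. I j g + I j h) \<longlonglongrightarrow> (\<integral>x. g x \<partial>N) + (\<integral>x. h x \<partial>N)"
      using g h by (intro tendsto_add) (auto simp: good_def)
    ultimately show ?thesis using g h good_integ[OF g] good_integ[OF h]
      unfolding good_def by (auto simp: I_def sum.distrib add_divide_distrib)
  qed
  have good_cmult: "good (\<lambda>x. c * g x)" if g: "good g" for g c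
  proof -
    obtain K where "\<forall>x. \<bar>g x\<bar> \<le> K" using g by (auto simp: good_def)
    then have "\<forall>x. \<bar>c * g x\<bar> \<le> \<bar>c\<bar> * K" by (auto simp: abs_mult intro: mult_left_mono)
    moreover have "(\<lambda>j. c * I j g) \<longlonglongrightarrow> c * (\<integral>x. g x \<partial>N)"
      using g by (intro tendsto_mult tendsto_const) (auto simp: good_def)
    ultimately show ?thesis using g
      unfolding good_def by (auto simp: I_def sum_distrib_left[symmetric])
  qed
  have I_bound: "\<bar>I j g\<bar> \<le> e" if "k j > 0" "\<forall>x. \<bar>g x\<bar> \<le> e" for j g e
  proof -
    have "\<bar>\<Sum>i<k j. g (r j i)\<bar> \<le> (\<Sum>i<k j. e)" using that(2) by (intro order.trans[OF sum_abs] sum_mono) auto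
    then show ?thesis using that(1) by (simp add: I_def field_simps)
  qed
  have L_bound: "\<bar>\<integral>x. g x \<partial>N\<bar> \<le> e" if g: "g \<in> borel_measurable borel" "\<forall>x. \<bar>g x\<bar> \<le> e" for g :: "real \<Rightarrow> real" and e
  proof -
    have "\<bar>\<integral>x. g x \<partial>N\<bar> \<le> (\<integral>x. \<bar>g x\<bar> \<partial>N)" using integral_norm_bound[of N g] by simp
    also have "\<dots> \<le> (\<integral>x. e \<partial>N)" using g integ[OF g] by (intro integral_mono) auto
    finally show ?thesis by (simp add: prob_space)
  qed
  have good_const: "good (\<lambda>x. c)" for c
  proof -
    have "eventually (\<lambda>j. I j (\<lambda>x. c) = c) sequentially" using k by eventually_elim (simp add: I_def)
    then have "(\<lambda>j. I j (\<lambda>x. c)) \<longlonglongrightarrow> c" by (rule tendsto_eventually)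
    then show ?thesis by (auto simp: good_def prob_space)
  qed
  have good_uniform: "good g" if g: "g \<in> borel_measurable borel" "\<And>x. \<bar>g x\<bar> \<le> K"
    and app: "\<And>e. e > 0 \<Longrightarrow> \<exists>h. good h \<and> (\<forall>x. \<bar>g x - h x\<bar> \<le> e)" for g K
  proof -
    have "(\<lambda>j. I j g) \<longlonglongrightarrow> (\<integral>x. g x \<partial>N)"
    proof (rule tendstoI)
      fix e :: real assume e: "e > 0"
      obtain h where h: "good h" "\<forall>x. \<bar>g x - h x\<bar> \<le> e / 4" using app[of "e / 4"] e by auto
      have "eventually (\<lambda>j. dist (I j h) (\<integral>x. h x \<partial>N) < e / 4) sequentially"
        using h(1) e by (intro tendstoD) (auto simp: good_def)
      then show "eventually (\<lambda>j. dist (I j g) (\<integral>x. g x \<partial>N) < e) sequentially" using k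
      proof eventually_elim
        case (elim j)
        have "I j g - I j h = I j (\<lambda>x. g x - h x)" by (simp add: I_def sum_subtractf diff_divide_distrib)
        then have 1: "\<bar>I j g - I j h\<bar> \<le> e / 4" using I_bound[OF elim(2) h(2)] by simp
        have "(\<integral>x. g x \<partial>N) - (\<integral>x. h x \<partial>N) = (\<integral>x. g x - h x \<partial>N)"
          using good_integ[OF h(1)] integ[of g K] g by (intro Bochner_Integration.integral_diff[symmetric]) auto
        moreover have "\<bar>\<integral>x. g x - h x \<partial>N\<bar> \<le> e / 4"
          by (rule L_bound) (use g h in \<open>auto simp: good_def\<close>)
        ultimately have "\<bar>(\<integral>x. g x \<partial>N) - (\<integral>x. h x \<partial>N)\<bar> \<le> e / 4" by simp
        then show ?case using 1 elim(1) e unfolding dist_real_def by linarith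
      qed
    qed
    then show ?thesis using g by (auto simp: good_def)
  qed
  \<comment> \<open>The absolute value makes the kernel bounded on the whole line without changing
    it on the nonnegative axis.\<close>
  define A where "A y x = 1 / (y + \<bar>x\<bar>)" for y x :: real
  have A_meas: "A y \<in> borel_measurable borel" for y unfolding A_def[abs_def] by measurable
  have A_bound: "0 < A y x" "A y x \<le> 1 / y" if "y > 0" for y x using that by (auto simp: A_def add_pos_nonneg frac_le)
  have A_resolvent: "A y x - A z x = (z - y) * (A y x * A z x)" if "y > 0" "z > 0" for x y z
  proof -
    have "y + \<bar>x\<bar> \<noteq> 0" "z + \<bar>x\<bar> \<noteq> 0" using that by linarith+
    then show ?thesis unfolding A_def by (simp add: field_simps)
  qed
  have good_A: "good (A y)" if y: "y > 0" for y
  proof -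
    have "eventually (\<lambda>j. (\<Sum>i<k j. 1 / (y + r j i)) / real (k j) = I j (A y)) sequentially"
      using r by eventually_elim (simp add: I_def A_def)
    from Lim_transform_eventually[OF st[OF y] this] have "(\<lambda>j. I j (A y)) \<longlonglongrightarrow> (\<integral>x. 1 / (y + x) \<partial>N)" .
    also have "(\<integral>x. 1 / (y + x) \<partial>N) = (\<integral>x. A y x \<partial>N)"
      by (rule integral_cong_AE) (use N(3) A_meas N(2) in \<open>auto simp: A_def measurable_cong_sets[OF N(2) refl]\<close>)
    finally show ?thesis using A_meas A_bound[OF y]
      by (auto simp: good_def abs_of_pos intro!: exI[of _ "1 / y"])
  qed
  text \<open>The span of the functions \<open>A y\<close> and \<open>1\<close> is closed under products up to uniform limits, by the resolvent identity.\<close>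
  have good_prod: "good (\<lambda>x. \<Prod>y\<leftarrow>ys. A y x)" if "\<forall>y\<in>set ys. y > 0" for ys
    using that
  proof (induction "length ys" arbitrary: ys rule: less_induct)
    case less
    consider "ys = []" | y where "ys = [y]" | y z zs where "ys = y # z # zs" by (cases ys; cases "tl ys") auto
    then show ?case
    proof cases
      case 1
      then show ?thesis using good_const[of 1] by simp
    next
      case 2
      then show ?thesis using good_A less.prems by simp
    next
      case 3
      define R where "R x = (\<Prod>y\<leftarrow>zs. A y x)" for x
      have y: "y > 0" "z > 0" and zs: "\<forall>y\<in>set zs. y > 0" using less.prems 3 by auto
      have R_meas: "R \<in> borel_measurable borel" unfolding R_def[abs_def] by (induction zs) (use A_meas in auto)
      have "\<exists>K. \<forall>x. \<bar>R x\<bar> \<le> K" unfolding R_def using zs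
      proof (induction zs)
        case (Cons a zs)
        then obtain K where K: "\<forall>x. \<bar>\<Prod>y\<leftarrow>zs. A y x\<bar> \<le> K" by auto
        have "\<bar>A a x\<bar> * \<bar>\<Prod>y\<leftarrow>zs. A y x\<bar> \<le> 1 / a * K" for x
          using A_bound[of a x] Cons.prems K by (intro mult_mono) auto
        then show ?case by (auto simp: abs_mult)
      qed auto
      then obtain K where K: "\<And>x. \<bar>R x\<bar> \<le> K" by auto
      have AR: "good (\<lambda>x. A y x * R x)" if "y > 0" for y
        using less.hyps[of "y # zs"] that zs 3 by (simp add: R_def)
      have distinct: "good (\<lambda>x. A y x * A z x * R x)" if "y \<noteq> z" "y > 0" "z > 0" for y z
      proof -
        have "good (\<lambda>x. 1 / (z - y) * (A y x * R x + (-1) * (A z x * R x)))"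
          using that by (intro good_cmult good_add AR)
        moreover have "1 / (z - y) * (A y x * R x + (-1) * (A z x * R x)) = A y x * A z x * R x" for x
        proof -
          have "1 / (z - y) * (A y x * R x + (-1) * (A z x * R x)) = 1 / (z - y) * ((A y x - A z x) * R x)" by (simp add: algebra_simps)
          also have "\<dots> = A y x * A z x * R x" unfolding A_resolvent[OF that(2,3)] using that(1) by simp
          finally show ?thesis .
        qed
        ultimately show ?thesis by simp
      qed
      have "good (\<lambda>x. A y x * A z x * R x)"
      proof (cases "y = z")
        case False
        then show ?thesis using distinct y by simp
      next
        case True
        show ?thesis unfolding True[symmetric]
        proof (rule good_uniform)
          show "(\<lambda>x. A y x * A y x * R x) \<in> borel_measurable borel" using A_meas R_meas by measurable
          show "\<bar>A y x * A y x * R x\<bar> \<le> 1 / y * (1 / y) * K" for x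
            unfolding abs_mult using A_bound[OF y(1), of x] K[of x] y(1) by (intro mult_mono mult_nonneg_nonneg) auto
          fix e :: real assume e: "e > 0"
          have K0: "K \<ge> 0" using K[of 0] by linarith
          \<comment> \<open>For a repeated parameter the resolvent identity has no divided
            difference, so one copy is shifted to y + h; the error is at most h K / y^3, and K + 1
            avoids division by 0.\<close>
          define h where "h = e * y ^ 3 / (K + 1)"
          have h: "h > 0" using e y K0 by (simp add: h_def)
          have "\<bar>A y x * A y x * R x - A y x * A (y + h) x * R x\<bar> \<le> e" for x
          proof -
            have "A y x * A y x * R x - A y x * A (y + h) x * R x = A y x * (A y x - A (y + h) x) * R x" by (simp add: algebra_simps)
            also have "\<dots> = h * (A y x * (A y x * A (y + h) x)) * R x" using A_resolvent[of y "y + h" x] y h by simp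
            also have "\<bar>\<dots>\<bar> = h * (\<bar>A y x\<bar> * (\<bar>A y x\<bar> * \<bar>A (y + h) x\<bar>)) * \<bar>R x\<bar>" using h by (simp add: abs_mult)
            also have "\<dots> \<le> h * (1 / y * (1 / y * (1 / y))) * K"
            proof -
              have "A (y + h) x \<le> 1 / (y + h)" using A_bound(2)[of "y + h" x] y h by simp
              also have "\<dots> \<le> 1 / y" using y h by (simp add: frac_le)
              finally show ?thesis using A_bound[OF y(1), of x] A_bound(1)[of "y + h" x] K[of x] K0 y h
                by (intro mult_mono mult_nonneg_nonneg) auto
            qed
            also have "\<dots> = e * (K / (K + 1))" using y K0 by (simp add: h_def field_simps power3_eq_cube)
            also have "\<dots> \<le> e" using e K0 by (intro mult_left_le) auto
            finally show ?thesis .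
          qed
          moreover have "good (\<lambda>x. A y x * A (y + h) x * R x)" using distinct[of y "y + h"] y h by simp
          ultimately show "\<exists>g. good g \<and> (\<forall>x. \<bar>A y x * A y x * R x - g x\<bar> \<le> e)" by blast
        qed
      qed
      then show ?thesis using 3 by (simp add: R_def mult.assoc)
    qed
  qed
  have w01: "0 < A 1 x" "A 1 x \<le> 1" for x using A_bound[of 1 x] by auto
  have good_power: "good (\<lambda>x. A 1 x ^ m)" for m
    using good_prod[of "replicate m 1"] by (simp add: prod_list_replicate)
  have good_poly: "good (\<lambda>x. \<Sum>i\<le>n. a i * A 1 x ^ i)" for a and n :: nat
  proof (induction n)
    case 0
    show ?case using good_const by simp
  next
    case (Suc n)
    then show ?case unfolding sum.atMost_Suc by (intro good_add good_cmult good_power)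
  qed
  have good_cont: "good (\<lambda>x. G (A 1 x))" if G: "continuous_on {0..1} G" for G :: "real \<Rightarrow> real"
  proof -
    obtain K where K: "\<forall>w\<in>{0..1}. \<bar>G w\<bar> \<le> K"
      using compact_imp_bounded[OF compact_continuous_image[OF G compact_Icc]] unfolding bounded_iff by auto
    have "continuous_on UNIV (\<lambda>x. G (A 1 x))"
    proof (rule continuous_on_compose2[OF G])
      show "continuous_on UNIV (A 1)" unfolding A_def[abs_def] by (intro continuous_intros) (auto simp: add_nonneg_eq_0_iff)
    qed (use w01 in \<open>auto simp: less_imp_le\<close>)
    then have "(\<lambda>x. G (A 1 x)) \<in> borel_measurable borel" by (rule borel_measurable_continuous_onI)
    then show ?thesis
    proof (rule good_uniform)
      show "\<bar>G (A 1 x)\<bar> \<le> K" for x using K w01[of x] by (simp add: less_imp_le)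
      fix e :: real assume "e > 0"
      then obtain h where h: "real_polynomial_function h" "\<And>w. w \<in> {0..1} \<Longrightarrow> \<bar>G w - h w\<bar> < e"
        using Stone_Weierstrass_real_polynomial_function[OF compact_Icc G] by blast
      from h(1) obtain a n where "h = (\<lambda>x. \<Sum>i\<le>n. a i * x ^ i)" unfolding real_polynomial_function_iff_sum by blast
      then have "good (\<lambda>x. h (A 1 x))" using good_poly by simp
      moreover have "\<bar>G (A 1 x) - h (A 1 x)\<bar> \<le> e" for x using h(2)[of "A 1 x"] w01[of x] by (simp add: less_imp_le)
      ultimately show "\<exists>g. good g \<and> (\<forall>x. \<bar>G (A 1 x) - g x\<bar> \<le> e)" by blast
    qed
  qed
  obtain B where "\<forall>x. \<bar>f x\<bar> \<le> B" using f(2) unfolding bounded_iff by auto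
  then have B: "\<bar>f x\<bar> \<le> B" for x by blast
  have B0: "B \<ge> 0" using B[of 0] by linarith
  have f_meas: "f \<in> borel_measurable borel" by (rule borel_measurable_continuous_onI[OF f(1)])
  \<comment> \<open>A cutoff equal to 1 for 1 + |x| \<le> R. Being a continuous function of
    \<open>A 1 x\<close> that vanishes at 0, it makes f times the cutoff accessible to the
    approximation.\<close>
  define H where "H R x = min 1 (R * A 1 x)" for R x
  have H01: "0 \<le> H R x" "H R x \<le> 1" if "R \<ge> 0" for R x using that w01[of x] by (auto simp: H_def)
  have good_H: "good (\<lambda>x. 1 - H R x)" if "R \<ge> 0" for R
    unfolding H_def by (rule good_cont) (intro continuous_intros)
  have good_fH: "good (\<lambda>x. f \<bar>x\<bar> * H R x)" if R: "R \<ge> 0" for R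
  proof -
    \<comment> \<open>The same function in the variable w = 1 / (1 + |x|); the factor R w forces
      continuity at w = 0, where f itself may oscillate.\<close>
    define G where "G w = (if w = 0 then 0 else f (1 / w - 1) * min 1 (R * w))" for w
    have "continuous_on {0..1} G"
      unfolding continuous_on_eq_continuous_within
    proof
      fix w :: real assume w: "w \<in> {0..1}"
      show "continuous (at w within {0..1}) G"
      proof (cases "w = 0")
        case True
        have "(G \<longlongrightarrow> 0) (at 0 within {0..1})"
        proof (rule Lim_null_comparison)
          have "\<bar>G t\<bar> \<le> B * (R * t)" if "t \<in> {0..1}" for t
            unfolding G_def using B[of "1 / t - 1"] that R B0 by (auto simp: abs_mult intro!: mult_mono)
          then show "eventually (\<lambda>t. norm (G t) \<le> B * (R * t)) (at 0 within {0..1})"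
            by (auto simp: eventually_at_filter)
          have "((\<lambda>t. B * (R * t)) \<longlongrightarrow> B * (R * 0)) (at 0 within {0..1})" by (intro tendsto_intros)
          then show "((\<lambda>t. B * (R * t)) \<longlongrightarrow> 0) (at 0 within {0..1})" by simp
        qed
        then show ?thesis using True by (simp add: continuous_within G_def)
      next
        case False
        then have w: "w \<in> {0<..}" using w by auto
        have "continuous_on {0<..} (\<lambda>w. f (1 / w - 1) * min 1 (R * w))"
          by (intro continuous_intros continuous_on_compose2[OF f(1)]) auto
        then have "continuous_on {0<..} G" by (rule continuous_on_eq) (auto simp: G_def)
        then have "isCont G w" using w by (simp add: continuous_on_eq_continuous_at)
        then show ?thesis by (rule continuous_at_imp_continuous_at_within)
      qed
    qed
    from good_cont[OF this] have "good (\<lambda>x. G (A 1 x))" .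
    moreover have "G (A 1 x) = f \<bar>x\<bar> * H R x" for x
    proof -
      have "A 1 x \<noteq> 0" "1 / A 1 x - 1 = \<bar>x\<bar>" using w01[of x] by (auto simp: A_def)
      then show ?thesis by (simp add: G_def H_def)
    qed
    ultimately show ?thesis by simp
  qed
  \<comment> \<open>Tightness of N; since 1 - H is a good test function, the bound carries over to
    the zero counting measures for large j.\<close>
  have tail: "(\<lambda>R. \<integral>x. 1 - H (real R) x \<partial>N) \<longlonglongrightarrow> (\<integral>x. 0 \<partial>N)"
  proof (rule integral_dominated_convergence[where w = "\<lambda>_. 1"])
    show "(\<lambda>x. 1 - H (real R) x) \<in> borel_measurable N" for R
      using good_integ[OF good_H[of "real R"]] by simp
    show "AE x in N. (\<lambda>R. 1 - H (real R) x) \<longlonglongrightarrow> 0"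
    proof (rule AE_I2)
      fix x
      have "eventually (\<lambda>R::nat. 1 / A 1 x \<le> real R) sequentially" using filterlim_real_sequentially unfolding filterlim_at_top by blast
      then have "eventually (\<lambda>R::nat. 1 - H (real R) x = 0) sequentially"
      proof eventually_elim
        case (elim R)
        then show ?case using w01[of x] by (simp add: H_def field_simps)
      qed
      then show "(\<lambda>R. 1 - H (real R) x) \<longlonglongrightarrow> 0" by (rule tendsto_eventually)
    qed
    show "AE x in N. norm (1 - H (real R) x) \<le> 1" for R using H01[of "real R"] by auto
  qed auto
  have Lf: "(\<integral>x. f x \<partial>N) = (\<integral>x. f \<bar>x\<bar> \<partial>N)"
    by (rule integral_cong_AE) (use N(3) f_meas in \<open>auto simp: measurable_cong_sets[OF N(2) refl]\<close>)
  have fabs_meas: "(\<lambda>x. f \<bar>x\<bar>) \<in> borel_measurable borel" using f_meas by measurable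
  have "(\<lambda>j. I j f) \<longlonglongrightarrow> (\<integral>x. f x \<partial>N)"
  proof (rule tendstoI)
    fix e :: real assume e: "e > 0"
    \<comment> \<open>The tails cost at most e/4 under N and e/4 + e/8 under the counting measures,
      and the cut-off integrals differ by less than e/8, in total less than e.\<close>
    define d where "d = e / (4 * (B + 1))"
    have d: "d > 0" "B * d \<le> e / 4" using e B0 by (auto simp: d_def field_simps)
    from tendstoD[OF tail d(1)] obtain R :: nat where R: "\<bar>\<integral>x. 1 - H (real R) x \<partial>N\<bar> < d"
      unfolding eventually_sequentially dist_real_def by auto
    have ev1: "eventually (\<lambda>j. dist (I j (\<lambda>x. 1 - H (real R) x)) (\<integral>x. 1 - H (real R) x \<partial>N) < e / (8 * (B + 1))) sequentially"
      using good_H[of "real R"] e B0 by (intro tendstoD) (auto simp: good_def)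
    have ev2: "eventually (\<lambda>j. dist (I j (\<lambda>x. f \<bar>x\<bar> * H (real R) x)) (\<integral>x. f \<bar>x\<bar> * H (real R) x \<partial>N) < e / 8) sequentially"
      using good_fH[of "real R"] e by (intro tendstoD) (auto simp: good_def)
    have L: "\<bar>(\<integral>x. f \<bar>x\<bar> \<partial>N) - (\<integral>x. f \<bar>x\<bar> * H (real R) x \<partial>N)\<bar> \<le> e / 4"
    proof -
      have "(\<integral>x. f \<bar>x\<bar> \<partial>N) - (\<integral>x. f \<bar>x\<bar> * H (real R) x \<partial>N) = (\<integral>x. f \<bar>x\<bar> - f \<bar>x\<bar> * H (real R) x \<partial>N)"
        using integ[OF fabs_meas, of B] B good_integ[OF good_fH[of "real R"]] by (intro Bochner_Integration.integral_diff[symmetric]) auto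
      also have "\<bar>\<dots>\<bar> \<le> (\<integral>x. \<bar>f \<bar>x\<bar> - f \<bar>x\<bar> * H (real R) x\<bar> \<partial>N)" using integral_norm_bound[of N "\<lambda>x. f \<bar>x\<bar> - f \<bar>x\<bar> * H (real R) x"] by simp
      also have "\<dots> \<le> (\<integral>x. B * (1 - H (real R) x) \<partial>N)"
      proof (rule integral_mono)
        show "integrable N (\<lambda>x. \<bar>f \<bar>x\<bar> - f \<bar>x\<bar> * H (real R) x\<bar>)"
          using integ[OF fabs_meas, of B] B good_integ[OF good_fH[of "real R"]] by (intro integrable_abs Bochner_Integration.integrable_diff) auto
        show "integrable N (\<lambda>x. B * (1 - H (real R) x))" using good_integ[OF good_H[of "real R"]] by (intro integrable_mult_right) auto
        fix x
        have "f \<bar>x\<bar> - f \<bar>x\<bar> * H (real R) x = f \<bar>x\<bar> * (1 - H (real R) x)" by (simp add: algebra_simps)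
        then have "\<bar>f \<bar>x\<bar> - f \<bar>x\<bar> * H (real R) x\<bar> = \<bar>f \<bar>x\<bar>\<bar> * (1 - H (real R) x)"
          using H01[of "real R" x] by (simp add: abs_mult)
        also have "\<dots> \<le> B * (1 - H (real R) x)" using B[of "\<bar>x\<bar>"] H01[of "real R" x] by (intro mult_right_mono) auto
        finally show "\<bar>f \<bar>x\<bar> - f \<bar>x\<bar> * H (real R) x\<bar> \<le> B * (1 - H (real R) x)" .
      qed
      also have "\<dots> = B * (\<integral>x. 1 - H (real R) x \<partial>N)" by simp
      also have "\<dots> \<le> B * d" using R B0 by (intro mult_left_mono) auto
      finally show ?thesis using d(2) by linarith
    qed
    show "eventually (\<lambda>j. dist (I j f) (\<integral>x. f x \<partial>N) < e) sequentially"
      using ev1 ev2 k r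
    proof eventually_elim
      case (elim j)
      have "(\<Sum>i<k j. f (r j i)) - (\<Sum>i<k j. f \<bar>r j i\<bar> * H (real R) (r j i)) = (\<Sum>i<k j. f \<bar>r j i\<bar> * (1 - H (real R) (r j i)))"
        unfolding sum_subtractf[symmetric] by (intro sum.cong refl) (use elim(4) in \<open>simp add: right_diff_distrib\<close>)
      then have "I j f - I j (\<lambda>x. f \<bar>x\<bar> * H (real R) x) = (\<Sum>i<k j. f \<bar>r j i\<bar> * (1 - H (real R) (r j i))) / real (k j)"
        by (simp add: I_def diff_divide_distrib[symmetric])
      moreover have "\<bar>\<Sum>i<k j. f \<bar>r j i\<bar> * (1 - H (real R) (r j i))\<bar> \<le> (\<Sum>i<k j. B * (1 - H (real R) (r j i)))"
        using B B0 H01[of "real R"] by (intro order.trans[OF sum_abs] sum_mono) (auto simp: abs_mult intro!: mult_mono)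
      ultimately have "\<bar>I j f - I j (\<lambda>x. f \<bar>x\<bar> * H (real R) x)\<bar> \<le> (\<Sum>i<k j. B * (1 - H (real R) (r j i))) / real (k j)"
        by (simp add: divide_right_mono)
      also have "\<dots> = B * I j (\<lambda>x. 1 - H (real R) x)" by (simp add: I_def sum_distrib_left)
      also have "\<dots> \<le> B * (d + e / (8 * (B + 1)))"
        using elim(1) R B0 unfolding dist_real_def by (intro mult_left_mono) linarith+
      also have "\<dots> \<le> e / 4 + e / 8"
      proof -
        have "B * (e / (8 * (B + 1))) \<le> e / 8" using e B0 by (simp add: field_simps)
        then show ?thesis using d(2) by (simp add: distrib_left)
      qed
      finally show ?case using elim(2) L e unfolding Lf dist_real_def by linarith
    qed
  qed
  then show ?thesis unfolding I_def .
qed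

lemma positive_cubic_root_exists:
  fixes p q \<xi> y :: real
  assumes "p > 0" "q > 0" "\<xi> > 0" "y > 0"
  obtains U where "U > 0" "U * (U + p) * (U + p + q) = y * (\<xi> - U)"
proof -
  define h where "h t = t * (t + p) * (t + p + q) - y * (\<xi> - t)" for t
  have "continuous_on {0..\<xi>} h" unfolding h_def[abs_def] by (intro continuous_intros)
  moreover have "h 0 < 0" "h \<xi> \<ge> 0" using assms by (simp_all add: h_def)
  ultimately obtain t where t: "0 \<le> t" "h t = 0" using IVT'[of h 0 0 \<xi>] assms by auto
  then have "t \<noteq> 0" using \<open>h 0 < 0\<close> by auto
  then show ?thesis using that[of t] t by (simp add: h_def)
qed

theorem mainTheorem3:
  fixes p q \<xi> :: real and k n :: "nat \<Rightarrow> nat"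
  assumes "p > 0" and "q > 0" and "\<xi> > 0"
    and "filterlim k at_top sequentially"
    and "filterlim n at_top sequentially"
    and "(\<lambda>j. real (k j) / real (n j)) \<longlonglongrightarrow> \<xi>"
  shows "prob_space (nu1 p q \<xi>) \<and>
         weakly_converges (\<lambda>j. zero_measure p q (n j) (k j)) (nu1 p q \<xi>)"
proof
  note p = assms(1,2) and \<xi> = assms(3)
  show prob: "prob_space (nu1 p q \<xi>)" by (rule prob_space_nu1[OF p \<xi>])
  \<comment> \<open>The root description is available only for n > 0; the finitely many j with
    \<open>n j = 0\<close> do not affect the limit.\<close>
  have "\<exists>r. \<forall>j. n j > 0 \<longrightarrow> P_poly p q (n j) (k j) = (\<Prod>i<k j. [:- r j i, 1:]) \<and> (\<forall>i<k j. r j i > 0)"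
  proof (rule choice, rule allI)
    fix j
    show "\<exists>r. n j > 0 \<longrightarrow> P_poly p q (n j) (k j) = (\<Prod>i<k j. [:- r i, 1:]) \<and> (\<forall>i<k j. r i > 0)"
    proof (cases "n j > 0")
      case True
      from P_poly_positive_roots[OF p this, of "k j"] obtain r
        where "P_poly p q (n j) (k j) = (\<Prod>i<k j. [:- r i, 1:])" "\<And>i. i < k j \<Longrightarrow> r i > 0" by blast
      then show ?thesis by blast
    qed simp
  qed
  then obtain r where r: "\<And>j. n j > 0 \<Longrightarrow> P_poly p q (n j) (k j) = (\<Prod>i<k j. [:- r j i, 1:])"
    and r_pos: "\<And>j i. n j > 0 \<Longrightarrow> i < k j \<Longrightarrow> r j i > 0" by blast
  have n_pos: "eventually (\<lambda>j. n j > 0) sequentially"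
    using eventually_gt_at_top[of 0] assms(5) by (rule eventually_compose_filterlim)
  have k_pos: "eventually (\<lambda>j. k j > 0) sequentially"
    using eventually_gt_at_top[of 0] assms(4) by (rule eventually_compose_filterlim)
  have r_nonneg: "eventually (\<lambda>j. \<forall>i<k j. r j i \<ge> 0) sequentially"
    using n_pos by eventually_elim (auto simp: r_pos less_imp_le)
  have stieltjes: "(\<lambda>j. (\<Sum>i<k j. 1 / (y + r j i)) / real (k j)) \<longlonglongrightarrow> (\<integral>x. 1 / (y + x) \<partial>nu1 p q \<xi>)" if y: "y > 0" for y
  proof -
    obtain U where U: "U > 0" "U * (U + p) * (U + p + q) = y * (\<xi> - U)"
      using positive_cubic_root_exists[OF p \<xi> y] .
    show ?thesis unfolding stieltjes_nu1[OF p \<xi> y U]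
      by (rule stieltjes_zeros_limit[OF p \<xi> y _ U(2) assms(5,6) r r_pos]) (use U in auto)
  qed
  have sets: "sets (nu1 p q \<xi>) = sets borel" unfolding nu1_eq_distr[OF p \<xi>] by simp
  show "weakly_converges (\<lambda>j. zero_measure p q (n j) (k j)) (nu1 p q \<xi>)"
    unfolding weakly_converges_def
  proof (intro allI impI)
    fix f :: "real \<Rightarrow> real" assume f: "continuous_on UNIV f \<and> bounded (range f)"
    then have "(\<lambda>j. (\<Sum>i<k j. f (r j i)) / real (k j)) \<longlonglongrightarrow> (\<integral>x. f x \<partial>nu1 p q \<xi>)"
      by (intro weak_convergence_from_stieltjes[OF prob sets AE_nu1_nonneg[OF p \<xi>] k_pos r_nonneg stieltjes]) auto
    moreover have "eventually (\<lambda>j. (\<Sum>i<k j. f (r j i)) / real (k j) = (\<integral>x. f x \<partial>zero_measure p q (n j) (k j))) sequentially"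
      using n_pos
    proof eventually_elim
      case (elim j)
      have "f \<in> borel_measurable borel" using f by (intro borel_measurable_continuous_onI) auto
      then show ?case using integral_zero_measure[OF _ r[OF elim]] by simp
    qed
    ultimately show "(\<lambda>j. \<integral>x. f x \<partial>zero_measure p q (n j) (k j)) \<longlonglongrightarrow> (\<integral>x. f x \<partial>nu1 p q \<xi>)"
      by (rule Lim_transform_eventually)
  qed
qed

end
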